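(* The following discrete problem (the MSMFE-0 method) has a unique solution $(\sigma_h,u_h,\gamma_h)$: find $\sigma_h\in\mathbb X_h$, $u_h\in V_h$, $\gamma_h\in\mathbb W_h^0$ such that $$(A\sigma_h,\tau)_Q+(u_h,\operatorname{div}\tau)+(\gamma_h,\tau)=\langle g,\tau n\rangle_{\Gamma_D}\quad\forall\tau\in\mathbb X_h,$$ $$(\operatorname{div}\sigma_h,v)=(f,v)\quad\forall v\in V_h,$$ $$(\sigma_h,\xi)=0\quad\forall\xi\in\mathbb W_h^0.$$
   Context: $d\in\{2,3\}$; $\Omega\subset\mathbb R^d$ is a simply connected bounded polygonal (for $d=3$, polyhedral) domain with outward unit normal $n$; $\partial\Omega=\Gamma_D\cup\Gamma_N$ with $\Gamma_D\neq\emptyset$. $\mathbb M,\mathbb S,\mathbb N$ are the spaces of real $d\times d$ matrices, symmetric matrices and skew-symmetric matrices. The compliance tensor $A=A(x)$, $x\in\Omega$, is at each point a symmetric, bounded and uniformly positive definite linear operator $\mathbb S\to\mathbb S$, and it is assumed to extend to an operator $\mathbb M\to\mathbb M$ with the same properties. $f$ is a given vector field on $\Omega$ (body forces) and $g$ is the given displacement boundary data on $\Gamma_D$. The divergence of a matrix field is taken row-wise. $(\cdot,\cdot)$ is the $L^2(\Omega)$ inner product (with the Frobenius product $:$ for matrices), and $\langle\cdot,\cdot\rangle_S$ is the $L^2(S)$ inner product or duality pairing. $\mathbb X=\{\tau\in L^2(\Omega,\mathbb M):\operatorname{div}\tau\in L^2(\Omega,\mathbb R^d),\ \tau n=0\text{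 on }\Gamma_N\}$, $V=L^2(\Omega,\mathbb R^d)$, $\mathbb W=L^2(\Omega,\mathbb N)$. $\mathcal T_h$ is a shape-regular and quasi-uniform finite element partition of $\Omega$ into triangles ($d=2$) or tetrahedra ($d=3$) of maximum diameter $h$. With $\mathcal P_k(E)$ the polynomials of degree at most $k$ on $E$, the finite element spaces are $\mathbb X_h=\{\tau\in\mathbb X:\tau|_E\in\mathcal P_1(E)^{d\times d}\ \forall E\in\mathcal T_h\}$ (each row in the lowest order Brezzi-Douglas-Marini space), $V_h=\{v\in V: v|_E\in\mathcal P_0(E)^d\ \forall E\in\mathcal T_h\}$, $\mathbb W_h^0=\{\xi\in\mathbb W:\xi|_E\text{ is a constant skew-symmetric matrix }\forall E\in\mathcal T_h\}$. Vertex quadrature: for an element $E$ with vertices $\mathbf r_1,\dots,\mathbf r_s$, $s=d+1$, and $\chi,\tau\in\mathbb X_h$, $(A\chi,\tau)_{Q,E}=\frac{|E|}{s}\sum_{i=1}^sA\chi(\mathbf r_i):\tau(\mathbf r_i)$, with the values at $\mathbf r_i$ taken from within $E$, and $(A\chi,\tau)_Q=\sum_{E\in\mathcal T_h}(A\chi,\tau)_{Q,E}$.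
   Formalization: The partition is assumed to resolve Γ_D and Γ_N: each boundary facet lies, up to its relative boundary, in exactly one of them, and each is covered by its facets. Without this the claim fails, e.g. for Γ_D a single point and Γ_N = ∂Ω. Domains with slits are excluded. *)

theory Defs
  imports "HOL-Analysis.Analysis"
begin

text \<open>
  Elements of the Lebesgue spaces are represented by functions on the whole space; functions that
  agree almost everywhere on the domain represent the same element. The Frobenius product of
  matrices is the inner product of the type \<^typ>\<open>real^'n^'n\<close>.
\<close>

subsection \<open>Function spaces\<close>

definition L2 :: "(real^'n) set \<Rightarrow> (real^'n \<Rightarrow> 'b::euclidean_space) set" where
  "L2 \<Omega> = {\<phi>. \<phi> \<in> borel_measurable (lebesgue_on \<Omega>) \<and>
               integrable (lebesgue_on \<Omega>) (\<lambda>x. (norm (\<phi> x))\<^sup>2)}"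

definition L2_inner ::
    "(real^'n) set \<Rightarrow> (real^'n \<Rightarrow> 'b::euclidean_space) \<Rightarrow> (real^'n \<Rightarrow> 'b) \<Rightarrow> real" where
  "L2_inner \<Omega> \<phi> \<psi> = (LINT x|lebesgue_on \<Omega>. \<phi> x \<bullet> \<psi> x)"

definition skew :: "real^'n^'n \<Rightarrow> bool" where
  "skew M \<longleftrightarrow> transpose M = - M"

definition grad :: "(real^'n \<Rightarrow> real) \<Rightarrow> real^'n \<Rightarrow> real^'n" where
  "grad \<phi> x = (\<chi> i. frechet_derivative \<phi> (at x) (axis i 1))"

primrec C_k :: "nat \<Rightarrow> (real^'n \<Rightarrow> real) \<Rightarrow> bool" where
  "C_k 0 \<phi> \<longleftrightarrow> continuous_on UNIV \<phi>"
| "C_k (Suc k) \<phi> \<longleftrightarrow> \<phi> differentiable_on UNIV \<and> (\<forall>i. C_k k (\<lambda>x. grad \<phi> x $ i))"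

definition smooth :: "(real^'n \<Rightarrow> real) \<Rightarrow> bool" where
  "smooth \<phi> \<longleftrightarrow> (\<forall>k. C_k k \<phi>)"

definition test_function :: "(real^'n) set \<Rightarrow> (real^'n \<Rightarrow> real) \<Rightarrow> bool" where
  "test_function \<Omega> \<phi> \<longleftrightarrow> smooth \<phi> \<and> compact (closure {x. \<phi> x \<noteq> 0}) \<and> closure {x. \<phi> x \<noteq> 0} \<subseteq> \<Omega>"

text \<open>The row-wise distributional divergence; as a function it is determined almost everywhere.\<close>

definition has_weak_div ::
    "(real^'n) set \<Rightarrow> (real^'n \<Rightarrow> real^'n^'n) \<Rightarrow> (real^'n \<Rightarrow> real^'n) \<Rightarrow> bool" where
  "has_weak_div \<Omega> \<tau> w \<longleftrightarrow> w \<in> L2 \<Omega> \<and>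
     (\<forall>\<phi>. test_function \<Omega> \<phi> \<longrightarrow>
        (LINT x|lebesgue_on \<Omega>. \<tau> x *v grad \<phi> x) = - (LINT x|lebesgue_on \<Omega>. \<phi> x *\<^sub>R w x))"

definition weak_div ::
    "(real^'n) set \<Rightarrow> (real^'n \<Rightarrow> real^'n^'n) \<Rightarrow> real^'n \<Rightarrow> real^'n" where
  "weak_div \<Omega> \<tau> = (SOME w. has_weak_div \<Omega> \<tau> w)"

text \<open>
  The normal trace of a field in \<open>H(div)\<close> is the functional given by Green's formula. It vanishes on
  the part of the boundary complementary to \<open>\<Gamma>\<^sub>D\<close> if it annihilates the functions that are zero
  on \<open>\<Gamma>\<^sub>D\<close>.
\<close>

definition zero_normal_trace_off ::
    "(real^'n) set \<Rightarrow> (real^'n) set \<Rightarrow> (real^'n \<Rightarrow> real^'n^'n) \<Rightarrow> bool" where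
  "zero_normal_trace_off \<Omega> \<Gamma>D \<tau> \<longleftrightarrow>
     (\<forall>\<phi>. smooth \<phi> \<and> (\<forall>x\<in>\<Gamma>D. \<phi> x = 0) \<longrightarrow>
        (LINT x|lebesgue_on \<Omega>. \<tau> x *v grad \<phi> x) +
        (LINT x|lebesgue_on \<Omega>. \<phi> x *\<^sub>R weak_div \<Omega> \<tau> x) = 0)"

definition XX :: "(real^'n) set \<Rightarrow> (real^'n) set \<Rightarrow> (real^'n \<Rightarrow> real^'n^'n) set" where
  "XX \<Omega> \<Gamma>D = {\<tau>. \<tau> \<in> L2 \<Omega> \<and> (\<exists>w. has_weak_div \<Omega> \<tau> w) \<and> zero_normal_trace_off \<Omega> \<Gamma>D \<tau>}"

definition VV :: "(real^'n) set \<Rightarrow> (real^'n \<Rightarrow> real^'n) set" where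
  "VV \<Omega> = L2 \<Omega>"

definition WW :: "(real^'n) set \<Rightarrow> (real^'n \<Rightarrow> real^'n^'n) set" where
  "WW \<Omega> = {\<xi> \<in> L2 \<Omega>. AE x in lebesgue_on \<Omega>. skew (\<xi> x)}"


subsection \<open>Domain, partitions and boundary facets\<close>

text \<open>The regularity condition \<open>\<Omega> = interior (closure \<Omega>)\<close> excludes slits, on which there is no
  outward normal.\<close>

definition polyhedral_domain :: "(real^'n) set \<Rightarrow> bool" where
  "polyhedral_domain \<Omega> \<longleftrightarrow> open \<Omega> \<and> connected \<Omega> \<and> \<Omega> \<noteq> {} \<and> bounded \<Omega> \<and>
     \<Omega> = interior (closure \<Omega>) \<and>
     (\<exists>\<P>. finite \<P> \<and> (\<forall>P\<in>\<P>. polytope P) \<and> closure \<Omega> = \<Union>\<P>)"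

text \<open>Elements are closed simplices of full dimension, any two of which meet in a common face.\<close>

definition fe_partition :: "(real^'n) set \<Rightarrow> (real^'n) set set \<Rightarrow> bool" where
  "fe_partition \<Omega> \<T> \<longleftrightarrow> triangulation \<T> \<and> (\<forall>E\<in>\<T>. (int CARD('n)) simplex E) \<and> \<Union>\<T> = closure \<Omega>"

definition mesh_size :: "(real^'n) set set \<Rightarrow> real" where
  "mesh_size \<T> = Max (diameter ` \<T>)"

definition inradius :: "(real^'n) set \<Rightarrow> real" where
  "inradius E = Sup {r. 0 \<le> r \<and> (\<exists>x. cball x r \<subseteq> E)}"

definition shape_regular :: "real set \<Rightarrow> (real \<Rightarrow> (real^'n) set set) \<Rightarrow> bool" where
  "shape_regular H \<T> \<longleftrightarrow> (\<exists>\<kappa>. \<forall>h\<in>H. \<forall>E\<in>\<T> h. diameter E \<le> \<kappa> * inradius E)"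

definition quasi_uniform :: "real set \<Rightarrow> (real \<Rightarrow> (real^'n) set set) \<Rightarrow> bool" where
  "quasi_uniform H \<T> \<longleftrightarrow> (\<exists>c. \<forall>h\<in>H. \<forall>E\<in>\<T> h. mesh_size (\<T> h) \<le> c * diameter E)"

definition vertices :: "(real^'n) set \<Rightarrow> (real^'n) set" where
  "vertices E = {r. r extreme_point_of E}"

definition boundary_facets ::
    "(real^'n) set \<Rightarrow> (real^'n) set set \<Rightarrow> ((real^'n) set \<times> (real^'n) set) set" where
  "boundary_facets \<Omega> \<T> = {(E, F). E \<in> \<T> \<and> F facet_of E \<and> F \<subseteq> frontier \<Omega>}"

text \<open>Lower-dimensional parts of facets may belong to a boundary part or not, so that
  the boundary parts may be closed or relatively open.\<close>

definition facets_in ::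
    "(real^'n) set \<Rightarrow> (real^'n) set set \<Rightarrow> (real^'n) set \<Rightarrow> ((real^'n) set \<times> (real^'n) set) set" where
  "facets_in \<Omega> \<T> \<Gamma> = {(E, F) \<in> boundary_facets \<Omega> \<T>. rel_interior F \<subseteq> \<Gamma>}"

definition resolves_boundary_parts ::
    "(real^'n) set \<Rightarrow> (real^'n) set \<Rightarrow> (real^'n) set \<Rightarrow> (real^'n) set set \<Rightarrow> bool" where
  "resolves_boundary_parts \<Omega> \<Gamma>D \<Gamma>N \<T> \<longleftrightarrow>
     (\<forall>(E, F) \<in> boundary_facets \<Omega> \<T>.
        rel_interior F \<subseteq> \<Gamma>D - \<Gamma>N \<or> rel_interior F \<subseteq> \<Gamma>N - \<Gamma>D) \<and>
     \<Gamma>D \<subseteq> (\<Union>(E, F) \<in> facets_in \<Omega> \<T> \<Gamma>D. F) \<and>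
     \<Gamma>N \<subseteq> (\<Union>(E, F) \<in> facets_in \<Omega> \<T> \<Gamma>N. F)"

definition outward_normal :: "(real^'n) set \<Rightarrow> (real^'n) set \<Rightarrow> real^'n" where
  "outward_normal E F = (THE \<nu>. norm \<nu> = 1 \<and> (\<forall>x\<in>F. \<forall>y\<in>E. \<nu> \<bullet> (y - x) \<le> 0))"

text \<open>
  Surface integration over a flat facet \<open>F\<close> with unit normal \<open>\<nu>\<close>: by Fubini, the surface
  measure of \<open>F\<close> is the image of the Lebesgue measure on the prism over \<open>F\<close> of height 1
  under the orthogonal projection of the prism onto \<open>F\<close>.
\<close>

definition prism :: "(real^'n) set \<Rightarrow> real^'n \<Rightarrow> (real^'n) set" where
  "prism F \<nu> = {x + t *\<^sub>R \<nu> | x t. x \<in> F \<and> 0 \<le> t \<and> t \<le> 1}"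

definition foot :: "(real^'n) set \<Rightarrow> real^'n \<Rightarrow> real^'n \<Rightarrow> real^'n" where
  "foot F \<nu> y = (let a = (SOME a. a \<in> F) in y - ((y - a) \<bullet> \<nu>) *\<^sub>R \<nu>)"

definition L2_facets ::
    "((real^'n) set \<times> (real^'n) set) set \<Rightarrow> (real^'n \<Rightarrow> 'b::euclidean_space) set" where
  "L2_facets \<F> = {g. \<forall>(E, F)\<in>\<F>.
     (\<lambda>y. g (foot F (outward_normal E F) y)) \<in> L2 (prism F (outward_normal E F))}"

definition facet_integral :: "(real^'n) set \<Rightarrow> real^'n \<Rightarrow> (real^'n \<Rightarrow> real) \<Rightarrow> real" where
  "facet_integral F \<nu> \<phi> = (LINT y|lebesgue_on (prism F \<nu>). \<phi> (foot F \<nu> y))"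


subsection \<open>Finite element spaces\<close>

definition poly_deg :: "nat \<Rightarrow> (real^'n \<Rightarrow> real) set" where
  "poly_deg k = {p. \<exists>c. \<forall>x. p x = (\<Sum>\<alpha> | (\<Sum>i\<in>UNIV. \<alpha> i) \<le> k. c \<alpha> * (\<Prod>i\<in>UNIV. (x $ i) ^ \<alpha> i))}"

text \<open>Piecewise polynomial fields are represented by functions that are polynomial on the open
  elements; their values on the element boundaries, which form a null set, are irrelevant.\<close>

definition XX_h ::
    "(real^'n) set \<Rightarrow> (real^'n) set \<Rightarrow> (real^'n) set set \<Rightarrow> (real^'n \<Rightarrow> real^'n^'n) set" where
  "XX_h \<Omega> \<Gamma>D \<T> = {\<tau> \<in> XX \<Omega> \<Gamma>D. \<forall>E\<in>\<T>. \<exists>P.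
     (\<forall>i j. (\<lambda>x. P x $ i $ j) \<in> poly_deg 1) \<and> (\<forall>x\<in>interior E. \<tau> x = P x)}"

definition VV_h :: "(real^'n) set \<Rightarrow> (real^'n) set set \<Rightarrow> (real^'n \<Rightarrow> real^'n) set" where
  "VV_h \<Omega> \<T> = {v \<in> VV \<Omega>. \<forall>E\<in>\<T>. \<exists>P.
     (\<forall>i. (\<lambda>x. P x $ i) \<in> poly_deg 0) \<and> (\<forall>x\<in>interior E. v x = P x)}"

definition WW_h0 :: "(real^'n) set \<Rightarrow> (real^'n) set set \<Rightarrow> (real^'n \<Rightarrow> real^'n^'n) set" where
  "WW_h0 \<Omega> \<T> = {\<xi> \<in> WW \<Omega>. \<forall>E\<in>\<T>. \<exists>M. skew M \<and> (\<forall>x\<in>interior E. \<xi> x = M)}"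


subsection \<open>The compliance tensor and the discrete problem\<close>

definition compliance_tensor ::
    "(real^'n) set \<Rightarrow> (real^'n \<Rightarrow> (real^'n^'n) \<Rightarrow>\<^sub>L (real^'n^'n)) \<Rightarrow> bool" where
  "compliance_tensor K A \<longleftrightarrow>
     (\<forall>x\<in>K. \<forall>M. transpose M = M \<longrightarrow> transpose (blinfun_apply (A x) M) = blinfun_apply (A x) M) \<and>
     (\<forall>x\<in>K. \<forall>M N. blinfun_apply (A x) M \<bullet> N = M \<bullet> blinfun_apply (A x) N) \<and>
     (\<exists>C. \<forall>x\<in>K. norm (A x) \<le> C) \<and>
     (\<exists>a>0. \<forall>x\<in>K. \<forall>M. a * (norm M)\<^sup>2 \<le> blinfun_apply (A x) M \<bullet> M)"

text \<open>
  The value at \<open>r\<close> of a field given piecewise, taken from within the element \<open>E\<close>: the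
  one-sided limit from the interior of \<open>E\<close>. This limit always exists for piecewise polynomials.
  If a coefficient has no limit at \<open>r\<close>, then its point value is meant.
\<close>

definition value_from_within ::
    "(real^'n) set \<Rightarrow> (real^'n \<Rightarrow> 'b::t2_space) \<Rightarrow> real^'n \<Rightarrow> 'b" where
  "value_from_within E \<phi> r =
     (if \<exists>l. (\<phi> \<longlongrightarrow> l) (at r within interior E) then Lim (at r within interior E) \<phi> else \<phi> r)"

definition quad_elem ::
    "(real^'n \<Rightarrow> (real^'n^'n) \<Rightarrow>\<^sub>L (real^'n^'n)) \<Rightarrow> (real^'n) set \<Rightarrow>
     (real^'n \<Rightarrow> real^'n^'n) \<Rightarrow> (real^'n \<Rightarrow> real^'n^'n) \<Rightarrow> real" where
  "quad_elem A E \<sigma> \<tau> = measure lebesgue E / real (CARD('n) + 1) *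
     (\<Sum>r\<in>vertices E. blinfun_apply (value_from_within E A r) (value_from_within E \<sigma> r)
                        \<bullet> value_from_within E \<tau> r)"

definition quad ::
    "(real^'n) set set \<Rightarrow> (real^'n \<Rightarrow> (real^'n^'n) \<Rightarrow>\<^sub>L (real^'n^'n)) \<Rightarrow>
     (real^'n \<Rightarrow> real^'n^'n) \<Rightarrow> (real^'n \<Rightarrow> real^'n^'n) \<Rightarrow> real" where
  "quad \<T> A \<sigma> \<tau> = (\<Sum>E\<in>\<T>. quad_elem A E \<sigma> \<tau>)"

definition boundary_pairing ::
    "(real^'n) set \<Rightarrow> (real^'n) set \<Rightarrow> (real^'n) set set \<Rightarrow>
     (real^'n \<Rightarrow> real^'n) \<Rightarrow> (real^'n \<Rightarrow> real^'n^'n) \<Rightarrow> real" where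
  "boundary_pairing \<Omega> \<Gamma>D \<T> g \<tau> = (\<Sum>(E, F)\<in>facets_in \<Omega> \<T> \<Gamma>D.
     facet_integral F (outward_normal E F)
       (\<lambda>x. g x \<bullet> (value_from_within E \<tau> x *v outward_normal E F)))"

definition MSMFE0_solution ::
    "(real^'n) set \<Rightarrow> (real^'n) set \<Rightarrow> (real^'n) set set \<Rightarrow>
     (real^'n \<Rightarrow> (real^'n^'n) \<Rightarrow>\<^sub>L (real^'n^'n)) \<Rightarrow>
     (real^'n \<Rightarrow> real^'n) \<Rightarrow> (real^'n \<Rightarrow> real^'n) \<Rightarrow>
     (real^'n \<Rightarrow> real^'n^'n) \<Rightarrow> (real^'n \<Rightarrow> real^'n) \<Rightarrow> (real^'n \<Rightarrow> real^'n^'n) \<Rightarrow> bool" where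
  "MSMFE0_solution \<Omega> \<Gamma>D \<T> A f g \<sigma> u \<gamma> \<longleftrightarrow>
     \<sigma> \<in> XX_h \<Omega> \<Gamma>D \<T> \<and> u \<in> VV_h \<Omega> \<T> \<and> \<gamma> \<in> WW_h0 \<Omega> \<T> \<and>
     (\<forall>\<tau>\<in>XX_h \<Omega> \<Gamma>D \<T>. quad \<T> A \<sigma> \<tau> + L2_inner \<Omega> u (weak_div \<Omega> \<tau>) + L2_inner \<Omega> \<gamma> \<tau>
                         = boundary_pairing \<Omega> \<Gamma>D \<T> g \<tau>) \<and>
     (\<forall>v\<in>VV_h \<Omega> \<T>. L2_inner \<Omega> (weak_div \<Omega> \<sigma>) v = L2_inner \<Omega> f v) \<and>
     (\<forall>\<xi>\<in>WW_h0 \<Omega> \<T>. L2_inner \<Omega> \<sigma> \<xi> = 0)"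

end

theory Submission
  imports Defs
begin

text \<open>
  Modulo functions that vanish almost everywhere, the method is a square linear problem on the
  finite-dimensional space of triples of a stress, a displacement and a rotation, so existence follows
  from uniqueness
  (\<open>finite_dimensional_variational_problem_solvable\<close>). Let a triple \<open>(\<sigma>, u, \<gamma>)\<close> solve the homogeneous
  problem. Testing with \<open>(\<sigma>, - u, - \<gamma>)\<close> leaves the quadrature form at \<open>\<sigma>\<close>; by coercivity \<open>\<sigma>\<close> is zero at
  all vertices of all elements, and hence zero. It remains that \<open>u\<close> and \<open>\<gamma>\<close> vanish if
  \<open>(u, div \<tau>) + (\<gamma>, \<tau>) = 0\<close> for all discrete stresses \<open>\<tau>\<close> (\<open>discrete_kernel_trivial\<close>).

  For this, let \<open>F\<close> be a facet of the element \<open>E\<close> opposite the vertex \<open>a\<close>, let \<open>r\<close> be a vertex of \<open>F\<close>, and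
  let \<open>w\<close> be a vector. On \<open>E\<close>, the field \<open>w (r - a)\<^sup>T\<close> times the barycentric coordinate of \<open>r\<close>, divided by
  the volume of \<open>E\<close>, has constant divergence, and its normal component vanishes on all facets except
  \<open>F\<close>. If \<open>F\<close> lies on the Dirichlet boundary, this field alone is a discrete stress; if \<open>F\<close> is shared with
  an element \<open>E'\<close> with opposite vertex \<open>b\<close>, the difference of the two fields is one. As \<open>u\<close> and \<open>\<gamma>\<close> are
  constant on \<open>E\<close>, with values \<open>U\<close> and \<open>G\<close>, the orthogonality says that \<open>U + G (r - a) / (d + 1)\<close> vanishes
  in the first case and agrees with its counterpart on \<open>E'\<close> in the second. If it vanishes for all
  vertices \<open>r\<close> of one facet, then \<open>G\<close> maps the edges \<open>r - a\<close>, which span the space, to one and the same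
  vector. This vector is orthogonal to all of them since \<open>G\<close> is skew-symmetric. So it is zero, and \<open>U = 0\<close>
  and \<open>G = 0\<close> (\<open>skew_field_on_facet_edges_eq_0\<close>). The values zero thus spread from an element at the
  Dirichlet boundary across facets to the whole mesh, because the elements of a connected domain cannot
  be divided into two classes without a common facet (\<open>shared_facet_between_parts\<close>).

  Two analytic facts are behind this. The test fields have to satisfy Green's formula. It is
  reduced to functions that vanish at both ends of each chord of a simplex in a fixed direction, for
  which it expresses the translation invariance of the Lebesgue measure (\<open>set_integral_directional_derivative_eq_0\<close>);
  the two sides of a shared facet are compared by an affine map (\<open>flux_integral_shared_facet\<close>). And
  the weak divergence has to be unique almost everywhere, which rests on an approximation of the
  indicators of open sets by test functions (\<open>test_functions_approximate_open_set\<close>).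
\<close>

section \<open>Solvability of finite-dimensional linear problems\<close>

text \<open>Finite element functions are not the elements of a type of their own. Linearity is therefore stated on a
set \<open>S\<close> that is closed under an operation \<open>comb c x y\<close>, which stands for \<open>c x +
y\<close>.\<close>

definition linear_wrt :: "(real \<Rightarrow> 'a \<Rightarrow> 'a \<Rightarrow> 'a) \<Rightarrow> 'a set \<Rightarrow> ('a \<Rightarrow> real) \<Rightarrow> bool" where
  "linear_wrt comb S f \<longleftrightarrow> (\<forall>c. \<forall>x\<in>S. \<forall>y\<in>S. f (comb c x y) = c * f x + f y)"

lemma linear_wrtD:
  "linear_wrt comb S f \<Longrightarrow> x \<in> S \<Longrightarrow> y \<in> S \<Longrightarrow> f (comb c x y) = c * f x + f y"
  by (auto simp: linear_wrt_def)

text \<open>Induction on the number of functionals. On the kernel of \<open>B k\<close> the functional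
\<open>L\<close> is a combination of the others, and one vector outside this kernel determines the coefficient of
\<open>B k\<close>.\<close>

lemma functional_in_span_if_vanishes_on_common_kernel:
  fixes B :: "'i \<Rightarrow> 'a \<Rightarrow> real"
  assumes "finite J"
    and "\<And>c x y. x \<in> S \<Longrightarrow> y \<in> S \<Longrightarrow> comb c x y \<in> S"
    and "\<And>j. j \<in> J \<Longrightarrow> linear_wrt comb S (B j)" "linear_wrt comb S L"
    and "\<And>y. y \<in> S \<Longrightarrow> \<forall>j\<in>J. B j y = 0 \<Longrightarrow> L y = 0"
  shows "\<exists>c. \<forall>y\<in>S. L y = (\<Sum>j\<in>J. c j * B j y)"
  using assms
proof (induction J arbitrary: S rule: finite_induct)
  case empty
  then show ?case by auto
next
  case (insert k J)
  note lin = linear_wrtD[OF insert.prems(2)] linear_wrtD[OF insert.prems(3)]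
  let ?S = "{y \<in> S. B k y = 0}"
  have "\<exists>c. \<forall>y\<in>?S. L y = (\<Sum>j\<in>J. c j * B j y)"
  proof (rule insert.IH)
    show "comb c x y \<in> ?S" if "x \<in> ?S" "y \<in> ?S" for c x y
      using that insert.prems(1) lin(1)[of k] by auto
    show "linear_wrt comb ?S (B j)" if "j \<in> J" for j
      using insert.prems(2)[of j] that by (auto simp: linear_wrt_def)
    show "linear_wrt comb ?S L"
      using insert.prems(3) by (auto simp: linear_wrt_def)
  qed (use insert.prems(4) in auto)
  then obtain c where c: "\<And>y. y \<in> ?S \<Longrightarrow> L y = (\<Sum>j\<in>J. c j * B j y)" by blast
  show ?case
  proof (cases "\<exists>z\<in>S. B k z \<noteq> 0")
    case False
    then show ?thesis
      using c insert.hyps by (intro exI[of _ c]) auto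
  next
    case True
    then obtain z where z: "z \<in> S" "B k z \<noteq> 0" by blast
    \<comment> \<open>the coefficient of \<open>B k\<close> for which the combination agrees with \<open>L\<close> at \<open>z\<close>\<close>
    define d where "d = (L z - (\<Sum>j\<in>J. c j * B j z)) / B k z"
    have "L y = (\<Sum>j\<in>J. c j * B j y) + d * B k y" if y: "y \<in> S" for y
    proof -
      define t where "t = - (B k y / B k z)"
      have k: "comb t z y \<in> ?S"
        using y z insert.prems(1) lin(1)[of k z y t] by (auto simp: t_def)
      have "L (comb t z y) = (\<Sum>j\<in>J. c j * B j (comb t z y))"
        by (rule c[OF k])
      also have "\<dots> = (\<Sum>j\<in>J. t * (c j * B j z) + c j * B j y)"
        using lin(1) y z by (intro sum.cong) (auto simp: algebra_simps)
      finally have "t * L z + L y = t * (\<Sum>j\<in>J. c j * B j z) + (\<Sum>j\<in>J. c j * B j y)"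
        using lin(2) y z by (simp add: sum.distrib sum_distrib_left)
      then show ?thesis
        using z by (simp add: d_def t_def field_simps)
    qed
    then show ?thesis
      using insert.hyps by (intro exI[of _ "c(k := d)"]) (auto simp: add.commute intro!: sum.cong)
  qed
qed

text \<open>The functionals \<open>l i\<close> bound the dimension of \<open>S\<close> modulo the common kernel of the
\<open>B x\<close>, so that finitely many of the \<open>B x\<close> cut out their common kernel. Passing to the kernel
of a single \<open>l k\<close> lowers the dimension by at most one; hence one induction step adds at most one
functional \<open>B p\<close>.\<close>

lemma finite_subfamily_with_same_kernel:
  fixes l :: "'i \<Rightarrow> 'a \<Rightarrow> real" and B :: "'b \<Rightarrow> 'a \<Rightarrow> real"
  assumes "finite I"
    and "\<And>c x y. x \<in> S \<Longrightarrow> y \<in> S \<Longrightarrow> comb c x y \<in> S"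
    and "\<And>i. i \<in> I \<Longrightarrow> linear_wrt comb S (l i)"
    and "\<And>x. x \<in> X \<Longrightarrow> linear_wrt comb S (B x)"
    and "\<And>x y. x \<in> X \<Longrightarrow> y \<in> S \<Longrightarrow> \<forall>i\<in>I. l i y = 0 \<Longrightarrow> B x y = 0"
  shows "\<exists>J. finite J \<and> J \<subseteq> X \<and> (\<forall>y\<in>S. (\<forall>j\<in>J. B j y = 0) \<longrightarrow> (\<forall>x\<in>X. B x y = 0))"
  using assms
proof (induction I arbitrary: S rule: finite_induct)
  case empty
  then show ?case by (intro exI[of _ "{}"]) auto
next
  case (insert k I)
  note lin = linear_wrtD[OF insert.prems(2)] linear_wrtD[OF insert.prems(3)]
  let ?S = "{y \<in> S. l k y = 0}"
  have "\<exists>J. finite J \<and> J \<subseteq> X \<and> (\<forall>y\<in>?S. (\<forall>j\<in>J. B j y = 0) \<longrightarrow> (\<forall>x\<in>X. B x y = 0))"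
  proof (rule insert.IH)
    show "comb c x y \<in> ?S" if "x \<in> ?S" "y \<in> ?S" for c x y
      using that insert.prems(1) lin(1)[of k] by auto
    show "linear_wrt comb ?S (l j)" if "j \<in> I" for j
      using insert.prems(2)[of j] that by (auto simp: linear_wrt_def)
    show "linear_wrt comb ?S (B x)" if "x \<in> X" for x
      using insert.prems(3) that by (auto simp: linear_wrt_def)
  qed (use insert.prems(4) in auto)
  then obtain J where J: "finite J" "J \<subseteq> X"
      "\<And>y x. y \<in> ?S \<Longrightarrow> \<forall>j\<in>J. B j y = 0 \<Longrightarrow> x \<in> X \<Longrightarrow> B x y = 0"
    by blast
  show ?case
  proof (cases "\<forall>y\<in>S. (\<forall>j\<in>J. B j y = 0) \<longrightarrow> (\<forall>x\<in>X. B x y = 0)")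
    case True
    then show ?thesis using J by blast
  next
    case False
    then obtain z p where z: "z \<in> S" "\<forall>j\<in>J. B j z = 0" and p: "p \<in> X" "B p z \<noteq> 0" by blast
    have lz: "l k z \<noteq> 0" using J(3)[of z p] z p by auto
    have kernel: "B x y = 0" if y: "y \<in> S" "\<forall>j\<in>insert p J. B j y = 0" and x: "x \<in> X" for x y
    proof -
      define t where "t = - (l k y / l k z)"
      have k: "comb t z y \<in> ?S"
        using y z lz insert.prems(1) lin(1)[of k z y t] by (auto simp: t_def)
      have "\<forall>j\<in>J. B j (comb t z y) = 0"
        using y z J(2) lin(2) by auto
      note zero = J(3)[OF k this]
      have "t * B p z + B p y = 0"
        using zero[OF p(1)] lin(2)[OF p(1) z(1) y(1)] by simp
      then have "t = 0" using p y by auto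
      then show "B x y = 0"
        using zero[OF x] lin(2)[OF x z(1) y(1), of t] by simp
    qed
    show ?thesis
    proof (intro exI conjI ballI impI)
      show "finite (insert p J)" "insert p J \<subseteq> X" using J(1,2) p(1) by auto
      show "B x y = 0" if "y \<in> S" "\<forall>j\<in>insert p J. B j y = 0" "x \<in> X" for x y
        using that by (rule kernel)
    qed
  qed
qed

text \<open>The Fredholm alternative for a bilinear form: \<open>L\<close> vanishes on the common kernel of the
functionals \<open>B x\<close>, which is already the common kernel of finitely many of them, and so \<open>L\<close>
is a combination of these. The separating functionals \<open>l i\<close> take the place of a basis of
\<open>S\<close>; in the application they are point values, whereas a basis of the stress space would require a
description of its normal traces.\<close>

lemma finite_dimensional_variational_problem_solvable:
  fixes comb :: "real \<Rightarrow> 'a \<Rightarrow> 'a \<Rightarrow> 'a" and B :: "'a \<Rightarrow> 'a \<Rightarrow> real"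
  assumes "finite I"
    and zero: "z \<in> S" "\<And>y. y \<in> S \<Longrightarrow> B z y = 0"
    and comb: "\<And>c x y. x \<in> S \<Longrightarrow> y \<in> S \<Longrightarrow> comb c x y \<in> S"
    and l: "\<And>i. i \<in> I \<Longrightarrow> linear_wrt comb S (l i)"
    and B1: "\<And>y. y \<in> S \<Longrightarrow> linear_wrt comb S (\<lambda>x. B x y)"
    and B2: "\<And>x. x \<in> S \<Longrightarrow> linear_wrt comb S (B x)"
    and L: "linear_wrt comb S L"
    and sep: "\<And>x y. x \<in> S \<Longrightarrow> y \<in> S \<Longrightarrow> \<forall>i\<in>I. l i y = 0 \<Longrightarrow> B x y = 0"
    and ker: "\<And>y. y \<in> S \<Longrightarrow> \<forall>x\<in>S. B x y = 0 \<Longrightarrow> L y = 0"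
  obtains x where "x \<in> S" "\<And>y. y \<in> S \<Longrightarrow> B x y = L y"
proof -
  obtain J where J: "finite J" "J \<subseteq> S"
      "\<And>y. y \<in> S \<Longrightarrow> \<forall>j\<in>J. B j y = 0 \<Longrightarrow> \<forall>x\<in>S. B x y = 0"
    using finite_subfamily_with_same_kernel[of I S comb l S B, OF \<open>finite I\<close> comb l B2 sep] by blast
  obtain c where c: "\<And>y. y \<in> S \<Longrightarrow> L y = (\<Sum>j\<in>J. c j * B j y)"
    using functional_in_span_if_vanishes_on_common_kernel[of J S comb B L, OF J(1) comb B2 L] J ker
    by blast
  have "\<exists>x\<in>S. \<forall>y\<in>S. B x y = (\<Sum>j\<in>J. c j * B j y)"
    using J(1,2)
  proof (induction J rule: finite_induct)
    case empty
    then show ?case using zero by auto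
  next
    case (insert k J)
    then obtain x where x: "x \<in> S" "\<forall>y\<in>S. B x y = (\<Sum>j\<in>J. c j * B j y)" by auto
    have "\<forall>y\<in>S. B (comb (c k) k x) y = (\<Sum>j\<in>insert k J. c j * B j y)"
      using insert x linear_wrtD[OF B1] by auto
    then show ?case using comb insert.prems x by blast
  qed
  then show ?thesis using c that by auto
qed

section \<open>Barycentric coordinates\<close>

text \<open>The vertex set stands for the simplex, from which it is recovered as the set of extreme points.
Barycentric coordinates are indexed by it.\<close>

locale full_simplex =
  fixes C :: "'a::euclidean_space set"
  assumes indep: "\<not> affine_dependent C" and card: "card C = Suc (DIM('a))"
begin

lemma finite_C [simp]: "finite C"
  using indep aff_independent_finite by blast

lemma C_nonempty [simp]: "C \<noteq> {}"
  using card by auto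

definition bary :: "'a \<Rightarrow> 'a \<Rightarrow> real" where
  "bary c x = (SOME u. sum u C = 1 \<and> (\<Sum>v\<in>C. u v *\<^sub>R v) = x) c"

lemma bary_sum: "(\<Sum>c\<in>C. bary c x) = 1"
  and bary_combination: "(\<Sum>c\<in>C. bary c x *\<^sub>R c) = x"
proof -
  have "x \<in> affine hull C"
    using affine_independent_span_eq[OF indep card] by simp
  then have "\<exists>u. sum u C = 1 \<and> (\<Sum>v\<in>C. u v *\<^sub>R v) = x"
    by (auto simp: affine_hull_finite)
  from someI_ex[OF this] show "(\<Sum>c\<in>C. bary c x) = 1" "(\<Sum>c\<in>C. bary c x *\<^sub>R c) = x"
    unfolding bary_def by auto
qed

lemma bary_unique:
  assumes "sum u C = 1" "(\<Sum>v\<in>C. u v *\<^sub>R v) = x" "c \<in> C"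
  shows "bary c x = u c"
proof (rule ccontr)
  assume ne: "bary c x \<noteq> u c"
  have "sum (\<lambda>v. bary v x - u v) C = 0" "(\<Sum>v\<in>C. (bary v x - u v) *\<^sub>R v) = 0"
    using assms bary_sum[of x] bary_combination[of x]
    by (simp_all add: sum_subtractf scaleR_left_diff_distrib)
  then have "affine_dependent C"
    using ne \<open>c \<in> C\<close> by (auto simp: affine_dependent_explicit_finite intro!: exI[of _ "\<lambda>v. bary v x - u v"])
  then show False using indep by simp
qed

lemma bary_vertex: "c \<in> C \<Longrightarrow> r \<in> C \<Longrightarrow> bary c r = (if c = r then 1 else 0)"
proof -
  assume c: "c \<in> C" and r: "r \<in> C"
  have "(\<Sum>v\<in>C. (if v = r then 1 else 0) *\<^sub>R v) = (\<Sum>v\<in>C. if v = r then v else 0)"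
    by (intro sum.cong) auto
  then show ?thesis
    using c r bary_unique[of "\<lambda>v. if v = r then 1 else 0" r c] by (simp add: sum.delta)
qed

text \<open>By uniqueness it suffices that the proposed coordinates have sum one and reproduce the point.\<close>

lemma bary_affine:
  assumes "c \<in> C" shows "bary c (x + t *\<^sub>R (y - z)) = bary c x + t * (bary c y - bary c z)"
proof (rule bary_unique[OF _ _ assms])
  show "(\<Sum>c\<in>C. bary c x + t * (bary c y - bary c z)) = 1"
    using bary_sum[of x] bary_sum[of y] bary_sum[of z]
    by (simp add: sum.distrib sum_subtractf flip: sum_distrib_left)
  have "(\<Sum>v\<in>C. (bary v x + t * (bary v y - bary v z)) *\<^sub>R v) =
      (\<Sum>v\<in>C. bary v x *\<^sub>R v) + t *\<^sub>R ((\<Sum>v\<in>C. bary v y *\<^sub>R v) - (\<Sum>v\<in>C. bary v z *\<^sub>R v))"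
    by (simp add: sum.distrib sum_subtractf scaleR_left_distrib scaleR_left_diff_distrib right_diff_distrib
        scaleR_right_diff_distrib scaleR_sum_right)
  then show "(\<Sum>v\<in>C. (bary v x + t * (bary v y - bary v z)) *\<^sub>R v) = x + t *\<^sub>R (y - z)"
    by (simp add: bary_combination)
qed

definition bary_grad :: "'a \<Rightarrow> 'a" where
  "bary_grad c = adjoint (\<lambda>x. bary c x - bary c 0) 1"

lemma bary_eq: assumes "c \<in> C" shows "bary c x = bary c 0 + bary_grad c \<bullet> x"
proof -
  have "linear (\<lambda>x. bary c x - bary c 0)"
  proof (rule linearI)
    show "bary c (x + y) - bary c 0 = bary c x - bary c 0 + (bary c y - bary c 0)" for x y
      using bary_affine[OF assms, of x 1 y 0] by simp
    show "bary c (t *\<^sub>R x) - bary c 0 = t *\<^sub>R (bary c x - bary c 0)" for x t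
      using bary_affine[OF assms, of 0 t x 0] by simp
  qed
  from adjoint_works[OF this, of x 1] show ?thesis
    by (simp add: bary_grad_def inner_commute)
qed

text \<open>In the direction of the edge from \<open>a\<close> to \<open>r\<close> only two coordinates change. A line
in this direction enters the simplex through the facet opposite \<open>r\<close> and leaves it through the facet
opposite \<open>a\<close>.\<close>

lemma bary_translate:
  assumes "c \<in> C" "r \<in> C" "a \<in> C" "r \<noteq> a"
  shows "bary c (x + t *\<^sub>R (r - a)) = bary c x + t * (if c = r then 1 else if c = a then - 1 else 0)"
  using assms by (simp add: bary_affine bary_vertex)

lemma bary_grad_edge:
  assumes "c \<in> C" "r \<in> C" "a \<in> C" "r \<noteq> a"
  shows "bary_grad c \<bullet> (r - a) = (if c = r then 1 else if c = a then - 1 else 0)"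
  using bary_translate[OF assms, of 0 1] bary_eq[OF assms(1), of "r - a"] by simp

lemma hull_eq: "convex hull C = {x. \<forall>c\<in>C. 0 \<le> bary c x}"
proof (intro equalityI subsetI)
  fix x assume "x \<in> convex hull C"
  then obtain u where "\<forall>v\<in>C. 0 \<le> u v" "sum u C = 1" "(\<Sum>v\<in>C. u v *\<^sub>R v) = x"
    by (auto simp: convex_hull_finite)
  then show "x \<in> {x. \<forall>c\<in>C. 0 \<le> bary c x}"
    using bary_unique by auto
next
  fix x assume "x \<in> {x. \<forall>c\<in>C. 0 \<le> bary c x}"
  then show "x \<in> convex hull C"
    using bary_sum[of x] bary_combination[of x]
    by (auto simp: convex_hull_finite intro!: exI[of _ "\<lambda>c. bary c x"])
qed

lemma facet_eq:
  assumes "a \<in> C" shows "convex hull (C - {a}) = {x \<in> convex hull C. bary a x = 0}"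
proof (intro equalityI subsetI)
  fix x assume x: "x \<in> convex hull (C - {a})"
  then obtain u where u: "\<forall>v\<in>C - {a}. 0 \<le> u v" "sum u (C - {a}) = 1" "(\<Sum>v\<in>C - {a}. u v *\<^sub>R v) = x"
    by (auto simp: convex_hull_finite)
  have "bary a x = (u(a := 0)) a"
    using u by (intro bary_unique) (auto simp: assms sum.remove[OF finite_C assms])
  moreover have "x \<in> convex hull C"
    using x hull_mono[of "C - {a}" C] by blast
  ultimately show "x \<in> {x \<in> convex hull C. bary a x = 0}" by simp
next
  fix x assume x: "x \<in> {x \<in> convex hull C. bary a x = 0}"
  then have "sum (\<lambda>c. bary c x) (C - {a}) = 1" "(\<Sum>v\<in>C - {a}. bary v x *\<^sub>R v) = x"
    using bary_sum[of x] bary_combination[of x] by (simp_all add: sum.remove[OF finite_C assms])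
  then show "x \<in> convex hull (C - {a})"
    using x by (auto simp: convex_hull_finite hull_eq intro!: exI[of _ "\<lambda>c. bary c x"])
qed

lemma compact_hull: "compact (convex hull C)"
  by (simp add: finite_imp_compact_convex_hull)

lemma interior_hull_nonempty: "interior (convex hull C) \<noteq> {}"
  by (metis affine_independent_span_eq C_nonempty affine_hull_convex_hull card convex_convex_hull
      convex_hull_eq_empty indep rel_interior_eq_empty rel_interior_interior)

lemma closure_interior_hull: "closure (interior (convex hull C)) = convex hull C"
  using convex_closure_interior[OF convex_convex_hull interior_hull_nonempty] compact_hull
  by (simp add: closure_closed compact_imp_closed)

text \<open>The edges that start at \<open>a\<close> span the whole space.\<close>

lemma facet_edges_span:
  assumes "a \<in> C" "\<And>r. r \<in> C - {a} \<Longrightarrow> (r - a) \<bullet> b = 0"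
  shows "b = 0"
proof -
  have "(x - a) \<bullet> b = 0" for x
  proof -
    have "x - a = (\<Sum>c\<in>C. bary c x *\<^sub>R (c - a))"
      using bary_sum[of x] bary_combination[of x]
      by (simp add: scaleR_right_diff_distrib sum_subtractf flip: scaleR_left.sum)
    then have "(x - a) \<bullet> b = (\<Sum>c\<in>C. bary c x * ((c - a) \<bullet> b))"
      by (simp add: inner_sum_left)
    also have "\<dots> = 0"
      using assms by (intro sum.neutral) (metis DiffI cancel_comm_monoid_add_class.diff_cancel inner_zero_left mult_zero_right singletonD)
    finally show ?thesis .
  qed
  from this[of "a + b"] show ?thesis by simp
qed

end

section \<open>Lebesgue integrals, affine maps and directional derivatives\<close>

lemma lborel_uminus: "distr lborel borel uminus = (lborel :: 'a::euclidean_space measure)"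
  by (subst (2) lborel_affine[of "- 1" 0]) (simp_all add: density_1)

text \<open>Uniqueness of the Haar measure. For nonnegative \<open>f\<close> and \<open>g\<close>, the double integral
of \<open>f (x + L y) * g (L y)\<close> is computed in both orders, which gives \<open>(\<integral> f) (\<integral> g
\<circ> L) = (\<integral> f \<circ> L) (\<integral> g)\<close>; with the indicator of the unit cube for
\<open>f\<close> this says that the image measure is a multiple of the Lebesgue measure. The factor remains
unspecified, because it cancels in the mean values over simplices formed below.\<close>

lemma distr_lborel_linear:
  fixes L :: "'a::euclidean_space \<Rightarrow> 'a"
  assumes L: "linear L" "inj L"
  obtains c :: real where "0 \<le> c" "distr lborel borel L = density lborel (\<lambda>_. ennreal c)"
proof -
  obtain M where M: "linear M" "\<And>x. M (L x) = x" "\<And>x. L (M x) = x"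
    using linear_injective_isomorphism[OF L] by blast
  have [measurable]: "L \<in> borel_measurable borel" "M \<in> borel_measurable borel"
    using L(1) M(1) by (auto intro!: borel_measurable_continuous_onI linear_continuous_on
        simp: linear_conv_bounded_linear)
  have shift: "(\<integral>\<^sup>+x. f (x + a) \<partial>lborel) = (\<integral>\<^sup>+x. f x \<partial>lborel)"
    if [measurable]: "f \<in> borel_measurable borel" for f :: "'a \<Rightarrow> ennreal" and a
  proof -
    have "(\<integral>\<^sup>+x. f x \<partial>lborel) = (\<integral>\<^sup>+x. f x \<partial>distr lborel borel ((+) a))"
      by (simp add: lborel_distr_plus)
    also have "\<dots> = (\<integral>\<^sup>+x. f (a + x) \<partial>lborel)"
      by (subst nn_integral_distr) auto
    finally show ?thesis by (simp add: add.commute)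
  qed
  have reflect: "(\<integral>\<^sup>+x. f (a - x) \<partial>lborel) = (\<integral>\<^sup>+x. f x \<partial>lborel)"
    if [measurable]: "f \<in> borel_measurable borel" for f :: "'a \<Rightarrow> ennreal" and a
  proof -
    have "(\<integral>\<^sup>+x. f (a + x) \<partial>lborel) = (\<integral>\<^sup>+x. f (a + x) \<partial>distr lborel borel uminus)"
      by (simp add: lborel_uminus)
    also have "\<dots> = (\<integral>\<^sup>+x. f (a - x) \<partial>lborel)"
      by (subst nn_integral_distr) auto
    finally show ?thesis using shift[OF that, of a] by (simp add: add.commute)
  qed
  have swap: "(\<integral>\<^sup>+x. f x \<partial>lborel) * (\<integral>\<^sup>+y. g (L y) \<partial>lborel) = (\<integral>\<^sup>+x. f (L x) \<partial>lborel) * (\<integral>\<^sup>+y. g y \<partial>lborel)"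
    if [measurable]: "f \<in> borel_measurable borel" "g \<in> borel_measurable borel" for f g :: "'a \<Rightarrow> ennreal"
  proof -
    have "(\<integral>\<^sup>+x. f x \<partial>lborel) * (\<integral>\<^sup>+y. g (L y) \<partial>lborel) = (\<integral>\<^sup>+y. (\<integral>\<^sup>+x. f (x + L y) \<partial>lborel) * g (L y) \<partial>lborel)"
      by (simp add: shift nn_integral_cmult)
    also have "\<dots> = (\<integral>\<^sup>+y. (\<integral>\<^sup>+x. f (x + L y) * g (L y) \<partial>lborel) \<partial>lborel)"
      by (simp add: nn_integral_multc)
    also have "\<dots> = (\<integral>\<^sup>+x. (\<integral>\<^sup>+y. f (x + L y) * g (L y) \<partial>lborel) \<partial>lborel)"
      by (rule lborel_pair.Fubini') measurable
    also have "\<dots> = (\<integral>\<^sup>+x. (\<integral>\<^sup>+y. f (L y) * g (L y - x) \<partial>lborel) \<partial>lborel)"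
    proof (rule nn_integral_cong)
      fix x
      show "(\<integral>\<^sup>+y. f (x + L y) * g (L y) \<partial>lborel) = (\<integral>\<^sup>+y. f (L y) * g (L y - x) \<partial>lborel)"
        using shift[of "\<lambda>y. f (L y) * g (L y - x)" "M x"]
        by (simp add: linear_add[OF L(1)] M(3) add.commute)
    qed
    also have "\<dots> = (\<integral>\<^sup>+y. (\<integral>\<^sup>+x. f (L y) * g (L y - x) \<partial>lborel) \<partial>lborel)"
      by (rule lborel_pair.Fubini') measurable
    also have "\<dots> = (\<integral>\<^sup>+y. f (L y) * (\<integral>\<^sup>+x. g x \<partial>lborel) \<partial>lborel)"
      by (simp add: nn_integral_cmult reflect)
    finally show ?thesis by (simp add: nn_integral_multc)
  qed
  define Q :: "'a set" where "Q = cbox 0 One"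
  have Q [measurable]: "Q \<in> sets borel" and Q1: "emeasure lborel Q = 1"
    by (auto simp: Q_def emeasure_lborel_cbox_eq inner_diff_left)
  define c where "c = emeasure lborel (L -` Q)"
  have "bounded (M ` Q)"
    using M(1) by (intro bounded_linear_image) (auto simp: Q_def linear_conv_bounded_linear)
  moreover have "L -` Q = M ` Q"
  proof (intro set_eqI iffI)
    fix x assume "x \<in> L -` Q"
    then show "x \<in> M ` Q" using M(2)[of x] by (metis image_eqI vimageD)
  qed (use M(3) in auto)
  ultimately have "c < \<infinity>"
    using emeasure_bounded_finite by (auto simp: c_def)
  have em: "emeasure lborel (L -` A) = c * emeasure lborel A" if [measurable]: "A \<in> sets borel" for A
  proof -
    have [simp]: "L -` B \<in> sets borel" if "B \<in> sets borel" for B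
      using measurable_sets_borel[of L borel B] that by simp
    show ?thesis
      using swap[of "indicator Q" "indicator A"] Q1 by (simp add: c_def indicator_vimage[symmetric])
  qed
  show ?thesis
  proof
    show "distr lborel borel L = density lborel (\<lambda>_. ennreal (enn2real c))"
    proof (rule measure_eqI)
      fix A assume "A \<in> sets (distr lborel borel L)"
      then have [measurable]: "A \<in> sets borel" by simp
      show "emeasure (distr lborel borel L) A = emeasure (density lborel (\<lambda>_. ennreal (enn2real c))) A"
        using em[of A] \<open>c < \<infinity>\<close> by (simp add: emeasure_distr emeasure_density_const)
    qed simp
  qed simp
qed

lemma set_integral_affine_image:
  fixes L :: "'a::euclidean_space \<Rightarrow> 'a"
  assumes L: "linear L" "inj L"
  shows "\<exists>c. \<forall>E f. E \<in> sets borel \<longrightarrow> (\<lambda>x. z + L x) ` E \<in> sets borel \<longrightarrow> f \<in> borel_measurable borel \<longrightarrow>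
      (LINT x:E|lborel. f (z + L x)) = c * (LINT x:(\<lambda>x. z + L x) ` E|lborel. (f x :: real))"
proof -
  obtain c :: real where c: "0 \<le> c" "distr lborel borel L = density lborel (\<lambda>_. ennreal c)"
    using distr_lborel_linear[OF L] .
  have [measurable]: "L \<in> borel_measurable borel"
    using L(1) by (auto intro!: borel_measurable_continuous_onI linear_continuous_on
        simp: linear_conv_bounded_linear)
  have shift: "(LINT x|lborel. g (z + x)) = (LINT x|lborel. g x)"
    if [measurable]: "g \<in> borel_measurable borel" for g :: "'a \<Rightarrow> real"
  proof -
    have "(LINT x|lborel. g x) = (LINT x|distr lborel borel ((+) z). g x)"
      by (simp add: lborel_distr_plus)
    also have "\<dots> = (LINT x|lborel. g (z + x))"
      by (subst integral_distr) auto
    finally show ?thesis by simp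
  qed
  show ?thesis
  proof (intro exI[of _ c] allI impI)
    fix E and f :: "'a \<Rightarrow> real"
    let ?E = "(\<lambda>x. z + L x) ` E"
    assume [measurable]: "E \<in> sets borel" "?E \<in> sets borel" "f \<in> borel_measurable borel"
    have ind: "indicator ?E (z + L x) = (indicator E x :: real)" for x
      using \<open>inj L\<close> by (auto simp: indicator_def inj_eq)
    have "(LINT x:E|lborel. f (z + L x)) = (LINT x|lborel. indicator ?E (z + L x) *\<^sub>R f (z + L x))"
      by (simp add: set_lebesgue_integral_def ind)
    also have "\<dots> = (LINT x|distr lborel borel L. indicator ?E (z + x) *\<^sub>R f (z + x))"
      by (subst integral_distr) auto
    also have "\<dots> = c * (LINT x|lborel. indicator ?E (z + x) *\<^sub>R f (z + x))"
      using c(1) by (subst c(2), subst integral_density) auto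
    also have "\<dots> = c * (LINT x:?E|lborel. f x)"
      unfolding set_lebesgue_integral_def by (subst shift) auto
    finally show "(LINT x:E|lborel. f (z + L x)) = c * (LINT x:?E|lborel. f x)" .
  qed
qed

lemma integrable_cutoff_compact:
  fixes f :: "'a::euclidean_space \<Rightarrow> 'b::euclidean_space"
  assumes "compact E" "continuous_on E f"
  shows "integrable lborel (\<lambda>x. indicator E x *\<^sub>R f x)"
  using borel_integrable_compact[OF assms] .

text \<open>The divergence theorem in its simplest form. A step along \<open>v\<close> that leaves \<open>E\<close> is
at least as long as a step along \<open>v\<close> to a zero of \<open>H\<close> in \<open>E\<close>, so the extension
\<open>G\<close> of \<open>H\<close> by zero is Lipschitz continuous along \<open>v\<close>. The integrals of its
difference quotients vanish by translation invariance, and by dominated convergence they tend to the integral of the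
derivative of \<open>H\<close>; on the boundary of \<open>E\<close>, a null set, the quotients may fail to
converge.\<close>

lemma set_integral_directional_derivative_eq_0:
  fixes H :: "'a::euclidean_space \<Rightarrow> real"
  assumes E: "compact E" "convex E"
    and H: "\<And>x. (H has_derivative (\<lambda>k. D x \<bullet> k)) (at x)"
    and D: "continuous_on UNIV D"
    and exit: "\<And>x t. x \<in> E \<Longrightarrow> x + t *\<^sub>R v \<notin> E \<Longrightarrow>
                 \<exists>s. \<bar>s\<bar> \<le> \<bar>t\<bar> \<and> x + s *\<^sub>R v \<in> E \<and> H (x + s *\<^sub>R v) = 0"
  shows "(LINT x:E|lborel. D x \<bullet> v) = 0"
proof -
  define G where "G x = indicator E x *\<^sub>R H x" for x
  have contH: "continuous_on UNIV H"
    using H by (meson has_derivative_at_withinI has_derivative_continuous_on)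
  have G_int: "integrable lborel G"
    unfolding G_def using E contH by (intro integrable_cutoff_compact) (auto intro: continuous_on_subset)
  have [measurable]: "G \<in> borel_measurable borel"
    using borel_measurable_integrable[OF G_int] by simp
  have "bounded (D ` E)"
    using E D by (meson compact_continuous_image compact_imp_bounded continuous_on_subset top_greatest)
  then obtain B where B: "\<And>x. x \<in> E \<Longrightarrow> norm (D x) \<le> B" "0 \<le> B"
    unfolding bounded_pos by (metis imageI less_imp_le)
  have lip: "\<bar>H x - H y\<bar> \<le> B * norm (x - y)" if "x \<in> E" "y \<in> E" for x y
  proof -
    have "norm (H x - H y) \<le> B * norm (x - y)"
    proof (rule differentiable_bound[OF E(2) _ _ that(1,2)])
      show "(H has_derivative (\<lambda>k. D x \<bullet> k)) (at x within E)" for x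
        using H by (rule has_derivative_at_withinI)
      show "onorm (\<lambda>k. D x \<bullet> k) \<le> B" if "x \<in> E" for x
      proof (rule onorm_le)
        fix k
        have "\<bar>D x \<bullet> k\<bar> \<le> norm (D x) * norm k" by (rule Cauchy_Schwarz_ineq2)
        also have "\<dots> \<le> B * norm k" using B(1)[OF that] by (rule mult_right_mono) simp
        finally show "norm (D x \<bullet> k) \<le> B * norm k" by simp
      qed
    qed
    then show ?thesis by simp
  qed
  have zero: "\<bar>H x\<bar> \<le> B * norm v * \<bar>t\<bar>" if x: "x \<in> E" "x + t *\<^sub>R v \<notin> E" for x t
  proof -
    obtain s where s: "\<bar>s\<bar> \<le> \<bar>t\<bar>" "x + s *\<^sub>R v \<in> E" "H (x + s *\<^sub>R v) = 0"
      using exit[OF x] by blast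
    have "\<bar>H x\<bar> \<le> B * norm v * \<bar>s\<bar>"
      using lip[OF x(1) s(2)] s(3) by (simp add: mult_ac)
    also have "\<dots> \<le> B * norm v * \<bar>t\<bar>"
      using B s(1) by (intro mult_left_mono) auto
    finally show ?thesis .
  qed
  have Glip: "\<bar>G (x + t *\<^sub>R v) - G x\<bar> \<le> B * norm v * \<bar>t\<bar>" for x t
  proof -
    consider "x \<in> E" "x + t *\<^sub>R v \<in> E" | "x \<in> E" "x + t *\<^sub>R v \<notin> E"
      | "x \<notin> E" "x + t *\<^sub>R v \<in> E" | "x \<notin> E" "x + t *\<^sub>R v \<notin> E" by blast
    then show ?thesis
    proof cases
      case 1
      then show ?thesis using lip[of "x + t *\<^sub>R v" x] by (simp add: G_def mult_ac)
    next
      case 2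
      then show ?thesis using zero[of x t] by (simp add: G_def)
    next
      case 3
      then show ?thesis using zero[of "x + t *\<^sub>R v" "- t"] by (simp add: G_def)
    next
      case 4
      then show ?thesis using B by (simp add: G_def)
    qed
  qed
  obtain R where R: "\<And>x. x \<in> E \<Longrightarrow> norm x \<le> R"
    using compact_imp_bounded[OF E(1)] unfolding bounded_iff by blast
  \<comment> \<open>difference quotients with step \<open>1 / (n + 1)\<close>, supported in a fixed ball\<close>
  define q where "q n x = real (Suc n) * (G (x + (1 / real (Suc n)) *\<^sub>R v) - G x)" for n x
  have bound: "norm (q n x) \<le> indicator (cball 0 (R + norm v)) x *\<^sub>R (B * norm v)" for n x
  proof (cases "x \<in> E \<or> x + (1 / real (Suc n)) *\<^sub>R v \<in> E")
    case True
    let ?a = "(1 / real (Suc n)) *\<^sub>R v"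
    have a: "norm ?a \<le> norm v"
      using mult_right_mono[of "1 / real (Suc n)" 1 "norm v"] by simp
    have "norm x \<le> R + norm v"
    proof (cases "x \<in> E")
      case True
      then have "norm x \<le> R" using R by auto
      then show ?thesis by (simp add: add_increasing2)
    next
      case False
      then have "x + ?a \<in> E" using True by blast
      then have "norm (x + ?a) \<le> R" using R by auto
      moreover have "norm x \<le> norm (x + ?a) + norm ?a"
        using norm_triangle_ineq4[of "x + ?a" ?a] by simp
      ultimately show ?thesis using a by linarith
    qed
    moreover have "norm (q n x) \<le> real (Suc n) * (B * norm v * \<bar>1 / real (Suc n)\<bar>)"
      unfolding q_def norm_mult using Glip[of x "1 / real (Suc n)"] by (intro mult_mono) auto
    moreover have "real (Suc n) * (B * norm v * \<bar>1 / real (Suc n)\<bar>) = B * norm v"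
      by simp
    ultimately show ?thesis by (auto simp: indicator_def)
  next
    case False
    then show ?thesis using B by (simp add: q_def G_def indicator_def)
  qed
  have q0: "(LINT x|lborel. q n x) = 0" for n
  proof -
    let ?a = "(1 / real (Suc n)) *\<^sub>R v"
    have tr: "integrable lborel (\<lambda>x. G (x + ?a))" "(LINT x|lborel. G (x + ?a)) = (LINT x|lborel. G x)"
    proof -
      have d: "distr lborel borel ((+) ?a) = lborel" by (rule lborel_distr_plus)
      have "integrable (distr lborel borel ((+) ?a)) G" using G_int d by simp
      then show "integrable lborel (\<lambda>x. G (x + ?a))"
        by (subst (asm) integrable_distr_eq) (auto simp: add.commute)
      have "(LINT x|lborel. G x) = (LINT x|distr lborel borel ((+) ?a). G x)" using d by simp
      also have "\<dots> = (LINT x|lborel. G (?a + x))" by (subst integral_distr) auto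
      finally show "(LINT x|lborel. G (x + ?a)) = (LINT x|lborel. G x)" by (simp add: add.commute)
    qed
    then show ?thesis using G_int by (simp add: q_def)
  qed
  have lim: "(\<lambda>n. q n x) \<longlonglongrightarrow> indicator E x *\<^sub>R (D x \<bullet> v)" if x: "x \<notin> frontier E" for x
  proof -
    have seq: "(\<lambda>n. x + (1 / real (Suc n)) *\<^sub>R v) \<longlonglongrightarrow> x"
    proof -
      have "(\<lambda>n. x + (1 / real (Suc n)) *\<^sub>R v) \<longlonglongrightarrow> x + 0 *\<^sub>R v"
        by (intro tendsto_intros LIMSEQ_Suc[OF lim_1_over_n])
      then show ?thesis by simp
    qed
    show ?thesis
    proof (cases "x \<in> E")
      case True
      then have xi: "x \<in> interior E"
        using x closure_subset by (auto simp: frontier_def)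
      have "\<forall>\<^sub>F n in sequentially. x + (1 / real (Suc n)) *\<^sub>R v \<in> interior E"
        using seq xi open_interior topological_tendstoD by blast
      then have ev: "\<forall>\<^sub>F n in sequentially. (H (x + (1 / real (Suc n)) *\<^sub>R v) - H x) / (1 / real (Suc n)) = q n x"
        
      proof (rule eventually_mono)
        fix n assume "x + (1 / real (Suc n)) *\<^sub>R v \<in> interior E"
        then have "x + (1 / real (Suc n)) *\<^sub>R v \<in> E" using interior_subset by blast
        then show "(H (x + (1 / real (Suc n)) *\<^sub>R v) - H x) / (1 / real (Suc n)) = q n x"
          using True by (simp add: q_def G_def)
      qed
      have "((\<lambda>t. H (x + t *\<^sub>R v)) has_derivative (\<lambda>t. D x \<bullet> (t *\<^sub>R v))) (at 0)"
      proof -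
        have "(H has_derivative (\<lambda>k. D x \<bullet> k)) (at (x + 0 *\<^sub>R v))" using H by simp
        moreover have "((\<lambda>t. x + t *\<^sub>R v) has_derivative (\<lambda>t. t *\<^sub>R v)) (at (0::real))"
          by (auto intro!: derivative_eq_intros)
        ultimately show ?thesis
          by (rule has_derivative_compose[rotated])
      qed
      then have "((\<lambda>t. H (x + t *\<^sub>R v)) has_real_derivative (D x \<bullet> v)) (at 0)"
        by (simp add: has_field_derivative_def mult_commute_abs)
      then have "((\<lambda>h. (H (x + h *\<^sub>R v) - H x) / h) \<longlongrightarrow> D x \<bullet> v) (at 0)"
        by (simp add: DERIV_def)
      moreover have "filterlim (\<lambda>n. 1 / real (Suc n)) (at 0) sequentially"
        using LIMSEQ_Suc[OF lim_1_over_n] by (auto simp: filterlim_at)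
      ultimately have "(\<lambda>n. (H (x + (1 / real (Suc n)) *\<^sub>R v) - H x) / (1 / real (Suc n))) \<longlonglongrightarrow> D x \<bullet> v"
        by (rule filterlim_compose)
      then show ?thesis using ev True by (auto intro: Lim_transform_eventually)
    next
      case False
      have "open (- E)" using E compact_imp_closed by auto
      then have "\<forall>\<^sub>F n in sequentially. x + (1 / real (Suc n)) *\<^sub>R v \<in> - E"
        using seq False topological_tendstoD by (metis ComplI)
      then have "\<forall>\<^sub>F n in sequentially. 0 = q n x"
        using False by (auto simp: q_def G_def elim!: eventually_mono)
      then show ?thesis
        using False by (auto intro: Lim_transform_eventually[OF tendsto_const])
    qed
  qed
  have "frontier E \<in> null_sets lborel"
    using negligible_convex_frontier[OF E(2)] by (simp add: negligible_iff_null_sets null_sets_completion_iff)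
  then have ae: "AE x in lborel. (\<lambda>n. q n x) \<longlonglongrightarrow> indicator E x *\<^sub>R (D x \<bullet> v)"
    using lim by (intro AE_I'[of "frontier E"]) auto
  have [measurable]: "E \<in> sets borel" "D \<in> borel_measurable borel"
    using compact_imp_closed[OF E(1)] D by (auto intro: borel_measurable_continuous_onI)
  have "(\<lambda>n. LINT x|lborel. q n x) \<longlonglongrightarrow> (LINT x|lborel. indicator E x *\<^sub>R (D x \<bullet> v))"
  proof (rule integral_dominated_convergence[where w = "\<lambda>x. indicator (cball 0 (R + norm v)) x *\<^sub>R (B * norm v)"])
    show "integrable lborel (\<lambda>x. indicator (cball 0 (R + norm v)) x *\<^sub>R (B * norm v) :: real)"
      by (intro integrable_cutoff_compact) auto
    show "(\<lambda>x. q n x) \<in> borel_measurable lborel" for n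
      unfolding q_def by measurable
  qed (use ae bound in auto)
  then have "(LINT x|lborel. indicator E x *\<^sub>R (D x \<bullet> v)) = 0"
    by (simp add: q0 LIMSEQ_const_iff)
  then show ?thesis by (simp add: set_lebesgue_integral_def)
qed

section \<open>The flux through a facet of a simplex\<close>

context full_simplex
begin

lemma bary_has_derivative:
  assumes "c \<in> C" shows "(bary c has_derivative (\<lambda>k. bary_grad c \<bullet> k)) (at x)"
proof -
  have "bary c = (\<lambda>x. bary c 0 + bary_grad c \<bullet> x)"
    by (rule ext) (rule bary_eq[OF assms])
  moreover have "((\<lambda>x. bary c 0 + bary_grad c \<bullet> x) has_derivative (\<lambda>k. bary_grad c \<bullet> k)) (at x)"
    by (auto intro!: derivative_eq_intros)
  ultimately show ?thesis by simp
qed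

lemma continuous_bary: "c \<in> C \<Longrightarrow> continuous_on S (bary c)"
  using bary_has_derivative by (meson has_derivative_at_withinI has_derivative_continuous_on)

text \<open>The field \<open>bary r x *\<^sub>R (r - a)\<close> has divergence one, and its normal component vanishes
on every facet except the one opposite \<open>a\<close>. If \<open>\<psi>\<close> vanishes there, then \<open>bary r *
\<psi>\<close> is zero at both ends of each chord in direction \<open>r - a\<close>: the chord through
\<open>x\<close> consists of the points \<open>x + t *\<^sub>R (r - a)\<close> with \<open>t\<close> between \<open>-
bary r x\<close> and \<open>bary a x\<close>.\<close>

lemma flux_integral_eq_0:
  fixes \<psi> :: "'a \<Rightarrow> real"
  assumes C: "r \<in> C" "a \<in> C" "r \<noteq> a"
    and \<psi>: "\<And>x. (\<psi> has_derivative (\<lambda>k. D x \<bullet> k)) (at x)" and D: "continuous_on UNIV D"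
    and zero: "\<And>x. x \<in> convex hull (C - {a}) \<Longrightarrow> \<psi> x = 0"
  shows "(LINT x:convex hull C|lborel. bary r x * (D x \<bullet> (r - a)) + \<psi> x) = 0"
proof -
  let ?D = "\<lambda>x. bary r x *\<^sub>R D x + \<psi> x *\<^sub>R bary_grad r"
  have cont\<psi>: "continuous_on UNIV \<psi>"
    using \<psi> by (meson has_derivative_at_withinI has_derivative_continuous_on)
  have "(LINT x:convex hull C|lborel. ?D x \<bullet> (r - a)) = 0"
  proof (rule set_integral_directional_derivative_eq_0)
    show "((\<lambda>x. bary r x * \<psi> x) has_derivative (\<lambda>k. ?D x \<bullet> k)) (at x)" for x
      using has_derivative_mult[OF bary_has_derivative[OF C(1)] \<psi>]
      by (rule has_derivative_eq_rhs) (auto simp: inner_add_left)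
    show "continuous_on UNIV ?D"
      using D cont\<psi> C by (intro continuous_intros continuous_bary)
  next
    fix x t
    assume x: "x \<in> convex hull C" and t: "x + t *\<^sub>R (r - a) \<notin> convex hull C"
    have tr: "bary c (x + s *\<^sub>R (r - a)) = bary c x + s * (if c = r then 1 else if c = a then - 1 else 0)"
      if "c \<in> C" for c s
      using bary_translate[OF that C] .
    have pos: "0 \<le> bary c x" if "c \<in> C" for c
      using x that by (auto simp: hull_eq)
    have "\<exists>c\<in>C. bary c (x + t *\<^sub>R (r - a)) < 0"
      using t by (auto simp: hull_eq not_le)
    then have t2: "bary r x + t < 0 \<or> bary a x - t < 0"
      using pos C by (auto simp: tr split: if_splits dest: leD)
    show "\<exists>s. \<bar>s\<bar> \<le> \<bar>t\<bar> \<and> x + s *\<^sub>R (r - a) \<in> convex hull C \<and> bary r (x + s *\<^sub>R (r - a)) * \<psi> (x + s *\<^sub>R (r - a)) = 0"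
    proof (cases "bary r x + t < 0")
      case True
      then have "\<bar>- bary r x\<bar> \<le> \<bar>t\<bar>" using pos[OF C(1)] by auto
      moreover have "x + (- bary r x) *\<^sub>R (r - a) \<in> convex hull C"
        unfolding hull_eq
      proof (intro CollectI ballI)
        fix c assume c: "c \<in> C"
        show "0 \<le> bary c (x + (- bary r x) *\<^sub>R (r - a))"
          unfolding tr[OF c] using pos[OF c] pos[OF C(1)] by auto
      qed
      moreover have "bary r (x + (- bary r x) *\<^sub>R (r - a)) = 0"
        using C by (simp add: tr del: scaleR_minus_left)
      ultimately show ?thesis by (intro exI[of _ "- bary r x"]) (simp del: scaleR_minus_left)
    next
      case False
      then have s: "\<bar>bary a x\<bar> \<le> \<bar>t\<bar>" using t2 pos[OF C(2)] by auto
      let ?y = "x + bary a x *\<^sub>R (r - a)"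
      have y: "?y \<in> convex hull C"
        using pos pos[OF C(2)] by (auto simp: hull_eq tr intro!: add_nonneg_nonneg)
      moreover have "bary a ?y = 0"
        using C by (simp add: tr)
      ultimately have "\<psi> ?y = 0"
        using zero[of ?y] facet_eq[OF C(2)] by simp
      with s y show ?thesis by (intro exI[of _ "bary a x"]) simp
    qed
  qed (use compact_hull in auto)
  moreover have "?D x \<bullet> (r - a) = bary r x * (D x \<bullet> (r - a)) + \<psi> x" for x
    using C by (simp add: inner_add_left bary_grad_edge)
  ultimately show ?thesis by simp
qed

lemma set_integrable_hull:
  fixes f :: "'a \<Rightarrow> real"
  assumes "continuous_on UNIV f"
  shows "set_integrable lborel (convex hull C) f"
  unfolding set_integrable_def
  by (rule integrable_cutoff_compact[OF compact_hull]) (rule continuous_on_subset[OF assms], simp)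

lemma hull_borel [measurable]: "convex hull C \<in> sets borel"
  by (intro borel_closed compact_imp_closed compact_hull)

lemma volume_eq: "(LINT x:convex hull C|lborel. (1::real)) = measure lebesgue (convex hull C)"
  unfolding set_lebesgue_integral_def
  using compact_hull by (simp add: measure_completion emeasure_bounded_finite compact_imp_bounded)

lemma volume_pos: "0 < measure lebesgue (convex hull C)"
proof -
  have "\<not> negligible (interior (convex hull C))"
    using interior_hull_nonempty open_interior open_not_negligible by blast
  then have "\<not> negligible (convex hull C)"
    using interior_subset negligible_subset by blast
  then show ?thesis
    using compact_hull by (metis lmeasurable_compact measure_nonneg negligible_iff_measure0 order_less_le)
qed

text \<open>The coordinate of \<open>a\<close> itself is an admissible test function in
\<open>flux_integral_eq_0\<close>; it shows that the coordinates of \<open>a\<close> and \<open>c\<close> have the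
same integral. All of them together have integral equal to the volume.\<close>

lemma bary_integral:
  assumes "c \<in> C"
  shows "(LINT x:convex hull C|lborel. bary c x) = measure lebesgue (convex hull C) / (DIM('a) + 1)"
proof -
  note int = set_integrable_hull[OF continuous_bary]
  have eq: "(LINT x:convex hull C|lborel. bary a x) = (LINT x:convex hull C|lborel. bary c x)" if "a \<in> C" for a
  proof (cases "a = c")
    case False
    have "(LINT x:convex hull C|lborel. bary c x * (bary_grad a \<bullet> (c - a)) + bary a x) = 0"
      using False assms that bary_has_derivative[OF that]
      by (intro flux_integral_eq_0[where D = "\<lambda>_. bary_grad a"]) (auto simp: facet_eq)
    moreover have "bary_grad a \<bullet> (c - a) = - 1"
      using False assms that by (subst bary_grad_edge) auto
    ultimately have "(LINT x:convex hull C|lborel. bary a x - bary c x) = 0"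
      by simp
    then show ?thesis
      using int assms that by (simp add: set_integral_diff)
  qed simp
  have "(LINT x:convex hull C|lborel. (1::real)) = (LINT x:convex hull C|lborel. (\<Sum>a\<in>C. bary a x))"
    by (simp add: bary_sum)
  also have "\<dots> = (\<Sum>a\<in>C. LINT x:convex hull C|lborel. bary a x)"
    unfolding set_lebesgue_integral_def scaleR_sum_right
    using int by (intro Bochner_Integration.integral_sum) (simp add: set_integrable_def)
  also have "\<dots> = (\<Sum>a\<in>C. LINT x:convex hull C|lborel. bary c x)"
    by (intro sum.cong eq) auto
  also have "\<dots> = (DIM('a) + 1) * (LINT x:convex hull C|lborel. bary c x)"
    by (simp add: card)
  finally show ?thesis
    unfolding volume_eq by (simp add: field_simps)
qed

end

text \<open>The mean value on the left depends only on the values of \<open>\<psi>\<close> on the facet with vertex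
set \<open>K\<close>, hence not on the apex. The affine map \<open>S x = x + bary a x *\<^sub>R (b - a)\<close> fixes
this facet, takes \<open>a\<close> to \<open>b\<close> and the first simplex to the second, and preserves the
barycentric coordinates. Pulled back by it, the difference of the two sides becomes the integral of
\<open>flux_integral_eq_0\<close> for the function \<open>\<psi> \<circ> S - \<psi>\<close>, which is zero on the
facet.\<close>

lemma flux_integral_shared_facet:
  fixes K :: "'a::euclidean_space set" and \<psi> :: "'a \<Rightarrow> real"
  assumes simp1: "full_simplex (insert a K)" "a \<notin> K"
    and simp2: "full_simplex (insert b K)" "b \<notin> K"
    and r: "r \<in> K"
    and \<psi>: "\<And>x. (\<psi> has_derivative (\<lambda>k. D x \<bullet> k)) (at x)" and D: "continuous_on UNIV D"
  defines "P \<equiv> full_simplex.bary (insert a K) r" and "Q \<equiv> full_simplex.bary (insert b K) r"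
  shows "(LINT x:convex hull (insert a K)|lborel. P x * (D x \<bullet> (r - a)) + \<psi> x) / measure lebesgue (convex hull (insert a K))
       = (LINT x:convex hull (insert b K)|lborel. Q x * (D x \<bullet> (r - b)) + \<psi> x) / measure lebesgue (convex hull (insert b K))"
proof -
  interpret s1: full_simplex "insert a K" by (rule simp1)
  interpret s2: full_simplex "insert b K" by (rule simp2)
  have K: "finite K" using s1.finite_C by simp
  define e where "e = b - a"
  define g where "g = s1.bary_grad a"
  define L where "L x = x + (g \<bullet> x) *\<^sub>R e" for x
  define z where "z = s1.bary a 0 *\<^sub>R e"
  let ?S = "\<lambda>x. z + L x"
  have S: "?S x = x + s1.bary a x *\<^sub>R e" for x
    using s1.bary_eq[of a x] by (simp add: z_def L_def g_def scaleR_left_distrib)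
  have S_comb: "?S x = (\<Sum>c\<in>K. s1.bary c x *\<^sub>R c) + s1.bary a x *\<^sub>R b" for x
    using s1.bary_combination[of x] K simp1(2) by (simp add: S e_def scaleR_right_diff_distrib algebra_simps)
  have sum1: "(\<Sum>c\<in>K. s1.bary c x) + s1.bary a x = 1" for x
    using s1.bary_sum[of x] K simp1(2) by simp
  have sum2: "(\<Sum>c\<in>K. s2.bary c x) + s2.bary b x = 1" for x
    using s2.bary_sum[of x] K simp2(2) by simp
  have bary_S: "s2.bary c (?S x) = (if c = b then s1.bary a x else s1.bary c x)" if "c \<in> insert b K" for c x
  proof (rule s2.bary_unique[OF _ _ that])
    have neq: "c \<noteq> b" if "c \<in> K" for c using that simp2(2) by auto
    show "(\<Sum>c\<in>insert b K. if c = b then s1.bary a x else s1.bary c x) = 1"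
      using K simp2(2) sum1[of x] neq by (simp cong: sum.cong)
    show "(\<Sum>c\<in>insert b K. (if c = b then s1.bary a x else s1.bary c x) *\<^sub>R c) = ?S x"
      using K simp2(2) neq by (simp add: S_comb add.commute cong: sum.cong)
  qed
  have linL: "linear L"
    by (rule linearI) (simp_all add: L_def inner_add_right scaleR_left_distrib scaleR_right_distrib)
  have injS: "x = y" if "?S x = ?S y" for x y
  proof -
    have "s1.bary a x = s1.bary a y" using bary_S[of b x] bary_S[of b y] that by simp
    then show ?thesis using that by (simp only: S) simp
  qed
  have injL: "inj L"
    using injS by (intro injI) simp
  have image: "?S ` (convex hull (insert a K)) = convex hull (insert b K)"
  proof (intro equalityI subsetI)
    fix y assume "y \<in> ?S ` (convex hull (insert a K))"
    then obtain x where x: "y = ?S x" "\<forall>c\<in>insert a K. 0 \<le> s1.bary c x"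
      by (auto simp: s1.hull_eq)
    then show "y \<in> convex hull (insert b K)"
      by (auto simp: s2.hull_eq bary_S)
  next
    fix y assume y: "y \<in> convex hull (insert b K)"
    \<comment> \<open>the image of \<open>y\<close> under the inverse of the affine map\<close>
    define x where "x = y + s2.bary b y *\<^sub>R (a - b)"
    have neq: "c \<noteq> a" if "c \<in> K" for c using that simp1(2) by auto
    have x_comb: "x = (\<Sum>c\<in>K. s2.bary c y *\<^sub>R c) + s2.bary b y *\<^sub>R a"
      using s2.bary_combination[of y] K simp2(2) by (simp add: x_def scaleR_right_diff_distrib) (metis add_diff_cancel_left' add.commute diff_add_eq)
    have bx: "s1.bary c x = (if c = a then s2.bary b y else s2.bary c y)" if "c \<in> insert a K" for c
    proof (rule s1.bary_unique[OF _ _ that])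
      show "(\<Sum>c\<in>insert a K. if c = a then s2.bary b y else s2.bary c y) = 1"
        using K simp1(2) sum2[of y] neq by (simp cong: sum.cong)
      show "(\<Sum>c\<in>insert a K. (if c = a then s2.bary b y else s2.bary c y) *\<^sub>R c) = x"
        using K simp1(2) neq by (simp add: x_comb add.commute cong: sum.cong)
    qed
    have "x \<in> convex hull (insert a K)"
      using y by (auto simp: s1.hull_eq s2.hull_eq bx)
    moreover have "?S x = y"
      by (simp only: S bx[of a] insertI1 if_True) (simp add: x_def e_def scaleR_right_diff_distrib)
    ultimately show "y \<in> ?S ` (convex hull (insert a K))" by (metis imageI)
  qed
  obtain c where c: "\<And>E f. E \<in> sets borel \<Longrightarrow> ?S ` E \<in> sets borel \<Longrightarrow> f \<in> borel_measurable borel \<Longrightarrow>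
      (LINT x:E|lborel. f (?S x)) = c * (LINT x:?S ` E|lborel. (f x :: real))"
    using set_integral_affine_image[OF linL injL, of z] by blast
  note cov = c[of "convex hull (insert a K)", unfolded image, OF s1.hull_borel s2.hull_borel]
  have vol: "measure lebesgue (convex hull (insert a K)) = c * measure lebesgue (convex hull (insert b K))"
    using cov[of "\<lambda>_. 1"] by (simp add: s1.volume_eq s2.volume_eq)
  have cont\<psi>: "continuous_on UNIV \<psi>"
    using \<psi> by (meson has_derivative_at_withinI has_derivative_continuous_on)
  have contS: "continuous_on UNIV ?S"
    using linL by (intro continuous_intros linear_continuous_on) (simp add: linear_conv_bounded_linear)
  have cont_comp: "continuous_on UNIV (\<lambda>x. f (?S x))" if "continuous_on UNIV f" for f :: "'a \<Rightarrow> 'b::real_normed_vector"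
    using continuous_on_compose2[OF that contS] by auto
  define \<eta> where "\<eta> x = \<psi> (?S x) - \<psi> x" for x
  define D\<eta> where "D\<eta> x = D (?S x) + (D (?S x) \<bullet> e) *\<^sub>R g - D x" for x
  have der\<eta>: "(\<eta> has_derivative (\<lambda>k. D\<eta> x \<bullet> k)) (at x)" for x
  proof -
    have "(?S has_derivative L) (at x)"
      using linear_imp_has_derivative[OF linL] by (auto intro!: derivative_eq_intros)
    from has_derivative_compose[OF this \<psi>]
    have "((\<lambda>x. \<psi> (?S x) - \<psi> x) has_derivative (\<lambda>k. D (?S x) \<bullet> L k - D x \<bullet> k)) (at x)"
      by (intro has_derivative_diff \<psi>)
    then show ?thesis
      unfolding \<eta>_def[abs_def]
      by (rule has_derivative_eq_rhs) (auto simp: D\<eta>_def L_def inner_add_left inner_diff_left inner_add_right)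
  qed
  have "(LINT x:convex hull (insert a K)|lborel. P x * (D\<eta> x \<bullet> (r - a)) + \<eta> x) = 0"
    unfolding P_def
  proof (rule s1.flux_integral_eq_0[OF _ _ _ der\<eta>])
    show "continuous_on UNIV D\<eta>"
      unfolding D\<eta>_def using D by (intro continuous_intros cont_comp)
    show "\<eta> x = 0" if "x \<in> convex hull (insert a K - {a})" for x
    proof -
      have "s1.bary a x = 0" using that s1.facet_eq[of a] by auto
      then show ?thesis unfolding \<eta>_def S by simp
    qed
  qed (use r simp1 in auto)
  moreover have "P x * (D\<eta> x \<bullet> (r - a)) + \<eta> x =
      (Q (?S x) * (D (?S x) \<bullet> (r - b)) + \<psi> (?S x)) - (P x * (D x \<bullet> (r - a)) + \<psi> x)" for x
  proof -
    have QP: "Q (?S x) = P x"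
      using bary_S[of r x] r simp2(2) by (auto simp: P_def Q_def)
    have "g \<bullet> (r - a) = - 1"
      using s1.bary_grad_edge[of a r a] r simp1(2) by (auto simp: g_def)
    then have D\<eta>: "D\<eta> x \<bullet> (r - a) = D (?S x) \<bullet> (r - b) - D x \<bullet> (r - a)"
    proof -
      have "D\<eta> x \<bullet> (r - a) = D (?S x) \<bullet> (r - a) + (D (?S x) \<bullet> e) * (g \<bullet> (r - a)) - D x \<bullet> (r - a)"
        by (simp add: D\<eta>_def inner_add_left inner_diff_left)
      then show ?thesis
        unfolding \<open>g \<bullet> (r - a) = - 1\<close> by (simp add: e_def inner_diff_right)
    qed
    show ?thesis unfolding QP D\<eta> \<eta>_def by (simp add: right_diff_distrib)
  qed
  ultimately have "(LINT x:convex hull (insert a K)|lborel.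
      (Q (?S x) * (D (?S x) \<bullet> (r - b)) + \<psi> (?S x)) - (P x * (D x \<bullet> (r - a)) + \<psi> x)) = 0"
    by simp
  moreover have contP: "continuous_on UNIV (\<lambda>x. P x * (D x \<bullet> (r - a)) + \<psi> x)"
    using D cont\<psi> r unfolding P_def by (intro continuous_intros s1.continuous_bary) auto
  moreover have contQ: "continuous_on UNIV (\<lambda>x. Q x * (D x \<bullet> (r - b)) + \<psi> x)"
    using D cont\<psi> r unfolding Q_def by (intro continuous_intros s2.continuous_bary) auto
  ultimately have "(LINT x:convex hull (insert a K)|lborel. P x * (D x \<bullet> (r - a)) + \<psi> x) =
      (LINT x:convex hull (insert a K)|lborel. Q (?S x) * (D (?S x) \<bullet> (r - b)) + \<psi> (?S x))"
    using set_integral_diff(2)[OF s1.set_integrable_hull[OF cont_comp[OF contQ]] s1.set_integrable_hull[OF contP]]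
    by simp
  also have "\<dots> = c * (LINT x:convex hull (insert b K)|lborel. Q x * (D x \<bullet> (r - b)) + \<psi> x)"
    using contQ by (intro cov borel_measurable_continuous_onI)
  finally have "(LINT x:convex hull (insert a K)|lborel. P x * (D x \<bullet> (r - a)) + \<psi> x) =
      c * (LINT x:convex hull (insert b K)|lborel. Q x * (D x \<bullet> (r - b)) + \<psi> x)" .
  moreover have "c \<noteq> 0" using vol s1.volume_pos by auto
  ultimately show ?thesis
    unfolding vol by simp
qed

section \<open>Smooth cut-off functions and the fundamental lemma of the calculus of variations\<close>

text \<open>For \<open>m = 0\<close> this is the standard smooth function \<open>exp (- 1 / t)\<close>, continued by
zero. The negative powers make the family closed under differentiation.\<close>

definition flat :: "nat \<Rightarrow> real \<Rightarrow> real" where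
  "flat m t = (if t > 0 then exp (- 1 / t) / t ^ m else 0)"

lemma flat_tendsto_0: "(flat m \<longlongrightarrow> 0) (at 0)"
  unfolding filterlim_at_split
proof
  have "\<forall>\<^sub>F t in at_left 0. flat m t = 0"
    by (auto simp: eventually_at_filter flat_def intro!: always_eventually)
  then show "(flat m \<longlongrightarrow> 0) (at_left 0)"
    by (rule tendsto_eventually)
  have "((\<lambda>y. y ^ m / exp y) \<longlongrightarrow> 0) (at_top :: real filter)"
    by (rule tendsto_power_div_exp_0)
  moreover have "\<forall>\<^sub>F y in at_top. y ^ m / exp y = flat m (inverse y)"
    using eventually_gt_at_top[of 0] by eventually_elim (auto simp: flat_def exp_minus field_simps)
  ultimately have "((\<lambda>y. flat m (inverse y)) \<longlongrightarrow> 0) at_top"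
    by (rule Lim_transform_eventually)
  then show "(flat m \<longlongrightarrow> 0) (at_right 0)"
    by (simp add: filterlim_at_right_to_top)
qed

lemma flat_has_derivative:
  "(flat m has_real_derivative (flat (m + 2) t - m * flat (m + 1) t)) (at t)"
proof -
  consider "t > 0" | "t < 0" | "t = 0" by linarith
  then show ?thesis
  proof cases
    case 1
    have "((\<lambda>t. exp (- 1 / t) / t ^ m) has_real_derivative (flat (m + 2) t - m * flat (m + 1) t)) (at t)"
    proof (cases m)
      case 0
      then show ?thesis
        using 1 by (auto intro!: derivative_eq_intros simp: flat_def field_simps power2_eq_square)
    next
      case (Suc n)
      have "((\<lambda>t. t ^ Suc n) has_real_derivative (1 + real n) * t ^ n) (at t)"
        using DERIV_pow[of "Suc n" t] by simp
      moreover have "((\<lambda>t. exp (- 1 / t)) has_real_derivative exp (- 1 / t) / t\<^sup>2) (at t)"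
        using 1 by (auto intro!: derivative_eq_intros simp: field_simps power2_eq_square)
      ultimately have "((\<lambda>t. exp (- 1 / t) / t ^ Suc n) has_real_derivative
          (exp (- 1 / t) / t\<^sup>2 * t ^ Suc n - exp (- 1 / t) * ((1 + real n) * t ^ n)) / (t ^ Suc n * t ^ Suc n)) (at t)"
        using 1 by (intro DERIV_divide) auto
      also have "(exp (- 1 / t) / t\<^sup>2 * t ^ Suc n - exp (- 1 / t) * ((1 + real n) * t ^ n)) / (t ^ Suc n * t ^ Suc n)
          = flat (m + 2) t - m * flat (m + 1) t"
        using 1 by (simp add: Suc flat_def field_simps power2_eq_square)
      finally show ?thesis by (simp add: Suc)
    qed
    then show ?thesis
      by (rule has_field_derivative_transform_within_open[of _ _ _ "{0<..}"]) (use 1 in \<open>auto simp: flat_def\<close>)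
  next
    case 2
    have "((\<lambda>t. 0) has_real_derivative 0) (at t)" by simp
    then have "(flat m has_real_derivative 0) (at t)"
      by (rule has_field_derivative_transform_within_open[of _ _ _ "{..<0}"]) (use 2 in \<open>auto simp: flat_def\<close>)
    then show ?thesis using 2 by (simp add: flat_def)
  next
    case 3
    have "((\<lambda>h. (flat m (0 + h) - flat m 0) / h) \<longlongrightarrow> 0) (at 0)"
    proof (rule Lim_transform_eventually[OF flat_tendsto_0[of "m + 1"]])
      show "\<forall>\<^sub>F h in at 0. flat (m + 1) h = (flat m (0 + h) - flat m 0) / h"
        by (intro eventuallyI) (auto simp: flat_def)
    qed
    then show ?thesis using 3 by (simp add: DERIV_def flat_def)
  qed
qed

text \<open>A class of functions closed under partial derivatives. A single differentiation of its members therefore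
yields smoothness.\<close>

inductive elementary_smooth :: "(real^'n \<Rightarrow> real) \<Rightarrow> bool" where
  const: "elementary_smooth (\<lambda>_. c)"
| coord: "elementary_smooth (\<lambda>x. x $ i)"
| add: "elementary_smooth p \<Longrightarrow> elementary_smooth q \<Longrightarrow> elementary_smooth (\<lambda>x. p x + q x)"
| mult: "elementary_smooth p \<Longrightarrow> elementary_smooth q \<Longrightarrow> elementary_smooth (\<lambda>x. p x * q x)"
| flat: "elementary_smooth p \<Longrightarrow> elementary_smooth (\<lambda>x. flat m (p x))"

lemma elementary_smooth_diff:
  "elementary_smooth p \<Longrightarrow> elementary_smooth q \<Longrightarrow> elementary_smooth (\<lambda>x. p x - q x)"
  using elementary_smooth.add[OF _ elementary_smooth.mult[OF elementary_smooth.const[of "-1"]], of p q] by simp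

lemma elementary_smooth_sum:
  "finite A \<Longrightarrow> (\<And>i. i \<in> A \<Longrightarrow> elementary_smooth (p i)) \<Longrightarrow> elementary_smooth (\<lambda>x. \<Sum>i\<in>A. p i x)"
  by (induction A rule: finite_induct) (auto intro: elementary_smooth.intros)

lemma elementary_smooth_prod:
  "finite A \<Longrightarrow> (\<And>i. i \<in> A \<Longrightarrow> elementary_smooth (p i)) \<Longrightarrow> elementary_smooth (\<lambda>x. \<Prod>i\<in>A. p i x)"
  by (induction A rule: finite_induct) (auto intro: elementary_smooth.intros)

lemma elementary_smooth_derivative:
  assumes "elementary_smooth p"
  shows "\<exists>d. (\<forall>x. (p has_derivative (\<lambda>k. \<Sum>i\<in>UNIV. d i x * k $ i)) (at x)) \<and> (\<forall>i. elementary_smooth (d i))"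
  using assms
proof induction
  case (const c)
  show ?case
    by (intro exI[of _ "\<lambda>_ _. 0"]) (auto intro: elementary_smooth.intros)
next
  case (coord j)
  have "((\<lambda>x. x $ j :: real) has_derivative (\<lambda>k. \<Sum>i\<in>UNIV. (if i = j then 1 else 0) * k $ i)) (at x)" for x
  proof (rule has_derivative_eq_rhs[OF bounded_linear.has_derivative[OF bounded_linear_vec_nth has_derivative_ident]])
    have "(if i = j then 1 else 0) * k $ i = (if i = j then k $ i else (0::real))" for i k
      by simp
    then have "(k $ j :: real) = (\<Sum>i\<in>UNIV. (if i = j then 1 else 0) * k $ i)" for k
      by simp
    then show "(\<lambda>k. k $ j :: real) = (\<lambda>k. \<Sum>i\<in>UNIV. (if i = j then 1 else 0) * k $ i)"
      by (rule ext)
  qed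
  then show ?case
    by (intro exI[of _ "\<lambda>i _. if i = j then 1 else 0"]) (auto intro: elementary_smooth.intros)
next
  case (add p q)
  then obtain d e where
    d: "\<And>x. (p has_derivative (\<lambda>k. \<Sum>i\<in>UNIV. d i x * k $ i)) (at x)" "\<And>i. elementary_smooth (d i)" and
    e: "\<And>x. (q has_derivative (\<lambda>k. \<Sum>i\<in>UNIV. e i x * k $ i)) (at x)" "\<And>i. elementary_smooth (e i)"
    by blast
  have "((\<lambda>x. p x + q x) has_derivative (\<lambda>k. \<Sum>i\<in>UNIV. (d i x + e i x) * k $ i)) (at x)" for x
    using has_derivative_add[OF d(1) e(1)]
    by (rule has_derivative_eq_rhs) (simp add: sum.distrib algebra_simps)
  then show ?case
    using d(2) e(2) by (intro exI[of _ "\<lambda>i x. d i x + e i x"]) (auto intro: elementary_smooth.intros)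
next
  case (mult p q)
  then obtain d e where
    d: "\<And>x. (p has_derivative (\<lambda>k. \<Sum>i\<in>UNIV. d i x * k $ i)) (at x)" "\<And>i. elementary_smooth (d i)" and
    e: "\<And>x. (q has_derivative (\<lambda>k. \<Sum>i\<in>UNIV. e i x * k $ i)) (at x)" "\<And>i. elementary_smooth (e i)"
    by blast
  have "((\<lambda>x. p x * q x) has_derivative (\<lambda>k. \<Sum>i\<in>UNIV. (p x * e i x + d i x * q x) * k $ i)) (at x)" for x
    using has_derivative_mult[OF d(1) e(1)]
    by (rule has_derivative_eq_rhs) (simp add: sum.distrib sum_distrib_left sum_distrib_right algebra_simps)
  then show ?case
    using d(2) e(2) mult.hyps
    by (intro exI[of _ "\<lambda>i x. p x * e i x + d i x * q x"] conjI allI elementary_smooth.add elementary_smooth.mult)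
next
  case (flat p m)
  then obtain d where
    d: "\<And>x. (p has_derivative (\<lambda>k. \<Sum>i\<in>UNIV. d i x * k $ i)) (at x)" "\<And>i. elementary_smooth (d i)"
    by blast
  let ?f = "\<lambda>x. flat (m + 2) (p x) - m * flat (m + 1) (p x)"
  have "((\<lambda>x. flat m (p x)) has_derivative (\<lambda>k. \<Sum>i\<in>UNIV. (?f x * d i x) * k $ i)) (at x)" for x
    using has_derivative_compose[OF d(1) flat_has_derivative[unfolded has_field_derivative_def]]
    by (rule has_derivative_eq_rhs) (auto simp: sum_distrib_left mult.assoc intro!: sum.cong)
  moreover have "elementary_smooth (\<lambda>x. ?f x * d i x)" for i
    using flat.hyps d(2) by (intro elementary_smooth.mult elementary_smooth_diff elementary_smooth.const elementary_smooth.flat)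
  ultimately show ?case
    by (intro exI[of _ "\<lambda>i x. ?f x * d i x"]) auto
qed

lemma grad_eqI:
  fixes p :: "real^'n \<Rightarrow> real"
  assumes "(p has_derivative (\<lambda>k. \<Sum>i\<in>UNIV. d i * k $ i)) (at x)"
  shows "grad p x $ i = d i"
  by (simp add: grad_def frechet_derivative_at[OF assms, symmetric] axis_def if_distrib[of "\<lambda>c. _ * c"] cong: if_cong)

lemma smooth_if_elementary_smooth:
  assumes "elementary_smooth p" shows "smooth p"
proof -
  have "C_k k p" for k
    using assms
  proof (induction k arbitrary: p)
    case 0
    then obtain d where "\<And>x. (p has_derivative (\<lambda>k. \<Sum>i\<in>UNIV. d i x * k $ i)) (at x)"
      using elementary_smooth_derivative by blast
    then show ?case by (simp, meson has_derivative_at_withinI has_derivative_continuous_on)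
  next
    case (Suc k)
    then obtain d where d: "\<And>x. (p has_derivative (\<lambda>k. \<Sum>i\<in>UNIV. d i x * k $ i)) (at x)"
      "\<And>i. elementary_smooth (d i)"
      using elementary_smooth_derivative by blast
    have "(\<lambda>x. grad p x $ i) = d i" for i
      using grad_eqI[OF d(1)] by auto
    moreover have "p differentiable_on UNIV"
      using d(1) by (auto simp: differentiable_on_def differentiable_def)
    ultimately show ?case using Suc.IH[OF d(2)] by simp
  qed
  then show ?thesis by (simp add: smooth_def)
qed

text \<open>As \<open>n\<close> grows, these functions increase to the indicator of the ball with centre
\<open>c\<close> and radius \<open>r\<close>.\<close>

definition ball_cutoff :: "real^'n \<Rightarrow> real \<Rightarrow> nat \<Rightarrow> real^'n \<Rightarrow> real" where
  "ball_cutoff c r n x = flat 0 (real n * (r\<^sup>2 - (\<Sum>i\<in>UNIV. (x $ i - c $ i) * (x $ i - c $ i))))"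

lemma elementary_smooth_ball_cutoff: "elementary_smooth (ball_cutoff c r n)"
  unfolding ball_cutoff_def
  by (intro elementary_smooth.flat elementary_smooth.mult elementary_smooth.const elementary_smooth_diff
      elementary_smooth_sum finite elementary_smooth.coord)

lemma ball_cutoff_eq: "ball_cutoff c r n x = flat 0 (real n * (r\<^sup>2 - (dist c x)\<^sup>2))"
  by (simp add: ball_cutoff_def dist_vec_def L2_set_def sum_nonneg dist_real_def power2_commute power2_eq_square)
     (simp add: algebra_simps)

lemma flat_0_bounds: "0 \<le> flat 0 t" "flat 0 t \<le> 1"
  by (auto simp: flat_def)

lemma ball_cutoff_bounds: "0 \<le> ball_cutoff c r n x" "ball_cutoff c r n x \<le> 1"
  by (simp_all add: ball_cutoff_eq flat_0_bounds)

lemma ball_cutoff_outside: "0 < r \<Longrightarrow> x \<notin> ball c r \<Longrightarrow> ball_cutoff c r n x = 0"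
proof -
  assume "0 < r" "x \<notin> ball c r"
  then have "r\<^sup>2 \<le> (dist c x)\<^sup>2" by (intro power_mono) auto
  then have "\<not> 0 < real n * (r\<^sup>2 - (dist c x)\<^sup>2)"
    by (simp add: not_less mult_nonneg_nonpos)
  then show ?thesis by (simp add: ball_cutoff_eq flat_def)
qed

lemma ball_cutoff_inside:
  assumes "x \<in> ball c r" shows "(\<lambda>n. ball_cutoff c r n x) \<longlonglongrightarrow> 1"
proof -
  define \<delta> where "\<delta> = r\<^sup>2 - (dist c x)\<^sup>2"
  have \<delta>: "0 < \<delta>"
    using assms by (simp add: \<delta>_def power_strict_mono)
  have "(\<lambda>n. exp (- (1 / \<delta>) * (1 / real n))) \<longlonglongrightarrow> exp (- (1 / \<delta>) * 0)"
    by (intro tendsto_intros lim_1_over_n)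
  moreover have "\<forall>\<^sub>F n in sequentially. exp (- (1 / \<delta>) * (1 / real n)) = ball_cutoff c r n x"
    using eventually_gt_at_top[of 0]
    by eventually_elim (use \<delta> in \<open>auto simp: ball_cutoff_eq flat_def simp flip: \<delta>_def\<close>)
  ultimately show ?thesis by (auto intro: Lim_transform_eventually)
qed

text \<open>An open set is a countable union of balls whose closures it contains. If \<open>\<psi> k\<close> is a
cut-off function of the \<open>k\<close>-th ball, then \<open>1 - (\<Prod>k\<le>n. 1 - \<psi> k)\<close> is a smooth
substitute for the indicator of the union of the first balls.\<close>

lemma test_functions_approximate_open_set:
  fixes U :: "(real^'n) set"
  assumes "open U"
  obtains \<phi> where "\<And>n. test_function U (\<phi> n)" "\<And>n x. 0 \<le> \<phi> n x \<and> \<phi> n x \<le> 1"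
    "\<And>x. (\<lambda>n. \<phi> n x) \<longlonglongrightarrow> indicator U x"
proof (cases "U = {}")
  case True
  have "smooth (\<lambda>_ :: real^'n. 0)"
    by (rule smooth_if_elementary_smooth[OF elementary_smooth.const])
  then show ?thesis
    using True by (intro that[of "\<lambda>_ _. 0"]) (auto simp: test_function_def)
next
  case False
  define \<B> where "\<B> = {B. \<exists>c r. 0 < r \<and> B = ball c r \<and> cball c r \<subseteq> U}"
  have "\<Union>\<B> = U"
  proof (intro equalityI subsetI)
    fix x assume "x \<in> U"
    then obtain r where "0 < r" "cball x r \<subseteq> U"
      using \<open>open U\<close> open_contains_cball by blast
    then show "x \<in> \<Union>\<B>" by (auto simp: \<B>_def intro!: exI[of _ "ball x r"])
  qed (use ball_subset_cball in \<open>fastforce simp: \<B>_def\<close>)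
  moreover obtain \<C> where "\<C> \<subseteq> \<B>" "countable \<C>" "\<Union>\<C> = \<Union>\<B>"
    by (rule Lindelof[of \<B>]) (auto simp: \<B>_def)
  ultimately have \<C>: "\<C> \<subseteq> \<B>" "countable \<C>" "\<Union>\<C> = U" "\<C> \<noteq> {}"
    using False by auto
  have "\<forall>k. \<exists>c r. 0 < r \<and> from_nat_into \<C> k = ball c r \<and> cball c r \<subseteq> U"
    using from_nat_into[OF \<C>(4)] \<C>(1) by (auto simp: \<B>_def)
  then obtain c r where cr: "\<And>k. 0 < r k" "\<And>k. from_nat_into \<C> k = ball (c k) (r k)" "\<And>k. cball (c k) (r k) \<subseteq> U"
    by metis
  have U: "U = (\<Union>k. ball (c k) (r k))"
    using range_from_nat_into[OF \<C>(4,2)] \<C>(3) unfolding cr(2)[symmetric] by simp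
  define \<phi> where "\<phi> n x = 1 - (\<Prod>k\<le>n. 1 - ball_cutoff (c k) (r k) n x)" for n x
  have smooth: "smooth (\<phi> n)" for n
    unfolding \<phi>_def
    by (intro smooth_if_elementary_smooth elementary_smooth_diff elementary_smooth.const elementary_smooth_prod
        elementary_smooth_ball_cutoff finite_atMost)
  have factor: "0 \<le> 1 - ball_cutoff (c k) (r k) n x" "1 - ball_cutoff (c k) (r k) n x \<le> 1" for k n x
    using ball_cutoff_bounds by (auto simp: algebra_simps)
  have prod: "0 \<le> (\<Prod>k\<le>n. 1 - ball_cutoff (c k) (r k) n x)" "(\<Prod>k\<le>n. 1 - ball_cutoff (c k) (r k) n x) \<le> 1" for n x
    using factor by (auto intro!: prod_nonneg prod_le_1)
  have outside: "\<phi> n x = 0" if "x \<notin> (\<Union>k\<le>n. cball (c k) (r k))" for n x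
  proof -
    have "ball_cutoff (c k) (r k) n x = 0" if "k \<le> n" for k
    proof (rule ball_cutoff_outside[OF cr(1)])
      have "x \<notin> cball (c k) (r k)" using \<open>k \<le> n\<close> \<open>x \<notin> _\<close> by blast
      then show "x \<notin> ball (c k) (r k)" using ball_subset_cball by blast
    qed
    then have "(\<Prod>k\<le>n. 1 - ball_cutoff (c k) (r k) n x) = 1"
      by (intro prod.neutral) auto
    then show ?thesis by (simp add: \<phi>_def)
  qed
  show ?thesis
  proof
    fix n
    have compact: "compact (\<Union>k\<le>n. cball (c k) (r k))"
      by (intro compact_UN) auto
    have support: "closure {x. \<phi> n x \<noteq> 0} \<subseteq> (\<Union>k\<le>n. cball (c k) (r k))"
      using outside by (intro closure_minimal compact_imp_closed[OF compact]) blast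
    have "compact (closure {x. \<phi> n x \<noteq> 0})"
      using compact_Int_closed[OF compact closed_closure, of "{x. \<phi> n x \<noteq> 0}"] support
      by (simp add: Int_absorb1)
    then show "test_function U (\<phi> n)"
      using smooth support cr(3) by (auto simp: test_function_def)
  next
    fix n x
    show "0 \<le> \<phi> n x \<and> \<phi> n x \<le> 1"
      using prod[of n x] by (auto simp: \<phi>_def)
  next
    fix x
    show "(\<lambda>n. \<phi> n x) \<longlonglongrightarrow> indicator U x"
    proof (cases "x \<in> U")
      case False
      then have "\<phi> n x = 0" for n
        using outside[of x n] cr(3) by blast
      then show ?thesis using False by simp
    next
      case True
      then obtain j where j: "x \<in> ball (c j) (r j)" using U by auto
      have "(\<lambda>n. 1 - ball_cutoff (c j) (r j) n x) \<longlonglongrightarrow> 1 - 1"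
        by (intro tendsto_intros ball_cutoff_inside j)
      then have "(\<lambda>n. 1 - ball_cutoff (c j) (r j) n x) \<longlonglongrightarrow> 0" by simp
      moreover have "\<forall>\<^sub>F n in sequentially. (\<Prod>k\<le>n. 1 - ball_cutoff (c k) (r k) n x) \<le> 1 - ball_cutoff (c j) (r j) n x"
        using eventually_ge_at_top[of j]
      proof eventually_elim
        case (elim n)
        have "(\<Prod>k\<le>n. 1 - ball_cutoff (c k) (r k) n x) =
            (1 - ball_cutoff (c j) (r j) n x) * (\<Prod>k\<in>{..n} - {j}. 1 - ball_cutoff (c k) (r k) n x)"
          using elim by (intro prod.remove) auto
        also have "\<dots> \<le> (1 - ball_cutoff (c j) (r j) n x) * 1"
          using factor by (intro mult_left_mono prod_le_1) auto
        finally show ?case by simp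
      qed
      ultimately have "(\<lambda>n. \<Prod>k\<le>n. 1 - ball_cutoff (c k) (r k) n x) \<longlonglongrightarrow> 0"
        by (intro real_tendsto_sandwich[OF always_eventually[OF allI[OF prod(1)]] _ tendsto_const])
      then have "(\<lambda>n. \<phi> n x) \<longlonglongrightarrow> 1 - 0"
        unfolding \<phi>_def by (intro tendsto_intros)
      then show ?thesis using True by simp
    qed
  qed
qed

lemma test_function_mono: "test_function U \<phi> \<Longrightarrow> U \<subseteq> \<Omega> \<Longrightarrow> test_function \<Omega> \<phi>"
  by (auto simp: test_function_def)

lemma test_function_measurable: "test_function U \<phi> \<Longrightarrow> \<phi> \<in> borel_measurable borel"
  unfolding test_function_def smooth_def
  by (metis C_k.simps(1) borel_measurable_continuous_onI)

text \<open>By approximation, \<open>w\<close> has integral zero over every open subset, and by taking differences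
over every closed set contained in \<open>\<Omega>\<close>. The set where \<open>w\<close> is positive is a countable
union of closed sets up to a null set, and each of these is null because \<open>w\<close> is positive on it.\<close>

lemma nonpositive_if_orthogonal_to_test_functions:
  fixes w :: "real^'n \<Rightarrow> real"
  assumes \<Omega>: "open \<Omega>" and w: "integrable (lebesgue_on \<Omega>) w"
    and ortho: "\<And>\<phi>. test_function \<Omega> \<phi> \<Longrightarrow> (LINT x|lebesgue_on \<Omega>. \<phi> x * w x) = 0"
  shows "AE x in lebesgue_on \<Omega>. w x \<le> 0"
proof -
  have [simp]: "\<Omega> \<in> sets lebesgue" using \<Omega> by auto
  define W where "W x = indicator \<Omega> x * w x" for x
  have W: "integrable lebesgue W"
    using w by (simp add: W_def[abs_def] integrable_restrict_space)
  have ortho': "(LINT x|lebesgue. \<phi> x * W x) = 0" if "test_function \<Omega> \<phi>" for \<phi>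
    using ortho[OF that] by (simp add: integral_restrict_space W_def[abs_def] mult_ac)
  have open_zero: "(LINT x|lebesgue. indicator U x * W x) = 0" if U: "open U" "U \<subseteq> \<Omega>" for U
  proof -
    obtain \<phi> where \<phi>: "\<And>n. test_function U (\<phi> n)" "\<And>n x. 0 \<le> \<phi> n x \<and> \<phi> n x \<le> 1"
      "\<And>x. (\<lambda>n. \<phi> n x) \<longlonglongrightarrow> indicator U x"
      using test_functions_approximate_open_set[OF U(1)] by blast
    have "(\<lambda>n. LINT x|lebesgue. \<phi> n x * W x) \<longlonglongrightarrow> (LINT x|lebesgue. indicator U x * W x)"
    proof (rule integral_dominated_convergence[where w = "\<lambda>x. \<bar>W x\<bar>"])
      show "(\<lambda>x. indicator U x * W x) \<in> borel_measurable lebesgue"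
        using U W by (intro borel_measurable_times borel_measurable_indicator) auto
      show "(\<lambda>x. \<phi> n x * W x) \<in> borel_measurable lebesgue" for n
        using test_function_measurable[OF \<phi>(1)] W
        by (intro borel_measurable_times) (auto intro: measurable_completion)
      show "AE x in lebesgue. (\<lambda>n. \<phi> n x * W x) \<longlonglongrightarrow> indicator U x * W x"
        using \<phi>(3) by (intro AE_I2 tendsto_intros)
      show "AE x in lebesgue. norm (\<phi> n x * W x) \<le> \<bar>W x\<bar>" for n
        using \<phi>(2)[of n] by (intro AE_I2) (simp add: abs_mult mult_left_le_one_le)
    qed (use W in auto)
    then show ?thesis
      using ortho'[OF test_function_mono[OF \<phi>(1) U(2)]] by (simp add: LIMSEQ_const_iff)
  qed
  have closed_zero: "(LINT x|lebesgue. indicator F x * W x) = 0" if F: "closed F" "F \<subseteq> \<Omega>" for F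
  proof -
    have ind: "indicator F x * W x = indicator \<Omega> x * W x - indicator (\<Omega> - F) x * W x" for x
      using F by (auto simp: indicator_def)
    have int: "integrable lebesgue (\<lambda>x. indicator U x * W x)" if "open U" for U
      using W that by (intro integrable_mult_indicator[where 'b=real, simplified]) auto
    have "open (\<Omega> - F)" using \<Omega> F(1) by (rule open_Diff)
    then show ?thesis
      unfolding ind using \<Omega> int open_zero by (subst Bochner_Integration.integral_diff) auto
  qed
  let ?P = "{x. 0 < W x}"
  have "?P \<in> sets lebesgue"
    using borel_measurable_integrable[OF W] borel_measurable_less[of "\<lambda>_. 0" lebesgue W] by simp
  then obtain D N where D: "fsigma D" "N \<in> null_sets lebesgue" "D \<union> N = ?P"
    by (rule lebesgue_set_almost_fsigma) auto
  have "F \<in> null_sets lebesgue" if F: "closed F" "F \<subseteq> ?P" for F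
  proof -
    have "W x = 0" if "x \<notin> \<Omega>" for x using that by (simp add: W_def)
    then have F\<Omega>: "F \<subseteq> \<Omega>" using F(2) by fastforce
    have "integrable lebesgue (\<lambda>x. indicator F x * W x)"
      using W F by (intro integrable_mult_indicator[where 'b=real, simplified]) auto
    moreover have "AE x in lebesgue. 0 \<le> indicator F x * W x"
      using F by (intro AE_I2) (auto simp: indicator_def less_imp_le)
    ultimately have "AE x in lebesgue. indicator F x * W x = 0"
      using closed_zero[OF F(1) F\<Omega>] by (simp add: integral_nonneg_eq_0_iff_AE)
    moreover have "(indicator F x * W x = 0) = (x \<notin> F)" for x
      using F by (auto simp: indicator_def)
    ultimately have "AE x in lebesgue. x \<notin> F" by simp
    then show ?thesis
      using F(1) by (simp add: AE_iff_null)
  qed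
  moreover obtain F :: "nat \<Rightarrow> (real^'n) set" where F: "\<And>n. closed (F n)" "D = (\<Union>n. F n)"
    using D(1) by (auto elim: fsigma.cases)
  moreover have "F n \<subseteq> ?P" for n using F(2) D(3) by blast
  ultimately have "D \<in> null_sets lebesgue"
    by auto
  then have "AE x in lebesgue. \<not> 0 < W x"
    using null_sets.Un[OF _ D(2), of D] D(3) by (intro AE_I'[of "D \<union> N"]) auto
  then have "AE x in lebesgue. x \<in> \<Omega> \<longrightarrow> w x \<le> 0"
    by (rule eventually_mono) (auto simp: W_def not_less)
  then show ?thesis
    by (subst AE_restrict_space_iff) auto
qed

lemma zero_if_orthogonal_to_test_functions:
  fixes w :: "real^'n \<Rightarrow> real^'m"
  assumes \<Omega>: "open \<Omega>" and w: "integrable (lebesgue_on \<Omega>) w"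
    and ortho: "\<And>\<phi>. test_function \<Omega> \<phi> \<Longrightarrow> (LINT x|lebesgue_on \<Omega>. \<phi> x *\<^sub>R w x) = 0"
    and int: "\<And>\<phi>. test_function \<Omega> \<phi> \<Longrightarrow> integrable (lebesgue_on \<Omega>) (\<lambda>x. \<phi> x *\<^sub>R w x)"
  shows "AE x in lebesgue_on \<Omega>. w x = 0"
proof -
  have comp: "integrable (lebesgue_on \<Omega>) (\<lambda>x. w x $ i)" for i
    using integrable_bounded_linear[OF bounded_linear_vec_nth w] .
  have "(LINT x|lebesgue_on \<Omega>. \<phi> x * w x $ i) = 0" if "test_function \<Omega> \<phi>" for \<phi> i
    using integral_bounded_linear[OF bounded_linear_vec_nth int[OF that], of i] ortho[OF that] by simp
  then have "AE x in lebesgue_on \<Omega>. w x $ i \<le> 0" "AE x in lebesgue_on \<Omega>. - (w x $ i) \<le> 0" for i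
    using nonpositive_if_orthogonal_to_test_functions[OF \<Omega>, of "\<lambda>x. w x $ i"]
      nonpositive_if_orthogonal_to_test_functions[OF \<Omega>, of "\<lambda>x. - (w x $ i)"] comp[of i] by simp_all
  then have "AE x in lebesgue_on \<Omega>. \<forall>i. w x $ i \<le> 0" "AE x in lebesgue_on \<Omega>. \<forall>i. - (w x $ i) \<le> 0"
    by (auto simp: AE_all_countable)
  then show ?thesis
    by eventually_elim (auto simp: vec_eq_iff intro: antisym)
qed

section \<open>Square-integrable functions and the weak divergence\<close>

lemma L2_measurable: "\<phi> \<in> L2 \<Omega> \<Longrightarrow> \<phi> \<in> borel_measurable (lebesgue_on \<Omega>)"
  by (simp add: L2_def)

lemma L2_zero: "(\<lambda>x. 0) \<in> L2 \<Omega>"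
  by (simp add: L2_def)

lemma L2_bilinear_integrable:
  fixes B :: "'a::euclidean_space \<Rightarrow> 'b::euclidean_space \<Rightarrow> 'c::euclidean_space"
  assumes B: "bounded_bilinear B" and \<phi>: "\<phi> \<in> L2 \<Omega>" and \<psi>: "\<psi> \<in> L2 \<Omega>"
  shows "integrable (lebesgue_on \<Omega>) (\<lambda>x. B (\<phi> x) (\<psi> x))"
proof -
  interpret bounded_bilinear B by (rule B)
  obtain k where k: "0 \<le> k" "\<And>a b. norm (B a b) \<le> norm a * norm b * k"
    using nonneg_bounded by blast
  have meas: "(\<lambda>x. B (\<phi> x) (\<psi> x)) \<in> borel_measurable (lebesgue_on \<Omega>)"
    using L2_measurable[OF \<phi>] L2_measurable[OF \<psi>]
    by (rule borel_measurable_continuous_Pair) (intro continuous_on continuous_intros)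
  have dom: "integrable (lebesgue_on \<Omega>) (\<lambda>x. k * ((norm (\<phi> x))\<^sup>2 + (norm (\<psi> x))\<^sup>2))"
    using \<phi> \<psi> by (simp add: L2_def)
  have bound: "norm (B (\<phi> x) (\<psi> x)) \<le> norm (k * ((norm (\<phi> x))\<^sup>2 + (norm (\<psi> x))\<^sup>2))" for x
  proof -
    have "norm (\<phi> x) * norm (\<psi> x) \<le> (norm (\<phi> x))\<^sup>2 + (norm (\<psi> x))\<^sup>2"
      using sum_squares_bound[of "norm (\<phi> x)" "norm (\<psi> x)"]
        mult_nonneg_nonneg[OF norm_ge_zero[of "\<phi> x"] norm_ge_zero[of "\<psi> x"]] by linarith
    then have "norm (\<phi> x) * norm (\<psi> x) * k \<le> ((norm (\<phi> x))\<^sup>2 + (norm (\<psi> x))\<^sup>2) * k"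
      using k(1) by (rule mult_right_mono)
    then show ?thesis
      using k(1) order_trans[OF k(2)[of "\<phi> x" "\<psi> x"]] by (simp add: mult.commute)
  qed
  show ?thesis
    using dom meas by (rule Bochner_Integration.integrable_bound) (intro AE_I2 bound)
qed

lemma L2_add_scaled:
  assumes "\<phi> \<in> L2 \<Omega>" "\<psi> \<in> L2 \<Omega>" shows "(\<lambda>x. c *\<^sub>R \<phi> x + \<psi> x) \<in> L2 \<Omega>"
proof -
  have [measurable]: "\<phi> \<in> borel_measurable (lebesgue_on \<Omega>)" "\<psi> \<in> borel_measurable (lebesgue_on \<Omega>)"
    using assms by (auto simp: L2_def)
  have "integrable (lebesgue_on \<Omega>) (\<lambda>x. (norm (c *\<^sub>R \<phi> x + \<psi> x))\<^sup>2)"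
  proof (rule Bochner_Integration.integrable_bound[OF _ _ AE_I2])
    show "integrable (lebesgue_on \<Omega>) (\<lambda>x. 2 * (c\<^sup>2 * (norm (\<phi> x))\<^sup>2) + 2 * (norm (\<psi> x))\<^sup>2)"
      using assms by (simp add: L2_def)
    show "norm ((norm (c *\<^sub>R \<phi> x + \<psi> x))\<^sup>2) \<le> norm (2 * (c\<^sup>2 * (norm (\<phi> x))\<^sup>2) + 2 * (norm (\<psi> x))\<^sup>2)" for x
    proof -
      have "(norm (c *\<^sub>R \<phi> x + \<psi> x))\<^sup>2 \<le> (\<bar>c\<bar> * norm (\<phi> x) + norm (\<psi> x))\<^sup>2"
        using norm_triangle_ineq[of "c *\<^sub>R \<phi> x" "\<psi> x"] by (intro power_mono) auto
      also have "\<dots> \<le> 2 * (\<bar>c\<bar> * norm (\<phi> x))\<^sup>2 + 2 * (norm (\<psi> x))\<^sup>2"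
        using sum_squares_bound[of "\<bar>c\<bar> * norm (\<phi> x)" "norm (\<psi> x)"] by (simp add: power2_sum)
      finally show ?thesis by (simp add: power_mult_distrib)
    qed
  qed measurable
  then show ?thesis by (simp add: L2_def)
qed

lemma L2_inner_add_scaled_left:
  assumes "\<phi> \<in> L2 \<Omega>" "\<phi>' \<in> L2 \<Omega>" "\<psi> \<in> L2 \<Omega>"
  shows "L2_inner \<Omega> (\<lambda>x. c *\<^sub>R \<phi> x + \<phi>' x) \<psi> = c * L2_inner \<Omega> \<phi> \<psi> + L2_inner \<Omega> \<phi>' \<psi>"
  using L2_bilinear_integrable[OF bounded_bilinear_inner assms(1,3)]
    L2_bilinear_integrable[OF bounded_bilinear_inner assms(2,3)]
  by (simp add: L2_inner_def inner_add_left)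

lemma L2_inner_commute: "L2_inner \<Omega> \<phi> \<psi> = L2_inner \<Omega> \<psi> \<phi>"
  by (simp add: L2_inner_def inner_commute)

lemma L2_inner_add_scaled_right:
  assumes "\<phi> \<in> L2 \<Omega>" "\<phi>' \<in> L2 \<Omega>" "\<psi> \<in> L2 \<Omega>"
  shows "L2_inner \<Omega> \<psi> (\<lambda>x. c *\<^sub>R \<phi> x + \<phi>' x) = c * L2_inner \<Omega> \<psi> \<phi> + L2_inner \<Omega> \<psi> \<phi>'"
  using L2_inner_add_scaled_left[OF assms] by (simp add: L2_inner_commute)

lemma L2_inner_cong_AE:
  assumes "AE x in lebesgue_on \<Omega>. \<phi> x = \<phi>' x" "\<phi> \<in> L2 \<Omega>" "\<phi>' \<in> L2 \<Omega>" "\<psi> \<in> L2 \<Omega>"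
  shows "L2_inner \<Omega> \<phi> \<psi> = L2_inner \<Omega> \<phi>' \<psi>"
  unfolding L2_inner_def
  using assms by (intro integral_cong_AE borel_measurable_inner L2_measurable) (auto elim: eventually_mono)

lemma L2_inner_AE_0:
  assumes "AE x in lebesgue_on \<Omega>. \<phi> x = 0"
  shows "L2_inner \<Omega> \<phi> \<psi> = 0" "L2_inner \<Omega> \<psi> \<phi> = 0"
proof -
  have "AE x in lebesgue_on \<Omega>. \<phi> x \<bullet> \<psi> x = 0" using assms by (rule eventually_mono) simp
  then have "L2_inner \<Omega> \<phi> \<psi> = 0" unfolding L2_inner_def by (rule integral_eq_zero_AE)
  then show "L2_inner \<Omega> \<phi> \<psi> = 0" "L2_inner \<Omega> \<psi> \<phi> = 0" by (simp_all add: L2_inner_commute)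
qed

lemma L2_bounded:
  fixes f :: "real^'n \<Rightarrow> 'b::euclidean_space"
  assumes "\<Omega> \<in> lmeasurable" "f \<in> borel_measurable (lebesgue_on \<Omega>)" "\<And>x. x \<in> \<Omega> \<Longrightarrow> norm (f x) \<le> B"
  shows "f \<in> L2 \<Omega>"
proof -
  interpret finite_measure "lebesgue_on \<Omega>"
    using assms(1) by (rule finite_measure_lebesgue_on)
  have "integrable (lebesgue_on \<Omega>) (\<lambda>x. (norm (f x))\<^sup>2)"
  proof (rule integrable_const_bound)
    show "AE x in lebesgue_on \<Omega>. norm ((norm (f x))\<^sup>2) \<le> B\<^sup>2"
      using assms(3) by (intro AE_I2) (auto simp: space_restrict_space intro!: power_mono)
  qed (use assms(2) in measurable)
  then show ?thesis using assms(2) by (simp add: L2_def)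
qed

lemma continuous_borel_measurable_lebesgue_on:
  fixes f :: "real^'n \<Rightarrow> 'b::euclidean_space"
  assumes "continuous_on UNIV f" shows "f \<in> borel_measurable (lebesgue_on \<Omega>)"
  using borel_measurable_continuous_onI[OF assms]
  by (intro measurable_restrict_space1 measurable_completion) simp

lemma L2_continuous:
  fixes f :: "real^'n \<Rightarrow> 'b::euclidean_space"
  assumes "bounded \<Omega>" "\<Omega> \<in> sets lebesgue" "continuous_on UNIV f"
  shows "f \<in> L2 \<Omega>"
proof -
  have "bounded (f ` closure \<Omega>)"
    using assms by (intro compact_imp_bounded compact_continuous_image) (auto intro: continuous_on_subset)
  then obtain B where "\<And>x. x \<in> closure \<Omega> \<Longrightarrow> norm (f x) \<le> B"
    unfolding bounded_iff by blast
  then show ?thesis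
    using assms closure_subset
    by (intro L2_bounded[of _ _ B] bounded_set_imp_lmeasurable continuous_borel_measurable_lebesgue_on) blast+
qed

lemma bounded_bilinear_matrix_vector_mult:
  "bounded_bilinear ((*v) :: real^'n^'m \<Rightarrow> real^'n \<Rightarrow> real^'m)"
proof
  show "\<exists>K. \<forall>(a::real^'n^'m) b. norm (a *v b) \<le> norm a * norm b * K"
  proof (intro exI[of _ 1] allI)
    fix a :: "real^'n^'m" and b :: "real^'n"
    have "norm (a *v b) \<le> L2_set (\<lambda>i. norm (a $ i) * norm b) UNIV"
      unfolding norm_vec_def[of "a *v b"]
      by (rule L2_set_mono) (auto simp: matrix_vector_mul_component Cauchy_Schwarz_ineq2)
    also have "\<dots> = norm a * norm b"
      unfolding norm_vec_def[of a] by (simp add: L2_set_left_distrib)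
    finally show "norm (a *v b) \<le> norm a * norm b * 1" by simp
  qed
qed (simp_all add: matrix_vector_mult_add_rdistrib matrix_vector_right_distrib
      matrix_vector_mult_scaleR scaleR_matrix_vector_assoc[symmetric])

lemma smooth_continuous: "smooth \<phi> \<Longrightarrow> continuous_on UNIV \<phi>"
  unfolding smooth_def by (metis C_k.simps(1))

lemma smooth_grad_continuous:
  fixes \<phi> :: "real^'n \<Rightarrow> real"
  assumes "smooth \<phi>" shows "continuous_on UNIV (grad \<phi>)"
proof -
  have "C_k (Suc 0) \<phi>" using assms by (simp add: smooth_def)
  then have "continuous_on UNIV (\<lambda>x. grad \<phi> x $ i)" for i by simp
  then have "continuous_on UNIV (\<lambda>x. \<chi> i. grad \<phi> x $ i)" by (intro continuous_on_vec_lambda)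
  then show ?thesis by simp
qed

lemma smooth_has_derivative:
  fixes \<phi> :: "real^'n \<Rightarrow> real"
  assumes "smooth \<phi>" shows "(\<phi> has_derivative (\<lambda>k. grad \<phi> x \<bullet> k)) (at x)"
proof -
  have "C_k (Suc 0) \<phi>" using assms by (simp add: smooth_def)
  then have d: "(\<phi> has_derivative frechet_derivative \<phi> (at x)) (at x)"
    by (simp add: differentiable_on_def frechet_derivative_works)
  then interpret bounded_linear "frechet_derivative \<phi> (at x)" by (rule has_derivative_bounded_linear)
  have "frechet_derivative \<phi> (at x) k = grad \<phi> x \<bullet> k" for k
  proof -
    have "frechet_derivative \<phi> (at x) k = frechet_derivative \<phi> (at x) (\<Sum>i\<in>UNIV. (k $ i) *\<^sub>R axis i 1)"
      using basis_expansion[of k] by (simp add: scalar_mult_eq_scaleR)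
    also have "\<dots> = grad \<phi> x \<bullet> k"
      by (simp add: sum scaleR grad_def inner_vec_def mult.commute)
    finally show ?thesis .
  qed
  then show ?thesis using d by (metis (no_types, lifting) ext)
qed

lemma has_weak_divD: "has_weak_div \<Omega> \<tau> w \<Longrightarrow> w \<in> L2 \<Omega>"
  by (simp add: has_weak_div_def)

lemma weak_div_works: "has_weak_div \<Omega> \<tau> w \<Longrightarrow> has_weak_div \<Omega> \<tau> (weak_div \<Omega> \<tau>)"
  unfolding weak_div_def by (rule someI[where P = "has_weak_div \<Omega> \<tau>"])

locale bounded_domain =
  fixes \<Omega> :: "(real^'n) set"
  assumes open_domain: "open \<Omega>" and bounded_domain: "bounded \<Omega>"
begin

lemma domain_measurable [simp]: "\<Omega> \<in> sets lebesgue" "\<Omega> \<in> lmeasurable"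
  using open_domain bounded_domain by (auto intro: lmeasurable_open)

lemma L2_continuous_domain:
  "continuous_on UNIV f \<Longrightarrow> f \<in> L2 \<Omega>" for f :: "real^'n \<Rightarrow> 'b::euclidean_space"
  by (rule L2_continuous[OF bounded_domain domain_measurable(1)])

lemma integrable_grad:
  "\<tau> \<in> L2 \<Omega> \<Longrightarrow> smooth \<phi> \<Longrightarrow> integrable (lebesgue_on \<Omega>) (\<lambda>x. \<tau> x *v grad \<phi> x)"
  by (rule L2_bilinear_integrable[OF bounded_bilinear_matrix_vector_mult _ L2_continuous_domain[OF smooth_grad_continuous]])

lemma integrable_test:
  "w \<in> L2 \<Omega> \<Longrightarrow> smooth \<phi> \<Longrightarrow> integrable (lebesgue_on \<Omega>) (\<lambda>x. \<phi> x *\<^sub>R w x)"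
  by (rule L2_bilinear_integrable[OF bounded_bilinear_scaleR L2_continuous_domain[OF smooth_continuous]])

lemma L2_integrable: "w \<in> L2 \<Omega> \<Longrightarrow> integrable (lebesgue_on \<Omega>) w"
  using L2_bilinear_integrable[OF bounded_bilinear_scaleR L2_continuous_domain[of "\<lambda>_. 1"]] by simp

lemma integral_test_add_scaled:
  assumes "v \<in> L2 \<Omega>" "w \<in> L2 \<Omega>" "smooth \<phi>"
  shows "(LINT x|lebesgue_on \<Omega>. \<phi> x *\<^sub>R (c *\<^sub>R v x + w x)) =
    c *\<^sub>R (LINT x|lebesgue_on \<Omega>. \<phi> x *\<^sub>R v x) + (LINT x|lebesgue_on \<Omega>. \<phi> x *\<^sub>R w x)"
proof -
  have "\<phi> x *\<^sub>R (c *\<^sub>R v x + w x) = c *\<^sub>R (\<phi> x *\<^sub>R v x) + \<phi> x *\<^sub>R w x" for x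
    by (simp add: scaleR_right_distrib mult.commute)
  then show ?thesis
    using integrable_test[OF assms(1,3)] integrable_test[OF assms(2,3)] by (simp del: scaleR_scaleR)
qed

lemma integral_grad_add_scaled:
  assumes "\<tau> \<in> L2 \<Omega>" "\<sigma> \<in> L2 \<Omega>" "smooth \<phi>"
  shows "(LINT x|lebesgue_on \<Omega>. (c *\<^sub>R \<tau> x + \<sigma> x) *v grad \<phi> x) =
    c *\<^sub>R (LINT x|lebesgue_on \<Omega>. \<tau> x *v grad \<phi> x) + (LINT x|lebesgue_on \<Omega>. \<sigma> x *v grad \<phi> x)"
  using integrable_grad[OF assms(1,3)] integrable_grad[OF assms(2,3)]
  by (simp add: matrix_vector_mult_add_rdistrib scaleR_matrix_vector_assoc[symmetric])

text \<open>The operator \<open>weak_div\<close> is defined by choice; everything that is known about its values comes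
from this uniqueness.\<close>

lemma has_weak_div_unique:
  assumes "has_weak_div \<Omega> \<tau> v" "has_weak_div \<Omega> \<tau> w"
  shows "AE x in lebesgue_on \<Omega>. v x = w x"
proof -
  have L2: "v \<in> L2 \<Omega>" "w \<in> L2 \<Omega>" using assms by (auto dest: has_weak_divD)
  have L2': "(\<lambda>x. (-1) *\<^sub>R w x + v x) \<in> L2 \<Omega>" using L2 by (intro L2_add_scaled)
  have "AE x in lebesgue_on \<Omega>. (-1) *\<^sub>R w x + v x = 0"
  proof (rule zero_if_orthogonal_to_test_functions[OF open_domain L2_integrable[OF L2']])
    fix \<phi> assume \<phi>: "test_function \<Omega> \<phi>"
    then have sm: "smooth \<phi>" by (simp add: test_function_def)
    show "integrable (lebesgue_on \<Omega>) (\<lambda>x. \<phi> x *\<^sub>R ((-1) *\<^sub>R w x + v x))"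
      by (rule integrable_test[OF L2' sm])
    have "(LINT x|lebesgue_on \<Omega>. \<phi> x *\<^sub>R v x) = (LINT x|lebesgue_on \<Omega>. \<phi> x *\<^sub>R w x)"
    proof -
      have "- (LINT x|lebesgue_on \<Omega>. \<phi> x *\<^sub>R v x) = - (LINT x|lebesgue_on \<Omega>. \<phi> x *\<^sub>R w x)"
        using assms \<phi> by (simp add: has_weak_div_def)
      then show ?thesis by (rule neg_equal_iff_equal[THEN iffD1])
    qed
    then show "(LINT x|lebesgue_on \<Omega>. \<phi> x *\<^sub>R ((-1) *\<^sub>R w x + v x)) = 0"
      using integrable_test[OF L2(1) sm] integrable_test[OF L2(2) sm]
      by (simp add: scaleR_right_diff_distrib)
  qed
  then show ?thesis by (rule eventually_mono) simp
qed

lemma weak_div_AE: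
  assumes "has_weak_div \<Omega> \<tau> w" shows "AE x in lebesgue_on \<Omega>. weak_div \<Omega> \<tau> x = w x"
  using has_weak_div_unique[OF weak_div_works[OF assms] assms] .

lemma has_weak_div_add_scaled:
  assumes "has_weak_div \<Omega> \<tau> v" "has_weak_div \<Omega> \<sigma> w" "\<tau> \<in> L2 \<Omega>" "\<sigma> \<in> L2 \<Omega>"
  shows "has_weak_div \<Omega> (\<lambda>x. c *\<^sub>R \<tau> x + \<sigma> x) (\<lambda>x. c *\<^sub>R v x + w x)"
  unfolding has_weak_div_def
proof (intro conjI allI impI)
  have L2: "v \<in> L2 \<Omega>" "w \<in> L2 \<Omega>" using assms by (auto dest: has_weak_divD)
  then show "(\<lambda>x. c *\<^sub>R v x + w x) \<in> L2 \<Omega>" by (rule L2_add_scaled)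
  fix \<phi> assume \<phi>: "test_function \<Omega> \<phi>"
  then have sm: "smooth \<phi>" by (simp add: test_function_def)
  have "(LINT x|lebesgue_on \<Omega>. \<tau> x *v grad \<phi> x) = - (LINT x|lebesgue_on \<Omega>. \<phi> x *\<^sub>R v x)"
    "(LINT x|lebesgue_on \<Omega>. \<sigma> x *v grad \<phi> x) = - (LINT x|lebesgue_on \<Omega>. \<phi> x *\<^sub>R w x)"
    using assms \<phi> by (auto simp: has_weak_div_def)
  then show "(LINT x|lebesgue_on \<Omega>. (c *\<^sub>R \<tau> x + \<sigma> x) *v grad \<phi> x) =
      - (LINT x|lebesgue_on \<Omega>. \<phi> x *\<^sub>R (c *\<^sub>R v x + w x))"
    by (simp add: integral_test_add_scaled[OF L2 sm] integral_grad_add_scaled[OF assms(3,4) sm])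
qed

lemma weak_div_add_scaled_AE:
  assumes "has_weak_div \<Omega> \<tau> v" "has_weak_div \<Omega> \<sigma> w" "\<tau> \<in> L2 \<Omega>" "\<sigma> \<in> L2 \<Omega>"
  shows "AE x in lebesgue_on \<Omega>. weak_div \<Omega> (\<lambda>x. c *\<^sub>R \<tau> x + \<sigma> x) x = c *\<^sub>R weak_div \<Omega> \<tau> x + weak_div \<Omega> \<sigma> x"
  using assms by (intro weak_div_AE has_weak_div_add_scaled weak_div_works)

lemma weak_div_AE_0:
  assumes "\<tau> \<in> L2 \<Omega>" "AE x in lebesgue_on \<Omega>. \<tau> x = 0"
  shows "AE x in lebesgue_on \<Omega>. weak_div \<Omega> \<tau> x = 0"
proof (rule weak_div_AE)
  show "has_weak_div \<Omega> \<tau> (\<lambda>x. 0)"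
    unfolding has_weak_div_def
  proof (intro conjI allI impI L2_zero)
    fix \<phi>
    have "AE x in lebesgue_on \<Omega>. \<tau> x *v grad \<phi> x = 0"
      using assms(2) by (rule eventually_mono) simp
    then show "(LINT x|lebesgue_on \<Omega>. \<tau> x *v grad \<phi> x) = - (LINT x|lebesgue_on \<Omega>. \<phi> x *\<^sub>R 0)"
      by (simp add: integral_eq_zero_AE)
  qed
qed

lemma XX_L2: "\<tau> \<in> XX \<Omega> \<Gamma> \<Longrightarrow> \<tau> \<in> L2 \<Omega>"
  and XX_weak_div: "\<tau> \<in> XX \<Omega> \<Gamma> \<Longrightarrow> has_weak_div \<Omega> \<tau> (weak_div \<Omega> \<tau>)"
  and XX_weak_div_L2: "\<tau> \<in> XX \<Omega> \<Gamma> \<Longrightarrow> weak_div \<Omega> \<tau> \<in> L2 \<Omega>"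
  by (auto simp: XX_def intro: weak_div_works has_weak_divD)

lemma integral_test_cong:
  assumes "AE x in lebesgue_on \<Omega>. v x = w x" "v \<in> L2 \<Omega>" "w \<in> L2 \<Omega>" "smooth \<phi>"
  shows "(LINT x|lebesgue_on \<Omega>. \<phi> x *\<^sub>R v x) = (LINT x|lebesgue_on \<Omega>. \<phi> x *\<^sub>R w x)"
  using assms(1) borel_measurable_integrable[OF integrable_test] assms(2-)
  by (intro integral_cong_AE) (auto elim: eventually_mono)

text \<open>Compactly supported test functions determine the divergence, test functions that vanish on
\<open>\<Gamma>\<close> the boundary condition. A field for which Green's formula holds for both kinds belongs to the
space, and the function \<open>w\<close> in the formula is its divergence.\<close>

lemma XX_I:
  assumes "\<tau> \<in> L2 \<Omega>" "w \<in> L2 \<Omega>"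
    and green: "\<And>\<phi>. smooth \<phi> \<Longrightarrow> test_function \<Omega> \<phi> \<or> (\<forall>x\<in>\<Gamma>. \<phi> x = 0) \<Longrightarrow>
      (LINT x|lebesgue_on \<Omega>. \<tau> x *v grad \<phi> x) + (LINT x|lebesgue_on \<Omega>. \<phi> x *\<^sub>R w x) = 0"
  shows "\<tau> \<in> XX \<Omega> \<Gamma>" "AE x in lebesgue_on \<Omega>. weak_div \<Omega> \<tau> x = w x"
proof -
  have div: "has_weak_div \<Omega> \<tau> w"
    using assms by (auto simp: has_weak_div_def test_function_def eq_neg_iff_add_eq_0)
  then show ae: "AE x in lebesgue_on \<Omega>. weak_div \<Omega> \<tau> x = w x" by (rule weak_div_AE)
  have "zero_normal_trace_off \<Omega> \<Gamma> \<tau>"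
    unfolding zero_normal_trace_off_def
    using green integral_test_cong[OF ae has_weak_divD[OF weak_div_works[OF div]] assms(2)] by auto
  then show "\<tau> \<in> XX \<Omega> \<Gamma>"
    using assms(1) div by (auto simp: XX_def)
qed

lemma XX_add_scaled:
  assumes "\<tau> \<in> XX \<Omega> \<Gamma>" "\<sigma> \<in> XX \<Omega> \<Gamma>"
  shows "(\<lambda>x. c *\<^sub>R \<tau> x + \<sigma> x) \<in> XX \<Omega> \<Gamma>"
proof (rule XX_I(1))
  note L2 = XX_L2[OF assms(1)] XX_L2[OF assms(2)]
  note divL2 = XX_weak_div_L2[OF assms(1)] XX_weak_div_L2[OF assms(2)]
  show "(\<lambda>x. c *\<^sub>R \<tau> x + \<sigma> x) \<in> L2 \<Omega>" using L2 by (rule L2_add_scaled)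
  show "(\<lambda>x. c *\<^sub>R weak_div \<Omega> \<tau> x + weak_div \<Omega> \<sigma> x) \<in> L2 \<Omega>" using divL2 by (rule L2_add_scaled)
  fix \<phi> assume sm: "smooth \<phi>" and \<phi>: "test_function \<Omega> \<phi> \<or> (\<forall>x\<in>\<Gamma>. \<phi> x = 0)"
  have green: "(LINT x|lebesgue_on \<Omega>. \<rho> x *v grad \<phi> x) + (LINT x|lebesgue_on \<Omega>. \<phi> x *\<^sub>R weak_div \<Omega> \<rho> x) = 0"
    if "\<rho> \<in> XX \<Omega> \<Gamma>" for \<rho>
    using \<phi>
  proof
    assume "test_function \<Omega> \<phi>"
    then show ?thesis using XX_weak_div[OF that] by (simp add: has_weak_div_def)
  next
    assume "\<forall>x\<in>\<Gamma>. \<phi> x = 0"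
    then show ?thesis using that sm by (simp add: XX_def zero_normal_trace_off_def)
  qed
  have "(LINT x|lebesgue_on \<Omega>. (c *\<^sub>R \<tau> x + \<sigma> x) *v grad \<phi> x)
      + (LINT x|lebesgue_on \<Omega>. \<phi> x *\<^sub>R (c *\<^sub>R weak_div \<Omega> \<tau> x + weak_div \<Omega> \<sigma> x))
    = c *\<^sub>R ((LINT x|lebesgue_on \<Omega>. \<tau> x *v grad \<phi> x) + (LINT x|lebesgue_on \<Omega>. \<phi> x *\<^sub>R weak_div \<Omega> \<tau> x))
      + ((LINT x|lebesgue_on \<Omega>. \<sigma> x *v grad \<phi> x) + (LINT x|lebesgue_on \<Omega>. \<phi> x *\<^sub>R weak_div \<Omega> \<sigma> x))"
    unfolding integral_test_add_scaled[OF divL2 sm] integral_grad_add_scaled[OF L2 sm]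
    by (simp add: scaleR_right_distrib)
  then show "(LINT x|lebesgue_on \<Omega>. (c *\<^sub>R \<tau> x + \<sigma> x) *v grad \<phi> x)
      + (LINT x|lebesgue_on \<Omega>. \<phi> x *\<^sub>R (c *\<^sub>R weak_div \<Omega> \<tau> x + weak_div \<Omega> \<sigma> x)) = 0"
    using green assms by simp
qed

end

section \<open>Geometry of the mesh\<close>

locale fe_mesh =
  fixes \<Omega> :: "(real^'n) set" and \<T> :: "(real^'n) set set"
  assumes domain: "polyhedral_domain \<Omega>" and partition: "fe_partition \<Omega> \<T>"
begin

lemma domain_props: "open \<Omega>" "connected \<Omega>" "\<Omega> \<noteq> {}" "bounded \<Omega>" "\<Omega> = interior (closure \<Omega>)"
  using domain by (auto simp: polyhedral_domain_def)

lemma finite_mesh: "finite \<T>" and mesh_union: "\<Union>\<T> = closure \<Omega>"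
  and mesh_face: "E \<in> \<T> \<Longrightarrow> E' \<in> \<T> \<Longrightarrow> E \<inter> E' face_of E"
  using partition by (auto simp: fe_partition_def triangulation_def)

lemma element_simplex:
  assumes "E \<in> \<T>"
  shows "full_simplex (vertices E)" "E = convex hull (vertices E)"
proof -
  obtain C where C: "\<not> affine_dependent C" "int (card C) = int CARD('n) + 1" "E = convex hull C"
    using assms partition by (auto simp: fe_partition_def simplex_def)
  have "vertices E = C"
    using extreme_point_of_convex_hull_affine_independent[OF C(1)] C(3) by (auto simp: vertices_def)
  then show "full_simplex (vertices E)" "E = convex hull (vertices E)"
    using C by (auto simp: full_simplex_def)
qed

lemma element_props:
  assumes "E \<in> \<T>"
  shows "compact E" "convex E" "interior E \<noteq> {}" "closure (interior E) = E" "0 < measure lebesgue E"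
    "finite (vertices E)" "E \<subseteq> closure \<Omega>" "interior E \<subseteq> \<Omega>"
proof -
  interpret full_simplex "vertices E" by (rule element_simplex[OF assms])
  note E = element_simplex(2)[OF assms]
  show "compact E" "interior E \<noteq> {}" "closure (interior E) = E" "0 < measure lebesgue E"
    using compact_hull interior_hull_nonempty closure_interior_hull volume_pos unfolding E[symmetric] by auto
  show "convex E" using E by (metis convex_convex_hull)
  show "finite (vertices E)" by simp
  show "E \<subseteq> closure \<Omega>" using assms mesh_union by blast
  then show "interior E \<subseteq> \<Omega>" using domain_props(5) interior_mono by blast
qed

lemma vertices_subset: "E \<in> \<T> \<Longrightarrow> vertices E \<subseteq> E"
  by (auto simp: vertices_def extreme_point_of_def)

lemma aff_dim_element: "E \<in> \<T> \<Longrightarrow> aff_dim E = int CARD('n)"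
  using aff_dim_nonempty_interior[OF element_props(3)] by simp

lemma interiors_disjoint:
  assumes "E \<in> \<T>" "E' \<in> \<T>" "E \<noteq> E'" shows "interior E \<inter> interior E' = {}"
proof (rule ccontr)
  assume "interior E \<inter> interior E' \<noteq> {}"
  then have "interior (E \<inter> E') \<noteq> {}" by simp
  then have dim: "aff_dim (E \<inter> E') = int CARD('n)"
    using aff_dim_nonempty_interior[of "E \<inter> E'"] by simp
  have "E \<inter> E' = E"
    using face_of_aff_dim_lt[OF element_props(2)[OF assms(1)] mesh_face[OF assms(1,2)]]
      dim aff_dim_element[OF assms(1)] by auto
  moreover have "E' \<inter> E = E'"
    using face_of_aff_dim_lt[OF element_props(2)[OF assms(2)] mesh_face[OF assms(2,1)]]
      dim aff_dim_element[OF assms(2)] by (auto simp: Int_commute)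
  ultimately show False using assms(3) by blast
qed

lemma AE_in_element_interior: "AE x in lebesgue_on \<Omega>. \<exists>E\<in>\<T>. x \<in> interior E"
proof -
  have "frontier E \<in> null_sets lebesgue" if "E \<in> \<T>" for E
    using negligible_convex_frontier[OF element_props(2)[OF that]] by (simp add: negligible_iff_null_sets)
  then have "(\<Union>E\<in>\<T>. frontier E) \<in> null_sets lebesgue"
    using finite_mesh by (intro null_sets.finite_UN) auto
  then have "AE x in lebesgue. x \<notin> (\<Union>E\<in>\<T>. frontier E)"
    by (rule AE_not_in)
  then have "AE x in lebesgue. x \<in> \<Omega> \<longrightarrow> (\<exists>E\<in>\<T>. x \<in> interior E)"
  proof (rule eventually_mono)
    fix x assume x: "x \<notin> (\<Union>E\<in>\<T>. frontier E)"
    show "x \<in> \<Omega> \<longrightarrow> (\<exists>E\<in>\<T>. x \<in> interior E)"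
    proof
      assume "x \<in> \<Omega>"
      then obtain E where "E \<in> \<T>" "x \<in> E"
        using mesh_union closure_subset by blast
      then show "\<exists>E\<in>\<T>. x \<in> interior E"
        using x closure_subset by (auto simp: frontier_def)
    qed
  qed
  then show ?thesis
    using domain_props(1) by (subst AE_restrict_space_iff) auto
qed

lemma negligible_affine_hull_insert:
  fixes S :: "(real^'n) set"
  assumes "aff_dim S \<le> int CARD('n) - 2" shows "negligible (affine hull (insert p S))"
proof -
  have "aff_dim (affine hull (insert p S)) < int CARD('n)"
    using assms by (simp add: aff_dim_insert)
  then have "interior (affine hull (insert p S)) = {}"
    using aff_dim_nonempty_interior[of "affine hull (insert p S)"] by auto
  then show ?thesis
    by (simp add: negligible_convex_interior affine_imp_convex)
qed

text \<open>If no facet is shared, elements of different parts meet in faces of codimension at least two. Let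
\<open>z\<close> be a point of the connected set \<open>\<Omega>\<close> where the two parts touch, and let
\<open>p\<close> be a nearby point in the interior of an element of the first part. The points \<open>q\<close> for
which the segment from \<open>p\<close> to \<open>q\<close> meets one of these faces lie in the affine hull of
\<open>p\<close> and the face, a null set. Hence some \<open>q\<close> near \<open>z\<close>, in the interior of an
element of the second part, can be joined to \<open>p\<close> without meeting any of them. But the segment is
connected, stays in \<open>\<Omega>\<close> and has an end in either part, so it contains a point that belongs to
both.\<close>

lemma shared_facet_between_parts:
  assumes parts: "\<T> = \<T>1 \<union> \<T>2" "\<T>1 \<noteq> {}" "\<T>2 \<noteq> {}" "\<T>1 \<inter> \<T>2 = {}"
  obtains E E' F where "E \<in> \<T>1" "E' \<in> \<T>2" "F facet_of E" "F facet_of E'"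
proof -
  have "\<exists>E\<in>\<T>1. \<exists>E'\<in>\<T>2. \<exists>F. F facet_of E \<and> F facet_of E'"
  proof (rule ccontr)
    assume none: "\<not> ?thesis"
    have mesh: "E \<in> \<T>" if "E \<in> \<T>1 \<or> E \<in> \<T>2" for E using that parts(1) by blast
    have low: "aff_dim (E \<inter> E') \<le> int CARD('n) - 2" if E: "E \<in> \<T>1" "E' \<in> \<T>2" for E E'
    proof -
      have face: "E \<inter> E' face_of E" "E \<inter> E' face_of E'"
        using mesh_face[of E E'] mesh_face[of E' E] mesh E by (auto simp: Int_commute)
      have "E \<noteq> E'" using E parts(4) by blast
      have "E \<inter> E' \<noteq> E"
      proof
        assume "E \<inter> E' = E"
        then have "interior E \<subseteq> interior E'" by (intro interior_mono) blast
        then show False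
          using interiors_disjoint[of E E'] element_props(3)[of E] mesh E \<open>E \<noteq> E'\<close> by blast
      qed
      then have "aff_dim (E \<inter> E') < int CARD('n)"
        using face_of_aff_dim_lt[OF element_props(2) face(1)] aff_dim_element[of E] mesh E by auto
      moreover have "aff_dim (E \<inter> E') \<noteq> int CARD('n) - 1"
      proof
        assume dim: "aff_dim (E \<inter> E') = int CARD('n) - 1"
        then have "E \<inter> E' \<noteq> {}"
          using zero_less_card_finite[where 'a = 'n] by (metis aff_dim_empty diff_add_cancel int_ops(1) of_nat_0_less_iff order_less_irrefl uminus_add_conv_diff add.right_inverse add.commute)
        then have "E \<inter> E' facet_of E" "E \<inter> E' facet_of E'"
          using face dim aff_dim_element mesh E by (auto simp: facet_of_def)
        then show False using none E by blast
      qed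
      ultimately show ?thesis by simp
    qed
    have closed: "closed (\<Union>\<T>1)" "closed (\<Union>\<T>2)"
      using finite_mesh parts(1) mesh element_props(1) by (auto intro!: closed_Union compact_imp_closed)
    have cover: "\<Omega> \<subseteq> \<Union>\<T>1 \<union> \<Union>\<T>2"
      using mesh_union parts(1) closure_subset by blast
    have meets: "U \<inter> \<Union>\<T>1 \<inter> \<Union>\<T>2 \<noteq> {}"
      if "connected U" "U \<subseteq> \<Omega>" "U \<inter> \<Union>\<T>1 \<noteq> {}" "U \<inter> \<Union>\<T>2 \<noteq> {}" for U
      using connected_closedD[OF that(1) _ _ closed] that(2-) cover by blast
    have touch: "\<Omega> \<inter> E \<noteq> {}" if "E \<in> \<T>" for E
      using element_props(3,8)[OF that] interior_subset by blast
    obtain z where z: "z \<in> \<Omega>" "z \<in> \<Union>\<T>1" "z \<in> \<Union>\<T>2"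
      using meets[OF domain_props(2)] touch mesh parts(2,3) by blast
    then obtain E1 E2 where E: "E1 \<in> \<T>1" "z \<in> E1" "E2 \<in> \<T>2" "z \<in> E2" by blast
    obtain \<epsilon> where \<epsilon>: "0 < \<epsilon>" "ball z \<epsilon> \<subseteq> \<Omega>"
      using domain_props(1) z(1) open_contains_ball by blast
    have near: "\<exists>p. p \<in> ball z \<epsilon> \<inter> interior E" if "E \<in> \<T>" "z \<in> E" for E
    proof -
      have "z \<in> closure (interior E)" using element_props(4)[OF that(1)] that(2) by simp
      then show ?thesis
        using \<epsilon>(1) by (metis IntI closure_approachable dist_commute mem_ball)
    qed
    obtain p where p: "p \<in> ball z \<epsilon>" "p \<in> interior E1"
      using near[of E1] mesh E by blast
    define N where "N = (\<Union>E\<in>\<T>1. \<Union>E'\<in>\<T>2. affine hull (insert p (E \<inter> E')))"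
    have finite: "finite \<T>1" "finite \<T>2" using finite_mesh parts(1) by auto
    have "negligible N"
      unfolding N_def using finite low
      by (auto intro!: negligible_Union negligible_affine_hull_insert)
    moreover have "\<not> negligible (ball z \<epsilon> \<inter> interior E2)"
      using near[of E2] mesh E by (intro open_not_negligible) auto
    ultimately obtain q where q: "q \<in> ball z \<epsilon>" "q \<in> interior E2" "q \<notin> N"
      using negligible_subset[of N "ball z \<epsilon> \<inter> interior E2"] by blast
    let ?S = "closed_segment p q"
    have "?S \<subseteq> ball z \<epsilon>"
      using p(1) q(1) by (intro closed_segment_subset) auto
    then have "?S \<subseteq> \<Omega>" using \<epsilon>(2) by blast
    moreover have "p \<in> ?S" "q \<in> ?S" "p \<in> \<Union>\<T>1" "q \<in> \<Union>\<T>2"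
      using p q E interior_subset by auto
    ultimately obtain y where y: "y \<in> ?S" "y \<in> \<Union>\<T>1" "y \<in> \<Union>\<T>2"
      using meets[of ?S] by auto
    then obtain E E' where EE: "E \<in> \<T>1" "E' \<in> \<T>2" "y \<in> E \<inter> E'" by blast
    have "p \<noteq> y"
    proof
      assume "p = y"
      then have "p \<in> interior E1 \<inter> closure (interior E')"
        using p(2) EE mesh element_props(4)[of E'] by auto
      then have "interior E1 \<inter> interior E' \<noteq> {}"
        using open_Int_closure_eq_empty[OF open_interior] by blast
      then show False
        using interiors_disjoint[of E1 E'] mesh E EE parts(4) by blast
    qed
    obtain t where t: "y = (1 - t) *\<^sub>R p + t *\<^sub>R q" "0 \<le> t" "t \<le> 1"
      using y(1) by (auto simp: in_segment)
    have t0: "t \<noteq> 0" using t \<open>p \<noteq> y\<close> by auto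
    \<comment> \<open>\<open>q\<close> lies on the line through \<open>p\<close> and the point \<open>y\<close> of a face, against its choice\<close>
    have "q = (1 - 1 / t) *\<^sub>R p + (1 / t) *\<^sub>R y"
      using t0 by (simp add: t(1) scaleR_right_distrib scaleR_left_diff_distrib algebra_simps)
    moreover have "p \<in> affine hull (insert p (E \<inter> E'))" "y \<in> affine hull (insert p (E \<inter> E'))"
      using EE(3) by (auto intro: hull_inc)
    ultimately have "q \<in> affine hull (insert p (E \<inter> E'))"
      by (simp add: mem_affine)
    then show False using q(3) EE(1,2) by (auto simp: N_def)
  qed
  then show ?thesis using that by blast
qed

lemma facet_opposite_vertex:
  assumes "E \<in> \<T>" "F facet_of E"
  obtains a where "a \<in> vertices E" "F = convex hull (vertices E - {a})" "vertices F = vertices E - {a}"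
proof -
  interpret full_simplex "vertices E" by (rule element_simplex[OF assms(1)])
  have "F facet_of convex hull (vertices E)" using assms element_simplex(2) by metis
  then obtain a where a: "a \<in> vertices E" "F = convex hull (vertices E - {a})"
    using facet_of_convex_hull_affine_independent[OF indep] by auto
  have "\<not> affine_dependent (vertices E - {a})"
    using indep affine_independent_Diff by blast
  then have "vertices F = vertices E - {a}"
    unfolding vertices_def a(2) using extreme_point_of_convex_hull_affine_independent by blast
  then show ?thesis using a that by blast
qed

end

section \<open>Polynomials of degree at most one\<close>

lemma poly_deg_0_iff:
  fixes p :: "real^'n \<Rightarrow> real"
  shows "p \<in> poly_deg 0 \<longleftrightarrow> (\<exists>b. \<forall>x. p x = b)"
proof -
  have "{\<alpha> :: 'n \<Rightarrow> nat. (\<Sum>i\<in>UNIV. \<alpha> i) \<le> 0} = {\<lambda>_. 0}"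
    by auto
  then have "p \<in> poly_deg 0 \<longleftrightarrow> (\<exists>c :: ('n \<Rightarrow> nat) \<Rightarrow> real. \<forall>x. p x = c (\<lambda>_. 0))"
    by (simp add: poly_deg_def)
  also have "\<dots> \<longleftrightarrow> (\<exists>b. \<forall>x. p x = b)"
    by (metis (no_types))
  finally show ?thesis .
qed

lemma poly_deg_1_iff:
  fixes p :: "real^'n \<Rightarrow> real"
  shows "p \<in> poly_deg 1 \<longleftrightarrow> (\<exists>b g. \<forall>x. p x = b + g \<bullet> x)"
proof -
  \<comment> \<open>the multi-indices of order one\<close>
  define e :: "'n \<Rightarrow> 'n \<Rightarrow> nat" where "e j i = (if i = j then 1 else 0)" for i j
  have inj: "inj e"
    by (rule injI) (metis e_def zero_neq_one)
  have e0: "e j \<noteq> (\<lambda>_. 0)" for j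
    by (metis e_def zero_neq_one)
  have index: "{\<alpha> :: 'n \<Rightarrow> nat. (\<Sum>i\<in>UNIV. \<alpha> i) \<le> 1} = insert (\<lambda>_. 0) (range e)"
  proof (intro equalityI subsetI)
    fix \<alpha> :: "'n \<Rightarrow> nat" assume "\<alpha> \<in> {\<alpha>. (\<Sum>i\<in>UNIV. \<alpha> i) \<le> 1}"
    then have le: "(\<Sum>i\<in>UNIV. \<alpha> i) \<le> 1" by simp
    show "\<alpha> \<in> insert (\<lambda>_. 0) (range e)"
    proof (cases "\<exists>j. \<alpha> j \<noteq> 0")
      case True
      then obtain j where j: "\<alpha> j \<noteq> 0" by blast
      have "(\<Sum>i\<in>UNIV. \<alpha> i) = \<alpha> j + (\<Sum>i\<in>UNIV - {j}. \<alpha> i)"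
        by (rule sum.remove) auto
      then have "\<alpha> j = 1" "(\<Sum>i\<in>UNIV - {j}. \<alpha> i) = 0" using le j by linarith+
      then have "\<alpha> = e j" by (auto simp: e_def fun_eq_iff)
      then show ?thesis by blast
    qed auto
  qed (auto simp: e_def)
  have monomial: "(\<Prod>i\<in>UNIV. (x $ i) ^ e j i) = x $ j" for x :: "real^'n" and j
    by (simp add: e_def if_distrib[of "\<lambda>k. _ ^ k"] prod.delta cong: if_cong)
  have eval_eq: "(\<Sum>\<alpha> | (\<Sum>i\<in>UNIV. \<alpha> i) \<le> 1. c \<alpha> * (\<Prod>i\<in>UNIV. (x $ i) ^ \<alpha> i)) =
      c (\<lambda>_. 0) + (\<chi> j. c (e j)) \<bullet> x" for c :: "('n \<Rightarrow> nat) \<Rightarrow> real" and x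
    unfolding index using e0 e0[symmetric]
    by (subst sum.insert) (auto simp: sum.reindex[OF inj] monomial inner_vec_def)
  show ?thesis
  proof
    assume "p \<in> poly_deg 1"
    then show "\<exists>b g. \<forall>x. p x = b + g \<bullet> x"
      unfolding poly_deg_def eval_eq by blast
  next
    assume "\<exists>b g. \<forall>x. p x = b + g \<bullet> x"
    then obtain b g where p: "\<And>x. p x = b + g \<bullet> x" by blast
    define c where "c \<alpha> = (if \<alpha> = (\<lambda>_. 0) then b else (\<Sum>j\<in>UNIV. real (\<alpha> j) * g $ j))" for \<alpha> :: "'n \<Rightarrow> nat"
    have "(\<chi> j. c (e j)) = g"
      using e0 by (auto simp: c_def e_def vec_eq_iff if_distrib[of real] if_distrib[of "\<lambda>k. k * _"] cong: if_cong)
    then show "p \<in> poly_deg 1"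
      unfolding poly_deg_def eval_eq using p by (auto simp: c_def intro!: exI[of _ c])
  qed
qed

text \<open>The fields that are admissible on a single element of the stress space.\<close>

definition affine_field :: "(real^'n \<Rightarrow> real^'n^'n) \<Rightarrow> bool" where
  "affine_field P \<longleftrightarrow> (\<forall>i j. (\<lambda>x. P x $ i $ j) \<in> poly_deg 1)"

lemma affine_field_iff:
  "affine_field P \<longleftrightarrow> (\<exists>b g. \<forall>x i j. P x $ i $ j = b i j + g i j \<bullet> x)"
  unfolding affine_field_def poly_deg_1_iff by metis

lemma affine_fieldI: "(\<And>x i j. P x $ i $ j = b i j + g i j \<bullet> x) \<Longrightarrow> affine_field P"
  unfolding affine_field_def poly_deg_1_iff by blast

lemma affine_field_add_scaled:
  assumes "affine_field P" "affine_field Q" shows "affine_field (\<lambda>x. c *\<^sub>R P x + Q x)"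
proof -
  obtain b g where P: "\<And>x i j. P x $ i $ j = b i j + g i j \<bullet> x" using assms(1) unfolding affine_field_iff by blast
  obtain b' g' where Q: "\<And>x i j. Q x $ i $ j = b' i j + g' i j \<bullet> x" using assms(2) unfolding affine_field_iff by blast
  show ?thesis
    by (rule affine_fieldI[where b = "\<lambda>i j. c * b i j + b' i j" and g = "\<lambda>i j. c *\<^sub>R g i j + g' i j"])
       (simp add: P Q inner_add_left algebra_simps)
qed

lemma affine_field_continuous:
  assumes "affine_field P" shows "continuous_on S P"
proof -
  obtain b g where P: "\<And>x i j. P x $ i $ j = b i j + g i j \<bullet> x" using assms unfolding affine_field_iff by blast
  have "P = (\<lambda>x. \<chi> i j. b i j + g i j \<bullet> x)"
    by (simp add: fun_eq_iff vec_eq_iff P)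
  then show ?thesis
    by (auto intro!: continuous_intros continuous_on_vec_lambda)
qed

lemma affine_field_combination:
  assumes "affine_field P" "sum u A = 1" shows "P (\<Sum>v\<in>A. u v *\<^sub>R v) = (\<Sum>v\<in>A. u v *\<^sub>R P v)"
proof -
  obtain b g where P: "\<And>x i j. P x $ i $ j = b i j + g i j \<bullet> x" using assms(1) unfolding affine_field_iff by blast
  have "P (\<Sum>v\<in>A. u v *\<^sub>R v) $ i $ j = (\<Sum>v\<in>A. u v *\<^sub>R P v) $ i $ j" for i j
  proof -
    have "P (\<Sum>v\<in>A. u v *\<^sub>R v) $ i $ j = b i j * sum u A + (\<Sum>v\<in>A. u v * (g i j \<bullet> v))"
      using assms(2) by (simp add: P inner_sum_right)
    also have "\<dots> = (\<Sum>v\<in>A. u v * (b i j + g i j \<bullet> v))"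
      by (simp add: sum_distrib_left sum_distrib_right sum.distrib distrib_left mult.commute)
    finally show ?thesis by (simp add: P)
  qed
  then show ?thesis by (simp add: vec_eq_iff)
qed

section \<open>Element fields\<close>

definition outer :: "real^'n \<Rightarrow> real^'n \<Rightarrow> real^'n^'n" where
  "outer w b = (\<chi> i j. w $ i * b $ j)"

lemma outer_mult_vec: "outer w b *v g = (b \<bullet> g) *\<^sub>R w"
  by (simp add: vec_eq_iff outer_def matrix_vector_mult_def inner_vec_def sum_distrib_right sum_distrib_left mult_ac)

lemma inner_outer: "M \<bullet> outer w b = (M *v b) \<bullet> w"
  by (simp add: inner_vec_def outer_def matrix_vector_mult_def sum_distrib_right sum_distrib_left mult_ac)

lemma skew_inner_eq_0:
  assumes "skew G" shows "v \<bullet> (G *v v) = 0"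
proof -
  have "v \<bullet> (G *v v) = (transpose G *v v) \<bullet> v"
    by (simp add: dot_lmul_matrix transpose_matrix_vector)
  also have "transpose G *v v = - (G *v v)"
  proof -
    have "(- G) *v v = - (G *v v)" by (simp add: vec_eq_iff matrix_vector_mul_component)
    then show ?thesis using assms by (simp only: skew_def)
  qed
  also have "\<dots> \<bullet> v = - (v \<bullet> (G *v v))"
    by (simp add: inner_commute)
  finally show ?thesis by simp
qed

lemma L2_indicator:
  fixes f :: "real^'n \<Rightarrow> 'b::euclidean_space"
  assumes "f \<in> L2 \<Omega>" "U \<in> sets lebesgue" shows "(\<lambda>x. indicator U x *\<^sub>R f x) \<in> L2 \<Omega>"
proof -
  have ind: "(\<lambda>x. indicator U x :: real) \<in> borel_measurable (lebesgue_on \<Omega>)"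
    using assms(2) by (intro measurable_restrict_space1 borel_measurable_indicator)
  note meas = borel_measurable_scaleR[OF ind L2_measurable[OF assms(1)]]
  have "integrable (lebesgue_on \<Omega>) (\<lambda>x. (norm (indicator U x *\<^sub>R f x))\<^sup>2)"
  proof (rule Bochner_Integration.integrable_bound[OF _ _ AE_I2])
    show "integrable (lebesgue_on \<Omega>) (\<lambda>x. (norm (f x))\<^sup>2)" using assms(1) by (simp add: L2_def)
    show "(\<lambda>x. (norm (indicator U x *\<^sub>R f x))\<^sup>2) \<in> borel_measurable (lebesgue_on \<Omega>)"
      using meas by measurable
  qed (auto simp: indicator_def)
  then show ?thesis using meas by (simp add: L2_def)
qed

text \<open>All edges \<open>r - a\<close> have the same image under \<open>G\<close>, namely \<open>- U / s\<close>.
As \<open>G\<close> is skew-symmetric, each edge is orthogonal to its image; so \<open>U\<close> is orthogonal to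
vectors that span the space. It vanishes, and \<open>G\<close> maps a spanning set to zero.\<close>

lemma skew_field_on_facet_edges_eq_0:
  fixes C :: "(real^'n) set"
  assumes "full_simplex C" "a \<in> C" "skew G" "s \<noteq> 0"
    and eq: "\<And>r. r \<in> C - {a} \<Longrightarrow> U + s *\<^sub>R (G *v (r - a)) = 0"
  shows "U = 0" "G = 0"
proof -
  interpret full_simplex C by fact
  have edge: "s *\<^sub>R (G *v (r - a)) = - U" if "r \<in> C - {a}" for r
    using eq[OF that] by (simp add: eq_neg_iff_add_eq_0 add.commute)
  have "U = 0"
  proof (rule facet_edges_span[OF assms(2)])
    fix r assume r: "r \<in> C - {a}"
    have "(r - a) \<bullet> (s *\<^sub>R (G *v (r - a))) = 0"
      using skew_inner_eq_0[OF assms(3)] by simp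
    then show "(r - a) \<bullet> U = 0" unfolding edge[OF r] by simp
  qed
  moreover have "G $ i = 0" for i
  proof (rule facet_edges_span[OF assms(2)])
    fix r assume "r \<in> C - {a}"
    then have "G *v (r - a) = 0" using edge \<open>U = 0\<close> assms(4) by auto
    then show "(r - a) \<bullet> G $ i = 0"
      by (metis inner_commute matrix_vector_mul_component zero_index)
  qed
  ultimately show "U = 0" "G = 0" by (auto simp: vec_eq_iff)
qed

sublocale fe_mesh \<subseteq> bounded_domain
  using domain_props by unfold_locales auto

context fe_mesh
begin

lemma integral_over_element:
  fixes f :: "real^'n \<Rightarrow> real"
  assumes E: "E \<in> \<T>" and f: "continuous_on UNIV f"
  shows "(LINT x|lebesgue_on \<Omega>. indicator (interior E) x * f x) = (LINT x:E|lborel. f x)"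
    and "integrable (lebesgue_on \<Omega>) (\<lambda>x. indicator (interior E) x * f x)"
proof -
  have [measurable]: "f \<in> borel_measurable borel" using f by (rule borel_measurable_continuous_onI)
  have [measurable]: "E \<in> sets borel" by (rule borel_closed[OF compact_imp_closed[OF element_props(1)[OF E]]])
  have "frontier E \<in> null_sets lebesgue"
    using negligible_convex_frontier[OF element_props(2)[OF E]] by (simp add: negligible_iff_null_sets)
  then have "AE x in lebesgue. x \<notin> frontier E" by (rule AE_not_in)
  then have ae: "AE x in lebesgue. indicator \<Omega> x *\<^sub>R (indicator (interior E) x * f x) = indicator E x *\<^sub>R f x"
  proof (rule eventually_mono)
    fix x assume "x \<notin> frontier E"
    then have "x \<in> interior E \<longleftrightarrow> x \<in> E"
      using closure_subset interior_subset by (auto simp: frontier_def)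
    then show "indicator \<Omega> x *\<^sub>R (indicator (interior E) x * f x) = indicator E x *\<^sub>R f x"
      using element_props(8)[OF E] by (auto simp: indicator_def)
  qed
  have lb: "(\<lambda>x. indicator E x *\<^sub>R f x) \<in> borel_measurable lborel"
    by measurable
  have m1: "(\<lambda>x. indicator \<Omega> x *\<^sub>R (indicator (interior E) x * f x)) \<in> borel_measurable lebesgue"
    using domain_props(1) by (intro measurable_completion) measurable
  have m2: "(\<lambda>x. indicator E x *\<^sub>R f x) \<in> borel_measurable lebesgue"
    using lb by (rule measurable_completion)
  have "(LINT x|lebesgue_on \<Omega>. indicator (interior E) x * f x)
      = (LINT x|lebesgue. indicator \<Omega> x *\<^sub>R (indicator (interior E) x * f x))"
    by (simp add: integral_restrict_space)
  also have "\<dots> = (LINT x|lebesgue. indicator E x *\<^sub>R f x)"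
    using m1 m2 ae by (rule integral_cong_AE)
  also have "\<dots> = (LINT x:E|lborel. f x)"
    unfolding set_lebesgue_integral_def using lb by (rule integral_completion)
  finally show "(LINT x|lebesgue_on \<Omega>. indicator (interior E) x * f x) = (LINT x:E|lborel. f x)" .
  show "integrable (lebesgue_on \<Omega>) (\<lambda>x. indicator (interior E) x * f x)"
    using L2_integrable[OF L2_indicator[OF L2_continuous_domain[OF f], of "interior E"]] by simp
qed

definition element_bary :: "(real^'n) set \<Rightarrow> real^'n \<Rightarrow> real^'n \<Rightarrow> real" where
  "element_bary E r = full_simplex.bary (vertices E) r"

text \<open>Each row is a multiple of the basis function of the lowest order Brezzi-Douglas-Marini space that belongs
to the vertex \<open>r\<close> of the facet opposite \<open>a\<close>: of all normal components at the vertices, only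
the one at \<open>r\<close> on this facet is different from zero. The normalisation by the volume makes the flux
through the facet independent of the element on either side of it.\<close>

definition element_field ::
    "(real^'n) set \<Rightarrow> real^'n \<Rightarrow> real^'n \<Rightarrow> real^'n \<Rightarrow> real^'n \<Rightarrow> real^'n^'n" where
  "element_field E r a w x =
     indicator (interior E) x *\<^sub>R ((element_bary E r x / measure lebesgue E) *\<^sub>R outer w (r - a))"

text \<open>The divergence of \<open>element_field E r a w\<close>, which is the same for all \<open>r\<close> and
\<open>a\<close>.\<close>

definition element_div :: "(real^'n) set \<Rightarrow> real^'n \<Rightarrow> real^'n \<Rightarrow> real^'n" where
  "element_div E w x = indicator (interior E) x *\<^sub>R ((1 / measure lebesgue E) *\<^sub>R w)"

lemma element_bary_continuous: "E \<in> \<T> \<Longrightarrow> r \<in> vertices E \<Longrightarrow> continuous_on S (element_bary E r)"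
  unfolding element_bary_def by (rule full_simplex.continuous_bary[OF element_simplex(1)])

lemma element_field_L2: "E \<in> \<T> \<Longrightarrow> r \<in> vertices E \<Longrightarrow> element_field E r a w \<in> L2 \<Omega>"
  unfolding element_field_def[abs_def] using element_props(5)[of E]
  by (intro L2_indicator L2_continuous_domain continuous_intros element_bary_continuous) auto

lemma element_div_L2: "element_div E w \<in> L2 \<Omega>"
  unfolding element_div_def[abs_def]
  by (intro L2_indicator L2_continuous_domain continuous_intros) auto

text \<open>The flux of the element field through the facet opposite \<open>a\<close>, weighted with
\<open>\<phi>\<close>, as the volume integral to which it is equal by Green's formula.\<close>

definition facet_flux :: "(real^'n) set \<Rightarrow> real^'n \<Rightarrow> real^'n \<Rightarrow> (real^'n \<Rightarrow> real) \<Rightarrow> real" where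
  "facet_flux E r a \<phi> =
     (LINT x:E|lborel. element_bary E r x * (grad \<phi> x \<bullet> (r - a)) + \<phi> x) / measure lebesgue E"

lemma element_green:
  assumes E: "E \<in> \<T>" "r \<in> vertices E" and \<phi>: "smooth \<phi>"
  shows "(LINT x|lebesgue_on \<Omega>. element_field E r a w x *v grad \<phi> x)
       + (LINT x|lebesgue_on \<Omega>. \<phi> x *\<^sub>R element_div E w x) = facet_flux E r a \<phi> *\<^sub>R w"
proof -
  let ?q = "\<lambda>x. element_bary E r x * (grad \<phi> x \<bullet> (r - a)) + \<phi> x"
  have cont: "continuous_on UNIV ?q"
    using smooth_continuous[OF \<phi>] smooth_grad_continuous[OF \<phi>] element_bary_continuous[OF E]
    by (intro continuous_intros)
  have "(LINT x|lebesgue_on \<Omega>. element_field E r a w x *v grad \<phi> x)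
       + (LINT x|lebesgue_on \<Omega>. \<phi> x *\<^sub>R element_div E w x)
     = (LINT x|lebesgue_on \<Omega>. element_field E r a w x *v grad \<phi> x + \<phi> x *\<^sub>R element_div E w x)"
    using integrable_grad[OF element_field_L2[OF E] \<phi>] integrable_test[OF element_div_L2 \<phi>] by simp
  also have "\<dots> = (LINT x|lebesgue_on \<Omega>. (indicator (interior E) x * ?q x) *\<^sub>R ((1 / measure lebesgue E) *\<^sub>R w))"
  proof (intro Bochner_Integration.integral_cong refl)
    fix x
    have "(c *\<^sub>R outer w b) *v g = (c * (g \<bullet> b)) *\<^sub>R w" for c and b g :: "real^'n"
      by (simp add: scaleR_matrix_vector_assoc[symmetric] outer_mult_vec inner_commute)
    then show "element_field E r a w x *v grad \<phi> x + \<phi> x *\<^sub>R element_div E w x =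
        (indicator (interior E) x * ?q x) *\<^sub>R ((1 / measure lebesgue E) *\<^sub>R w)"
      by (cases "x \<in> interior E") (simp_all add: element_field_def element_div_def add_divide_distrib scaleR_left_distrib)
  qed
  also have "\<dots> = (LINT x|lebesgue_on \<Omega>. indicator (interior E) x * ?q x) *\<^sub>R ((1 / measure lebesgue E) *\<^sub>R w)"
    using integral_over_element(2)[OF E(1) cont] by (intro integral_scaleR_left)
  also have "\<dots> = facet_flux E r a \<phi> *\<^sub>R w"
    unfolding integral_over_element(1)[OF E(1) cont] by (simp add: facet_flux_def)
  finally show ?thesis .
qed

lemma facet_flux_eq_0:
  assumes "E \<in> \<T>" "a \<in> vertices E" "r \<in> vertices E - {a}" "smooth \<phi>"
    and "\<And>x. x \<in> convex hull (vertices E - {a}) \<Longrightarrow> \<phi> x = 0"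
  shows "facet_flux E r a \<phi> = 0"
  using full_simplex.flux_integral_eq_0[OF element_simplex(1)[OF assms(1)] _ assms(2) _
      smooth_has_derivative[OF assms(4)] smooth_grad_continuous[OF assms(4)] assms(5), of r] assms(3)
  unfolding facet_flux_def element_bary_def element_simplex(2)[OF assms(1), symmetric] by auto

lemma facet_flux_shared:
  assumes E: "E \<in> \<T>" "a \<in> vertices E" and E': "E' \<in> \<T>" "b \<in> vertices E'"
    and K: "vertices E - {a} = vertices E' - {b}" "r \<in> vertices E - {a}" and \<phi>: "smooth \<phi>"
  shows "facet_flux E r a \<phi> = facet_flux E' r b \<phi>"
proof -
  have v: "insert a (vertices E - {a}) = vertices E" "insert b (vertices E - {a}) = vertices E'"
    using E(2) insert_Diff[OF E'(2), folded K(1)] by blast+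
  have b: "b \<notin> vertices E - {a}" unfolding K(1) by simp
  show ?thesis
    using flux_integral_shared_facet[where K = "vertices E - {a}" and a = a and b = b, unfolded v,
        OF element_simplex(1)[OF E(1)] _ element_simplex(1)[OF E'(1)] b K(2)
          smooth_has_derivative[OF \<phi>] smooth_grad_continuous[OF \<phi>]]
    unfolding facet_flux_def element_bary_def element_simplex(2)[OF E(1), symmetric]
      element_simplex(2)[OF E'(1), symmetric] by simp
qed

lemma element_field_affine:
  assumes "E \<in> \<T>" "r \<in> vertices E"
  shows "affine_field (\<lambda>x. (element_bary E r x / measure lebesgue E) *\<^sub>R outer w (r - a))"
proof -
  interpret full_simplex "vertices E" by (rule element_simplex(1)[OF assms(1)])
  define b where "b i j = (bary r 0 / measure lebesgue E) * outer w (r - a) $ i $ j" for i j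
  define g where "g i j = (outer w (r - a) $ i $ j / measure lebesgue E) *\<^sub>R bary_grad r" for i j
  have "((bary r x / measure lebesgue E) *\<^sub>R outer w (r - a)) $ i $ j = b i j + g i j \<bullet> x" for x i j
    unfolding bary_eq[OF assms(2), of x] b_def g_def by (simp add: algebra_simps add_divide_distrib)
  then show ?thesis
    unfolding element_bary_def by (rule affine_fieldI)
qed

lemma element_field_on_elements:
  assumes "E \<in> \<T>" "r \<in> vertices E" "D \<in> \<T>"
  shows "\<exists>P. affine_field P \<and> (\<forall>x\<in>interior D. element_field E r a w x = P x)"
proof (cases "D = E")
  case True
  then show ?thesis
    using element_field_affine[OF assms(1,2), of w a] by (intro exI conjI) (auto simp: element_field_def)
next
  case False
  have "affine_field (\<lambda>_. 0)"
    by (rule affine_fieldI[where b = "\<lambda>_ _. 0" and g = "\<lambda>_ _. 0"]) simp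
  moreover have "element_field E r a w x = 0" if "x \<in> interior D" for x
  proof -
    have "x \<notin> interior E" using interiors_disjoint[OF assms(1,3)] False that by blast
    then show ?thesis by (simp add: element_field_def)
  qed
  ultimately show ?thesis by (intro exI conjI) auto
qed

lemma XX_h_iff:
  "\<tau> \<in> XX_h \<Omega> \<Gamma> \<T> \<longleftrightarrow> \<tau> \<in> XX \<Omega> \<Gamma> \<and> (\<forall>E\<in>\<T>. \<exists>P. affine_field P \<and> (\<forall>x\<in>interior E. \<tau> x = P x))"
  by (simp add: XX_h_def affine_field_def)

text \<open>The weighted flux through the facet vanishes: a test function with compact support in
\<open>\<Omega>\<close> is zero on the facet because the facet lies outside \<open>\<Omega>\<close>, and a function
that is zero on \<open>\<Gamma>\<close> is zero on the whole facet by continuity.\<close>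

lemma boundary_element_field:
  assumes E: "E \<in> \<T>" "a \<in> vertices E" "r \<in> vertices E - {a}"
    and F: "convex hull (vertices E - {a}) \<subseteq> frontier \<Omega>" "rel_interior (convex hull (vertices E - {a})) \<subseteq> \<Gamma>"
  shows "element_field E r a w \<in> XX_h \<Omega> \<Gamma> \<T>"
    "AE x in lebesgue_on \<Omega>. weak_div \<Omega> (element_field E r a w) x = element_div E w x"
proof -
  let ?F = "convex hull (vertices E - {a})"
  have r: "r \<in> vertices E" using E(3) by simp
  have closedF: "closed ?F"
    using element_props(6)[OF E(1)] by (intro compact_imp_closed finite_imp_compact_convex_hull) auto
  have green: "(LINT x|lebesgue_on \<Omega>. element_field E r a w x *v grad \<phi> x)
      + (LINT x|lebesgue_on \<Omega>. \<phi> x *\<^sub>R element_div E w x) = 0"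
    if sm: "smooth \<phi>" and \<phi>: "test_function \<Omega> \<phi> \<or> (\<forall>x\<in>\<Gamma>. \<phi> x = 0)" for \<phi>
  proof -
    have "\<phi> x = 0" if x: "x \<in> ?F" for x
      using \<phi>
    proof
      assume "test_function \<Omega> \<phi>"
      then have "{x. \<phi> x \<noteq> 0} \<subseteq> \<Omega>"
        using closure_subset[of "{x. \<phi> x \<noteq> 0}"] unfolding test_function_def by blast
      moreover have "frontier \<Omega> \<inter> \<Omega> = {}"
        using domain_props(1) by (simp add: frontier_disjoint_eq)
      then have "x \<notin> \<Omega>" using F(1) x by blast
      ultimately show ?thesis by blast
    next
      assume "\<forall>x\<in>\<Gamma>. \<phi> x = 0"
      then have "\<And>y. y \<in> rel_interior ?F \<Longrightarrow> \<phi> y = 0" using F(2) by blast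
      moreover have "x \<in> closure (rel_interior ?F)"
        using x closedF by (simp add: convex_closure_rel_interior)
      ultimately show ?thesis
        using continuous_constant_on_closure[OF continuous_on_subset[OF smooth_continuous[OF sm] subset_UNIV]]
        by blast
    qed
    then show ?thesis
      unfolding element_green[OF E(1) r sm] using facet_flux_eq_0[OF E sm] by simp
  qed
  have "element_field E r a w \<in> XX \<Omega> \<Gamma>"
    using green by (rule XX_I(1)[OF element_field_L2[OF E(1) r] element_div_L2])
  then show "element_field E r a w \<in> XX_h \<Omega> \<Gamma> \<T>"
    using element_field_on_elements[OF E(1) r] by (auto simp: XX_h_iff)
  show "AE x in lebesgue_on \<Omega>. weak_div \<Omega> (element_field E r a w) x = element_div E w x"
    using green by (rule XX_I(2)[OF element_field_L2[OF E(1) r] element_div_L2])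
qed

text \<open>The two sides of a shared facet have opposite outward normals. Hence the element fields enter with
opposite signs, and their weighted fluxes through the facet cancel.\<close>

lemma interior_facet_field:
  fixes w :: "real^'n"
  assumes E: "E \<in> \<T>" "a \<in> vertices E" and E': "E' \<in> \<T>" "b \<in> vertices E'"
    and K: "vertices E - {a} = vertices E' - {b}" "r \<in> vertices E - {a}"
  defines "\<tau> \<equiv> (\<lambda>x. (-1) *\<^sub>R element_field E' r b w x + element_field E r a w x)"
  shows "\<tau> \<in> XX_h \<Omega> \<Gamma> \<T>"
    "AE x in lebesgue_on \<Omega>. weak_div \<Omega> \<tau> x = (-1) *\<^sub>R element_div E' w x + element_div E w x"
proof -
  have r: "r \<in> vertices E" "r \<in> vertices E'" using K by auto
  note field_L2 = element_field_L2[OF E'(1) r(2), of b w] element_field_L2[OF E(1) r(1), of a w]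
  note div_L2 = element_div_L2[of E' w] element_div_L2[of E w]
  have green: "(LINT x|lebesgue_on \<Omega>. \<tau> x *v grad \<phi> x)
      + (LINT x|lebesgue_on \<Omega>. \<phi> x *\<^sub>R ((-1) *\<^sub>R element_div E' w x + element_div E w x)) = 0"
    if sm: "smooth \<phi>" for \<phi>
  proof -
    have "(LINT x|lebesgue_on \<Omega>. \<tau> x *v grad \<phi> x)
        + (LINT x|lebesgue_on \<Omega>. \<phi> x *\<^sub>R ((-1) *\<^sub>R element_div E' w x + element_div E w x))
      = facet_flux E r a \<phi> *\<^sub>R w - facet_flux E' r b \<phi> *\<^sub>R w"
      unfolding \<tau>_def integral_grad_add_scaled[OF field_L2 sm] integral_test_add_scaled[OF div_L2 sm]
        element_green[OF E(1) r(1) sm, symmetric] element_green[OF E'(1) r(2) sm, symmetric]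
      by simp
    then show ?thesis using facet_flux_shared[OF E E' K sm] by simp
  qed
  have L2: "\<tau> \<in> L2 \<Omega>" "(\<lambda>x. (-1) *\<^sub>R element_div E' w x + element_div E w x) \<in> L2 \<Omega>"
    unfolding \<tau>_def by (rule L2_add_scaled[OF field_L2] L2_add_scaled[OF div_L2])+
  have "\<exists>P. affine_field P \<and> (\<forall>x\<in>interior D. \<tau> x = P x)" if D: "D \<in> \<T>" for D
  proof -
    obtain P where P: "affine_field P" "\<forall>x\<in>interior D. element_field E' r b w x = P x"
      using element_field_on_elements[OF E'(1) r(2) D] by blast
    obtain Q where Q: "affine_field Q" "\<forall>x\<in>interior D. element_field E r a w x = Q x"
      using element_field_on_elements[OF E(1) r(1) D] by blast
    show ?thesis
      using affine_field_add_scaled[OF P(1) Q(1), of "-1"] P(2) Q(2)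
      by (intro exI[of _ "\<lambda>x. (-1) *\<^sub>R P x + Q x"]) (auto simp: \<tau>_def)
  qed
  moreover have "\<tau> \<in> XX \<Omega> \<Gamma>"
    using green by (rule XX_I(1)[OF L2])
  ultimately show "\<tau> \<in> XX_h \<Omega> \<Gamma> \<T>" by (simp add: XX_h_iff)
  show "AE x in lebesgue_on \<Omega>. weak_div \<Omega> \<tau> x = (-1) *\<^sub>R element_div E' w x + element_div E w x"
    using green by (rule XX_I(2)[OF L2])
qed

lemma pairing_element_div:
  assumes E: "E \<in> \<T>" and u: "\<And>x. x \<in> interior E \<Longrightarrow> u x = U"
  shows "L2_inner \<Omega> u (element_div E w) = U \<bullet> w"
proof -
  have "L2_inner \<Omega> u (element_div E w) = (LINT x|lebesgue_on \<Omega>. indicator (interior E) x * ((U \<bullet> w) / measure lebesgue E))"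
    unfolding L2_inner_def
    by (intro Bochner_Integration.integral_cong refl) (auto simp: element_div_def u split: split_indicator)
  also have "\<dots> = (LINT x:E|lborel. (U \<bullet> w) / measure lebesgue E)"
    using E by (rule integral_over_element) (rule continuous_on_const)
  also have "\<dots> = (LINT x:E|lborel. ((U \<bullet> w) / measure lebesgue E) * 1)"
    by simp
  also have "\<dots> = ((U \<bullet> w) / measure lebesgue E) * (LINT x:E|lborel. 1)"
    by (rule set_integral_mult_right)
  also have "\<dots> = U \<bullet> w"
    using full_simplex.volume_eq[OF element_simplex(1)[OF E], folded element_simplex(2)[OF E]] element_props(5)[OF E]
    by simp
  finally show ?thesis .
qed

lemma pairing_element_field:
  assumes E: "E \<in> \<T>" "r \<in> vertices E" and \<gamma>: "\<And>x. x \<in> interior E \<Longrightarrow> \<gamma> x = G"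
  shows "L2_inner \<Omega> \<gamma> (element_field E r a w) = ((1 / (CARD('n) + 1)) *\<^sub>R (G *v (r - a))) \<bullet> w"
proof -
  let ?c = "((G *v (r - a)) \<bullet> w) / measure lebesgue E"
  have "L2_inner \<Omega> \<gamma> (element_field E r a w) =
      (LINT x|lebesgue_on \<Omega>. indicator (interior E) x * (?c * element_bary E r x))"
    unfolding L2_inner_def
    by (intro Bochner_Integration.integral_cong refl)
       (auto simp: element_field_def \<gamma> inner_outer split: split_indicator)
  also have "\<dots> = (LINT x:E|lborel. ?c * element_bary E r x)"
    using E by (intro integral_over_element(1) continuous_intros element_bary_continuous) auto
  also have "\<dots> = ?c * (LINT x:E|lborel. element_bary E r x)"
    by (rule set_integral_mult_right)
  also have "(LINT x:E|lborel. element_bary E r x) = measure lebesgue E / (CARD('n) + 1)"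
    using full_simplex.bary_integral[OF element_simplex(1)[OF E(1)] E(2), folded element_simplex(2)[OF E(1)]]
    by (simp add: element_bary_def)
  finally show ?thesis
    using element_props(5)[OF E(1)] by simp
qed

lemma VV_h_iff:
  "u \<in> VV_h \<Omega> \<T> \<longleftrightarrow> u \<in> L2 \<Omega> \<and> (\<forall>E\<in>\<T>. \<exists>U. \<forall>x\<in>interior E. u x = U)"
proof -
  have "(\<exists>P. (\<forall>i. (\<lambda>x. P x $ i) \<in> poly_deg 0) \<and> (\<forall>x\<in>interior E. u x = P x)) \<longleftrightarrow> (\<exists>U. \<forall>x\<in>interior E. u x = U)"
    (is "?l \<longleftrightarrow> ?r") for E
  proof
    assume ?l
    then obtain P where P: "\<And>i. (\<lambda>x. P x $ i) \<in> poly_deg 0" "\<And>x. x \<in> interior E \<Longrightarrow> u x = P x" by blast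
    obtain b where "\<And>i x. P x $ i = b i" using P(1) unfolding poly_deg_0_iff by metis
    then have "P x = (\<chi> i. b i)" for x by (simp add: vec_eq_iff)
    then show ?r using P(2) by auto
  next
    assume ?r
    then obtain U where "\<forall>x\<in>interior E. u x = U" by blast
    then show ?l by (intro exI[of _ "\<lambda>_. U"]) (auto simp: poly_deg_0_iff)
  qed
  then show ?thesis by (simp add: VV_h_def VV_def)
qed

text \<open>The inf-sup condition, without its uniformity in the mesh size. For \<open>u\<close> and
\<open>\<gamma>\<close> with the values \<open>U E\<close> and \<open>G E\<close> on \<open>E\<close>, testing with
element fields expresses the orthogonality by the vectors \<open>J E r a\<close>: they vanish if the facet opposite
\<open>a\<close> lies on the Dirichlet part, and they are the same on both sides of a shared facet. By
\<open>skew_field_on_facet_edges_eq_0\<close> an element has zero values as soon as these vectors vanish for all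
vertices \<open>r\<close> of a single facet. So the elements with zero values include one at the Dirichlet boundary,
and with any element all its neighbours across facets; by \<open>shared_facet_between_parts\<close> they are all
elements.\<close>

lemma discrete_kernel_trivial:
  assumes E0: "E0 \<in> \<T>" "F0 facet_of E0" "F0 \<subseteq> frontier \<Omega>" "rel_interior F0 \<subseteq> \<Gamma>"
    and u: "u \<in> VV_h \<Omega> \<T>" and \<gamma>: "\<gamma> \<in> WW_h0 \<Omega> \<T>"
    and ortho: "\<And>\<tau>. \<tau> \<in> XX_h \<Omega> \<Gamma> \<T> \<Longrightarrow> L2_inner \<Omega> u (weak_div \<Omega> \<tau>) + L2_inner \<Omega> \<gamma> \<tau> = 0"
    and E: "E \<in> \<T>" and x: "x \<in> interior E"
  shows "u x = 0" "\<gamma> x = 0"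
proof -
  have uL2: "u \<in> L2 \<Omega>" using u by (simp add: VV_h_def VV_def)
  have \<gamma>L2: "\<gamma> \<in> L2 \<Omega>" using \<gamma> by (simp add: WW_h0_def WW_def)
  have "\<exists>U. \<forall>x\<in>interior E. u x = U" if "E \<in> \<T>" for E
    using u that by (simp add: VV_h_iff)
  then obtain U where U: "\<And>E x. E \<in> \<T> \<Longrightarrow> x \<in> interior E \<Longrightarrow> u x = U E" by metis
  obtain G where G: "\<And>E. E \<in> \<T> \<Longrightarrow> skew (G E)" "\<And>E x. E \<in> \<T> \<Longrightarrow> x \<in> interior E \<Longrightarrow> \<gamma> x = G E"
    using \<gamma> unfolding WW_h0_def mem_Collect_eq by metis
  define J where "J E r a = U E + (1 / (CARD('n) + 1)) *\<^sub>R (G E *v (r - a))" for E r a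
  have pairing: "L2_inner \<Omega> u (element_div E w) + L2_inner \<Omega> \<gamma> (element_field E r a w) = J E r a \<bullet> w"
    if "E \<in> \<T>" "r \<in> vertices E" for E r a w
    using pairing_element_div[OF that(1) U[OF that(1)]] pairing_element_field[OF that G(2)[OF that(1)]]
    by (simp add: J_def inner_add_left)
  have zero: "U E = 0 \<and> G E = 0" if "E \<in> \<T>" "a \<in> vertices E" "\<And>r. r \<in> vertices E - {a} \<Longrightarrow> J E r a = 0" for E a
    using skew_field_on_facet_edges_eq_0[OF element_simplex(1)[OF that(1)] that(2) G(1)[OF that(1)], of "1 / (CARD('n) + 1)" "U E"]
      that(3) by (simp add: J_def)
  have start: "U E0 = 0 \<and> G E0 = 0"
  proof -
    obtain a where a: "a \<in> vertices E0" "F0 = convex hull (vertices E0 - {a})"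
      using facet_opposite_vertex[OF E0(1,2)] .
    show ?thesis
    proof (rule zero[OF E0(1) a(1)])
      fix r assume r: "r \<in> vertices E0 - {a}"
      have "J E0 r a \<bullet> w = 0" for w
      proof -
        note \<tau> = boundary_element_field[OF E0(1) a(1) r, where w = w and \<Gamma> = \<Gamma>, folded a(2), OF E0(3,4)]
        have "weak_div \<Omega> (element_field E0 r a w) \<in> L2 \<Omega>"
          using \<tau>(1) XX_weak_div_L2 unfolding XX_h_iff by blast
        then have "L2_inner \<Omega> u (weak_div \<Omega> (element_field E0 r a w)) = L2_inner \<Omega> u (element_div E0 w)"
          unfolding L2_inner_commute[of \<Omega> u] by (rule L2_inner_cong_AE[OF \<tau>(2) _ element_div_L2 uL2])
        then show ?thesis
          using ortho[OF \<tau>(1)] pairing[OF E0(1), of r w a] r by simp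
      qed
      from this[of "J E0 r a"] show "J E0 r a = 0" by simp
    qed
  qed
  define \<T>1 where "\<T>1 = {E \<in> \<T>. U E = 0 \<and> G E = 0}"
  have "\<T> - \<T>1 = {}"
  proof (rule ccontr)
    assume ne: "\<T> - \<T>1 \<noteq> {}"
    have parts: "\<T> = \<T>1 \<union> (\<T> - \<T>1)" "\<T>1 \<noteq> {}" "\<T>1 \<inter> (\<T> - \<T>1) = {}"
      using start E0(1) by (auto simp: \<T>1_def)
    obtain E1 E2 F where EF: "E1 \<in> \<T>1" "E2 \<in> \<T> - \<T>1" "F facet_of E1" "F facet_of E2"
      using shared_facet_between_parts[OF parts(1,2) ne parts(3)] .
    have mesh: "E1 \<in> \<T>" "E2 \<in> \<T>" using EF by (auto simp: \<T>1_def)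
    obtain a where a: "a \<in> vertices E1" "vertices F = vertices E1 - {a}"
      using facet_opposite_vertex[OF mesh(1) EF(3)] .
    obtain b where b: "b \<in> vertices E2" "vertices F = vertices E2 - {b}"
      using facet_opposite_vertex[OF mesh(2) EF(4)] .
    have K: "vertices E2 - {b} = vertices E1 - {a}" using a b by simp
    have "U E2 = 0 \<and> G E2 = 0"
    proof (rule zero[OF mesh(2) b(1)])
      fix r assume r: "r \<in> vertices E2 - {b}"
      have r': "r \<in> vertices E2" "r \<in> vertices E1" using r K by auto
      have "J E2 r b \<bullet> w = 0" for w
      proof -
        let ?\<tau> = "\<lambda>x. (-1) *\<^sub>R element_field E1 r a w x + element_field E2 r b w x"
        note \<tau> = interior_facet_field(1)[OF mesh(2) b(1) mesh(1) a(1) K r, where w = w and \<Gamma> = \<Gamma>]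
          interior_facet_field(2)[OF mesh(2) b(1) mesh(1) a(1) K r, where w = w]
        have "weak_div \<Omega> ?\<tau> \<in> L2 \<Omega>"
          using \<tau>(1) XX_weak_div_L2 unfolding XX_h_iff by blast
        then have "L2_inner \<Omega> u (weak_div \<Omega> ?\<tau>) =
            L2_inner \<Omega> u (\<lambda>x. (-1) *\<^sub>R element_div E1 w x + element_div E2 w x)"
          unfolding L2_inner_commute[of \<Omega> u]
          by (rule L2_inner_cong_AE[OF \<tau>(2) _ L2_add_scaled[OF element_div_L2 element_div_L2] uL2])
        also have "\<dots> = - L2_inner \<Omega> u (element_div E1 w) + L2_inner \<Omega> u (element_div E2 w)"
          using L2_inner_add_scaled_right[OF element_div_L2 element_div_L2 uL2, of "-1"] by simp
        finally have "0 = - (L2_inner \<Omega> u (element_div E1 w) + L2_inner \<Omega> \<gamma> (element_field E1 r a w))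
            + (L2_inner \<Omega> u (element_div E2 w) + L2_inner \<Omega> \<gamma> (element_field E2 r b w))"
          using ortho[OF \<tau>(1)] L2_inner_add_scaled_right[OF element_field_L2[OF mesh(1) r'(2)] element_field_L2[OF mesh(2) r'(1)] \<gamma>L2, of "-1" a w b w]
          by simp
        then have "J E2 r b \<bullet> w = J E1 r a \<bullet> w"
          unfolding pairing[OF mesh(1) r'(2)] pairing[OF mesh(2) r'(1)] by simp
        also have "J E1 r a = 0"
          using EF(1) by (simp add: J_def \<T>1_def)
        finally show ?thesis by simp
      qed
      from this[of "J E2 r b"] show "J E2 r b = 0" by simp
    qed
    then show False using EF(2) mesh(2) by (simp add: \<T>1_def)
  qed
  then have "U E = 0 \<and> G E = 0" using E by (auto simp: \<T>1_def)
  then show "u x = 0" "\<gamma> x = 0" using U[OF E x] G(2)[OF E x] by auto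
qed

section \<open>One-sided values, the vertex quadrature and the boundary term\<close>

lemma within_element_nontrivial:
  assumes "E \<in> \<T>" "r \<in> E" shows "at r within interior E \<noteq> bot"
proof -
  have "r islimpt interior E"
  proof (cases "r \<in> interior E")
    case True
    then show ?thesis using interior_limit_point[of r "interior E"] by simp
  next
    case False
    then show ?thesis
      using element_props(4)[OF assms(1)] assms(2) by (auto simp: closure_def)
  qed
  then show ?thesis by (simp add: trivial_limit_within)
qed

lemma value_from_within_eq:
  fixes P :: "real^'n \<Rightarrow> 'b::euclidean_space"
  assumes "E \<in> \<T>" "r \<in> E" and P: "continuous_on UNIV P" "\<And>x. x \<in> interior E \<Longrightarrow> \<phi> x = P x"
  shows "value_from_within E \<phi> r = P r"
proof -
  have "(P \<longlongrightarrow> P r) (at r within interior E)"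
    using P(1) by (meson continuous_on_def continuous_on_subset UNIV_I tendsto_within_subset top_greatest)
  moreover have "\<forall>\<^sub>F x in at r within interior E. P x = \<phi> x"
    using P(2) by (auto simp: eventually_at_filter)
  ultimately have lim: "(\<phi> \<longlongrightarrow> P r) (at r within interior E)"
    by (rule Lim_transform_eventually)
  then show ?thesis
    using tendsto_Lim[OF within_element_nontrivial[OF assms(1,2)] lim] by (auto simp: value_from_within_def)
qed

lemma XX_h_piece:
  assumes "\<tau> \<in> XX_h \<Omega> \<Gamma> \<T>" "E \<in> \<T>"
  shows "\<exists>P. affine_field P \<and> (\<forall>x\<in>interior E. \<tau> x = P x) \<and> (\<forall>x\<in>E. value_from_within E \<tau> x = P x)"
proof -
  obtain P where P: "affine_field P" "\<And>x. x \<in> interior E \<Longrightarrow> \<tau> x = P x"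
    using assms unfolding XX_h_iff by blast
  show ?thesis
    using P value_from_within_eq[OF assms(2) _ affine_field_continuous[OF P(1)] P(2)] by blast
qed

lemma XX_h_add_scaled:
  assumes "\<sigma> \<in> XX_h \<Omega> \<Gamma> \<T>" "\<tau> \<in> XX_h \<Omega> \<Gamma> \<T>" shows "(\<lambda>x. c *\<^sub>R \<sigma> x + \<tau> x) \<in> XX_h \<Omega> \<Gamma> \<T>"
  unfolding XX_h_iff
proof (intro conjI ballI)
  show "(\<lambda>x. c *\<^sub>R \<sigma> x + \<tau> x) \<in> XX \<Omega> \<Gamma>"
    using assms by (auto simp: XX_h_iff intro: XX_add_scaled)
  fix E assume E: "E \<in> \<T>"
  obtain P where P: "affine_field P" "\<And>x. x \<in> interior E \<Longrightarrow> \<sigma> x = P x"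
    using XX_h_piece[OF assms(1) E] by blast
  obtain Q where Q: "affine_field Q" "\<And>x. x \<in> interior E \<Longrightarrow> \<tau> x = Q x"
    using XX_h_piece[OF assms(2) E] by blast
  show "\<exists>P. affine_field P \<and> (\<forall>x\<in>interior E. c *\<^sub>R \<sigma> x + \<tau> x = P x)"
    using affine_field_add_scaled[OF P(1) Q(1), of c] P(2) Q(2)
    by (intro exI[of _ "\<lambda>x. c *\<^sub>R P x + Q x"]) auto
qed

lemma value_from_within_XX_h_add_scaled:
  assumes "\<sigma> \<in> XX_h \<Omega> \<Gamma> \<T>" "\<tau> \<in> XX_h \<Omega> \<Gamma> \<T>" "E \<in> \<T>" "r \<in> E"
  shows "value_from_within E (\<lambda>x. c *\<^sub>R \<sigma> x + \<tau> x) r = c *\<^sub>R value_from_within E \<sigma> r + value_from_within E \<tau> r"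
proof -
  obtain P where P: "affine_field P" "\<And>x. x \<in> interior E \<Longrightarrow> \<sigma> x = P x" "\<And>x. x \<in> E \<Longrightarrow> value_from_within E \<sigma> x = P x"
    using XX_h_piece[OF assms(1,3)] by blast
  obtain Q where Q: "affine_field Q" "\<And>x. x \<in> interior E \<Longrightarrow> \<tau> x = Q x" "\<And>x. x \<in> E \<Longrightarrow> value_from_within E \<tau> x = Q x"
    using XX_h_piece[OF assms(2,3)] by blast
  have "value_from_within E (\<lambda>x. c *\<^sub>R \<sigma> x + \<tau> x) r = c *\<^sub>R P r + Q r"
    by (rule value_from_within_eq[OF assms(3,4) affine_field_continuous[OF affine_field_add_scaled[OF P(1) Q(1)]]])
       (simp add: P(2) Q(2))
  then show ?thesis using P(3) Q(3) assms(4) by simp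
qed

lemma value_from_within_const:
  fixes U :: "'b::euclidean_space"
  assumes "E \<in> \<T>" "r \<in> E" "\<And>x. x \<in> interior E \<Longrightarrow> \<phi> x = U"
  shows "value_from_within E \<phi> r = U"
  by (rule value_from_within_eq[OF assms(1,2) continuous_on_const assms(3)])

lemma VV_h_add_scaled:
  assumes "u \<in> VV_h \<Omega> \<T>" "v \<in> VV_h \<Omega> \<T>" shows "(\<lambda>x. c *\<^sub>R u x + v x) \<in> VV_h \<Omega> \<T>"
proof -
  have "\<exists>W. \<forall>x\<in>interior E. c *\<^sub>R u x + v x = W" if "E \<in> \<T>" for E
  proof -
    have "\<exists>U. \<forall>x\<in>interior E. u x = U" "\<exists>V. \<forall>x\<in>interior E. v x = V"
      using assms that unfolding VV_h_iff by simp_all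
    then obtain U V where "\<forall>x\<in>interior E. u x = U" "\<forall>x\<in>interior E. v x = V"
      by (elim exE)
    then show ?thesis by (intro exI[of _ "c *\<^sub>R U + V"]) simp
  qed
  then show ?thesis using assms by (simp add: VV_h_iff L2_add_scaled)
qed

lemma skew_add_scaled: "skew M \<Longrightarrow> skew N \<Longrightarrow> skew (c *\<^sub>R M + N)"
proof -
  have "transpose (c *\<^sub>R M + N) = c *\<^sub>R transpose M + transpose N"
    by (simp add: vec_eq_iff transpose_def)
  then show "skew M \<Longrightarrow> skew N \<Longrightarrow> skew (c *\<^sub>R M + N)"
    by (simp add: skew_def)
qed

lemma WW_h0_iff:
  "\<gamma> \<in> WW_h0 \<Omega> \<T> \<longleftrightarrow> \<gamma> \<in> L2 \<Omega> \<and> (\<forall>E\<in>\<T>. \<exists>M. skew M \<and> (\<forall>x\<in>interior E. \<gamma> x = M))"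
proof -
  have "AE x in lebesgue_on \<Omega>. skew (\<gamma> x)" if "\<forall>E\<in>\<T>. \<exists>M. skew M \<and> (\<forall>x\<in>interior E. \<gamma> x = M)"
    using AE_in_element_interior by (rule eventually_mono) (use that in force)
  then show ?thesis by (auto simp: WW_h0_def WW_def)
qed

lemma WW_h0_add_scaled:
  assumes "\<gamma> \<in> WW_h0 \<Omega> \<T>" "\<xi> \<in> WW_h0 \<Omega> \<T>" shows "(\<lambda>x. c *\<^sub>R \<gamma> x + \<xi> x) \<in> WW_h0 \<Omega> \<T>"
proof -
  have "\<exists>W. skew W \<and> (\<forall>x\<in>interior E. c *\<^sub>R \<gamma> x + \<xi> x = W)" if "E \<in> \<T>" for E
  proof -
    have "\<exists>M. skew M \<and> (\<forall>x\<in>interior E. \<gamma> x = M)" "\<exists>N. skew N \<and> (\<forall>x\<in>interior E. \<xi> x = N)"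
      using assms that unfolding WW_h0_iff by simp_all
    then obtain M N where "skew M" "\<forall>x\<in>interior E. \<gamma> x = M" "skew N" "\<forall>x\<in>interior E. \<xi> x = N"
      by (elim exE conjE)
    then show ?thesis by (intro exI[of _ "c *\<^sub>R M + N"]) (simp add: skew_add_scaled)
  qed
  then show ?thesis using assms by (simp add: WW_h0_iff L2_add_scaled)
qed

lemma value_from_within_piecewise_constant_add_scaled:
  fixes u v :: "real^'n \<Rightarrow> 'b::euclidean_space"
  assumes "\<exists>U. \<forall>x\<in>interior E. u x = U" "\<exists>V. \<forall>x\<in>interior E. v x = V" "E \<in> \<T>" "r \<in> E"
  shows "value_from_within E (\<lambda>x. c *\<^sub>R u x + v x) r = c *\<^sub>R value_from_within E u r + value_from_within E v r"
proof -
  obtain U V where "\<forall>x\<in>interior E. u x = U" "\<forall>x\<in>interior E. v x = V"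
    using assms(1,2) by (elim exE)
  then show ?thesis
    using value_from_within_const[OF assms(3,4), of u U] value_from_within_const[OF assms(3,4), of v V]
      value_from_within_const[OF assms(3,4), of "\<lambda>x. c *\<^sub>R u x + v x" "c *\<^sub>R U + V"] by simp
qed

lemma zero_in_spaces: "(\<lambda>_. 0) \<in> XX_h \<Omega> \<Gamma> \<T>" "(\<lambda>_. 0) \<in> VV_h \<Omega> \<T>" "(\<lambda>_. 0) \<in> WW_h0 \<Omega> \<T>"
proof -
  have "(\<lambda>_. 0) \<in> XX \<Omega> \<Gamma>"
    by (rule XX_I(1)[OF L2_zero L2_zero]) simp
  moreover have "affine_field (\<lambda>_. 0)"
    by (rule affine_fieldI[where b = "\<lambda>_ _. 0" and g = "\<lambda>_ _. 0"]) simp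
  ultimately show "(\<lambda>_. 0) \<in> XX_h \<Omega> \<Gamma> \<T>" by (auto simp: XX_h_iff)
  show "(\<lambda>_. 0) \<in> VV_h \<Omega> \<T>" by (auto simp: VV_h_iff L2_zero)
  have "skew 0" by (simp add: skew_def vec_eq_iff transpose_def)
  then show "(\<lambda>_. 0) \<in> WW_h0 \<Omega> \<T>" by (auto simp: WW_h0_iff L2_zero)
qed

lemma spaces_L2:
  "\<tau> \<in> XX_h \<Omega> \<Gamma> \<T> \<Longrightarrow> \<tau> \<in> L2 \<Omega>" "\<tau> \<in> XX_h \<Omega> \<Gamma> \<T> \<Longrightarrow> weak_div \<Omega> \<tau> \<in> L2 \<Omega>"
  "u \<in> VV_h \<Omega> \<T> \<Longrightarrow> u \<in> L2 \<Omega>" "\<gamma> \<in> WW_h0 \<Omega> \<T> \<Longrightarrow> \<gamma> \<in> L2 \<Omega>"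
  by (auto simp: XX_h_iff VV_h_iff WW_h0_iff XX_L2 XX_weak_div_L2)

lemma XX_h_zero_if_vertex_values_zero:
  assumes "\<tau> \<in> XX_h \<Omega> \<Gamma> \<T>" "E \<in> \<T>" "\<And>r. r \<in> vertices E \<Longrightarrow> value_from_within E \<tau> r = 0" "x \<in> interior E"
  shows "\<tau> x = 0"
proof -
  interpret full_simplex "vertices E" by (rule element_simplex(1)[OF assms(2)])
  obtain P where P: "affine_field P" "\<And>x. x \<in> interior E \<Longrightarrow> \<tau> x = P x" "\<And>x. x \<in> E \<Longrightarrow> value_from_within E \<tau> x = P x"
    using XX_h_piece[OF assms(1,2)] by blast
  have "P v = 0" if "v \<in> vertices E" for v
    using P(3)[of v] vertices_subset[OF assms(2)] assms(3) that by auto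
  then have "P (\<Sum>v\<in>vertices E. bary v x *\<^sub>R v) = 0"
    by (simp add: affine_field_combination[OF P(1) bary_sum])
  then show ?thesis using P(2)[OF assms(4)] by (simp add: bary_combination)
qed

text \<open>The coefficient may be discontinuous, so its one-sided value can be a limit that is attained nowhere; the
lower bound survives the limit.\<close>

lemma value_from_within_coercive:
  assumes coercive: "\<forall>x\<in>closure \<Omega>. \<forall>M. a * (norm M)\<^sup>2 \<le> blinfun_apply (A x) M \<bullet> M"
    and E: "E \<in> \<T>" "r \<in> E"
  shows "a * (norm M)\<^sup>2 \<le> blinfun_apply (value_from_within E A r) M \<bullet> M"
proof (cases "\<exists>l. (A \<longlongrightarrow> l) (at r within interior E)")
  case True
  then obtain l where l: "(A \<longlongrightarrow> l) (at r within interior E)" by blast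
  have "value_from_within E A r = l"
    using True tendsto_Lim[OF within_element_nontrivial[OF E] l] by (simp add: value_from_within_def)
  moreover have "((\<lambda>x. blinfun_apply (A x) M \<bullet> M) \<longlongrightarrow> blinfun_apply l M \<bullet> M) (at r within interior E)"
    by (intro tendsto_intros l)
  moreover have "\<forall>\<^sub>F x in at r within interior E. a * (norm M)\<^sup>2 \<le> blinfun_apply (A x) M \<bullet> M"
  proof -
    have "interior E \<subseteq> closure \<Omega>" using element_props(7)[OF E(1)] interior_subset by blast
    then show ?thesis
      using coercive by (auto simp: eventually_at_filter intro!: always_eventually)
  qed
  ultimately show ?thesis
    using tendsto_lowerbound[OF _ _ within_element_nontrivial[OF E]] by simp
next
  case False
  then show ?thesis
    using coercive element_props(7)[OF E(1)] E(2) by (auto simp: value_from_within_def)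
qed

text \<open>The quadrature form is a sum of nonnegative vertex contributions with positive weights.\<close>

lemma vertex_values_zero_if_quad_zero:
  assumes "a > 0" and coercive: "\<forall>x\<in>closure \<Omega>. \<forall>M. a * (norm M)\<^sup>2 \<le> blinfun_apply (A x) M \<bullet> M"
    and zero: "quad \<T> A \<tau> \<tau> = 0" and E: "E \<in> \<T>" and r: "r \<in> vertices E"
  shows "value_from_within E \<tau> r = 0"
proof -
  have nonneg: "0 \<le> blinfun_apply (value_from_within E A r) M \<bullet> M" if "E \<in> \<T>" "r \<in> vertices E" for E r M
  proof -
    have "0 \<le> a * (norm M)\<^sup>2" using \<open>a > 0\<close> by simp
    also have "\<dots> \<le> blinfun_apply (value_from_within E A r) M \<bullet> M"
      using vertices_subset[OF that(1)] that(2)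
      by (intro value_from_within_coercive[OF coercive that(1)]) blast
    finally show ?thesis .
  qed
  have elem: "0 \<le> quad_elem A E \<tau> \<tau>" if "E \<in> \<T>" for E
    unfolding quad_elem_def using nonneg[OF that] by (intro mult_nonneg_nonneg sum_nonneg) auto
  then have "quad_elem A E \<tau> \<tau> = 0"
    using zero sum_nonneg_eq_0_iff[OF finite_mesh elem] E by (simp add: quad_def)
  then have "(\<Sum>r\<in>vertices E. blinfun_apply (value_from_within E A r) (value_from_within E \<tau> r) \<bullet> value_from_within E \<tau> r) = 0"
    using element_props(5)[OF E] by (simp add: quad_elem_def)
  then have "blinfun_apply (value_from_within E A r) (value_from_within E \<tau> r) \<bullet> value_from_within E \<tau> r = 0"
    using sum_nonneg_eq_0_iff[OF element_props(6)[OF E]] nonneg[OF E] r by (metis (no_types, lifting))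
  then have "a * (norm (value_from_within E \<tau> r))\<^sup>2 \<le> 0"
    using value_from_within_coercive[OF coercive E, of r "value_from_within E \<tau> r"] vertices_subset[OF E] r by auto
  then show ?thesis using \<open>a > 0\<close> by (simp add: mult_le_0_iff)
qed

lemma quad_add_scaled_left:
  assumes "\<sigma> \<in> XX_h \<Omega> \<Gamma> \<T>" "\<sigma>' \<in> XX_h \<Omega> \<Gamma> \<T>"
  shows "quad \<T> A (\<lambda>x. c *\<^sub>R \<sigma> x + \<sigma>' x) \<tau> = c * quad \<T> A \<sigma> \<tau> + quad \<T> A \<sigma>' \<tau>"
proof -
  have "quad_elem A E (\<lambda>x. c *\<^sub>R \<sigma> x + \<sigma>' x) \<tau> = c * quad_elem A E \<sigma> \<tau> + quad_elem A E \<sigma>' \<tau>" if "E \<in> \<T>" for E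
  proof -
    have "value_from_within E (\<lambda>x. c *\<^sub>R \<sigma> x + \<sigma>' x) r = c *\<^sub>R value_from_within E \<sigma> r + value_from_within E \<sigma>' r"
      if "r \<in> vertices E" for r
      using value_from_within_XX_h_add_scaled[OF assms \<open>E \<in> \<T>\<close>] vertices_subset[OF \<open>E \<in> \<T>\<close>] that by blast
    then show ?thesis
      by (simp add: quad_elem_def blinfun.add_right blinfun.scaleR_right inner_add_left sum.distrib
          distrib_left mult.left_commute[of _ c] flip: sum_distrib_left)
  qed
  then show ?thesis by (simp add: quad_def sum.distrib sum_distrib_left)
qed

lemma quad_add_scaled_right:
  assumes "\<tau> \<in> XX_h \<Omega> \<Gamma> \<T>" "\<tau>' \<in> XX_h \<Omega> \<Gamma> \<T>"
  shows "quad \<T> A \<sigma> (\<lambda>x. c *\<^sub>R \<tau> x + \<tau>' x) = c * quad \<T> A \<sigma> \<tau> + quad \<T> A \<sigma> \<tau>'"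
proof -
  have "quad_elem A E \<sigma> (\<lambda>x. c *\<^sub>R \<tau> x + \<tau>' x) = c * quad_elem A E \<sigma> \<tau> + quad_elem A E \<sigma> \<tau>'" if "E \<in> \<T>" for E
  proof -
    have "value_from_within E (\<lambda>x. c *\<^sub>R \<tau> x + \<tau>' x) r = c *\<^sub>R value_from_within E \<tau> r + value_from_within E \<tau>' r"
      if "r \<in> vertices E" for r
      using value_from_within_XX_h_add_scaled[OF assms \<open>E \<in> \<T>\<close>] vertices_subset[OF \<open>E \<in> \<T>\<close>] that by blast
    then show ?thesis
      by (simp add: quad_elem_def inner_add_right sum.distrib
          distrib_left mult.left_commute[of _ c] flip: sum_distrib_left)
  qed
  then show ?thesis by (simp add: quad_def sum.distrib sum_distrib_left)
qed

lemma quad_vertex_values_zero: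
  assumes "\<And>E r. E \<in> \<T> \<Longrightarrow> r \<in> vertices E \<Longrightarrow> value_from_within E \<tau> r = 0"
  shows "quad \<T> A \<sigma> \<tau> = 0" "quad \<T> A \<tau> \<sigma> = 0"
  using assms by (simp_all add: quad_def quad_elem_def)

text \<open>The outward normal is the negative gradient of the barycentric coordinate of the vertex opposite
\<open>F\<close>, normalised to length one. A unit vector \<open>\<nu>'\<close> with the defining property has the
same inner product with all edges from this vertex to \<open>F\<close>, hence is a multiple of that gradient.\<close>

lemma outward_normal_props:
  assumes E: "E \<in> \<T>" and F: "F facet_of E"
  shows "norm (outward_normal E F) = 1" "\<And>x y. x \<in> F \<Longrightarrow> y \<in> F \<Longrightarrow> outward_normal E F \<bullet> (y - x) = 0"
proof -
  interpret full_simplex "vertices E" by (rule element_simplex(1)[OF E])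
  note hull = element_simplex(2)[OF E]
  obtain a where a: "a \<in> vertices E" "F = convex hull (vertices E - {a})" "vertices F = vertices E - {a}"
    using facet_opposite_vertex[OF E F] .
  define g where "g = bary_grad a"
  have bary: "bary a y = bary a x + g \<bullet> (y - x)" for x y
    using bary_eq[OF a(1), of x] bary_eq[OF a(1), of y] by (simp add: g_def inner_diff_right)
  have F_eq: "F = {x \<in> E. bary a x = 0}"
    using facet_eq[OF a(1)] unfolding a(2) hull[symmetric] .
  have FE: "F \<subseteq> E" using F_eq by blast
  have pos: "0 \<le> bary a y" if "y \<in> E" for y
    using that a(1) hull hull_eq by blast
  obtain r where r: "r \<in> vertices E - {a}"
    using F a(2) unfolding facet_of_def by auto
  have edge: "g \<bullet> (r - a) = - 1" if "r \<in> vertices E - {a}" for r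
    using bary_grad_edge[of a r a] a(1) that by (auto simp: g_def)
  have "g \<noteq> 0" using edge[OF r] by auto
  define \<nu> where "\<nu> = - (1 / norm g) *\<^sub>R g"
  have unique: "\<nu>' = \<nu>" if n: "norm \<nu>' = 1" and le: "\<forall>x\<in>F. \<forall>y\<in>E. \<nu>' \<bullet> (y - x) \<le> 0" for \<nu>'
  proof -
    define s where "s = \<nu>' \<bullet> (r - a)"
    have VF: "v \<in> F" if "v \<in> vertices E - {a}" for v
      using that hull_inc[of v "vertices E - {a}"] unfolding a(2) by auto
    have aE: "a \<in> E" using a(1) vertices_subset[OF E] by blast
    have const: "\<nu>' \<bullet> (v - a) = s" if v: "v \<in> vertices E - {a}" for v
    proof -
      have "\<nu>' \<bullet> (v - r) \<le> 0" "\<nu>' \<bullet> (r - v) \<le> 0"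
        using le VF[OF v] VF[OF r] FE by blast+
      then show ?thesis by (simp add: s_def inner_diff_right)
    qed
    have "\<nu>' \<bullet> (a - r) \<le> 0" using le VF[OF r] aE by blast
    then have s: "0 \<le> s" by (simp add: s_def inner_diff_right)
    have "\<nu>' + s *\<^sub>R g = 0"
    proof (rule facet_edges_span[OF a(1)])
      fix v assume v: "v \<in> vertices E - {a}"
      show "(v - a) \<bullet> (\<nu>' + s *\<^sub>R g) = 0"
        using const[OF v] edge[OF v] by (simp add: inner_add_right inner_commute[of "v - a"])
    qed
    then have eq: "\<nu>' = - s *\<^sub>R g" by (simp add: eq_neg_iff_add_eq_0)
    then have "s * norm g = 1" using n s by simp
    then have "s = 1 / norm g" using \<open>g \<noteq> 0\<close> by (simp add: field_simps)
    then show ?thesis using eq by (simp add: \<nu>_def)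
  qed
  have \<nu>: "norm \<nu> = 1" "\<forall>x\<in>F. \<forall>y\<in>E. \<nu> \<bullet> (y - x) \<le> 0"
  proof -
    show "norm \<nu> = 1" using \<open>g \<noteq> 0\<close> by (simp add: \<nu>_def)
    show "\<forall>x\<in>F. \<forall>y\<in>E. \<nu> \<bullet> (y - x) \<le> 0"
    proof (intro ballI)
      fix x y assume "x \<in> F" "y \<in> E"
      then have "0 \<le> g \<bullet> (y - x)" using bary[of y x] pos[of y] F_eq by auto
      then show "\<nu> \<bullet> (y - x) \<le> 0" by (simp add: \<nu>_def)
    qed
  qed
  have out: "outward_normal E F = \<nu>"
    unfolding outward_normal_def
  proof (rule the_equality)
    show "norm \<nu> = 1 \<and> (\<forall>x\<in>F. \<forall>y\<in>E. \<nu> \<bullet> (y - x) \<le> 0)" using \<nu> by (rule conjI)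
  qed (elim conjE, rule unique)
  show "norm (outward_normal E F) = 1" using \<nu>(1) out by simp
  show "outward_normal E F \<bullet> (y - x) = 0" if "x \<in> F" "y \<in> F" for x y
  proof -
    have "\<nu> \<bullet> (y - x) \<le> 0" "\<nu> \<bullet> (x - y) \<le> 0" using \<nu>(2) that FE by blast+
    then show ?thesis by (simp add: out inner_diff_right)
  qed
qed

lemma foot_in_facet:
  assumes "E \<in> \<T>" "F facet_of E" "y \<in> prism F (outward_normal E F)"
  shows "foot F (outward_normal E F) y \<in> F"
proof -
  let ?\<nu> = "outward_normal E F"
  obtain x t where x: "y = x + t *\<^sub>R ?\<nu>" "x \<in> F"
    using assms(3) by (auto simp: prism_def)
  define a where "a = (SOME a. a \<in> F)"
  have a: "a \<in> F" using x(2) unfolding a_def by (metis someI)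
  have n: "?\<nu> \<bullet> ?\<nu> = 1"
    using outward_normal_props(1)[OF assms(1,2)] by (simp add: dot_square_norm)
  have "(y - a) \<bullet> ?\<nu> = (x - a) \<bullet> ?\<nu> + t * (?\<nu> \<bullet> ?\<nu>)"
    by (simp add: x(1) inner_diff_left inner_add_left)
  also have "(x - a) \<bullet> ?\<nu> = 0"
    using outward_normal_props(2)[OF assms(1,2) a x(2)] by (simp add: inner_commute)
  finally have "foot F ?\<nu> y = x"
    using x(1) n by (simp add: foot_def flip: a_def)
  then show ?thesis using x(2) by simp
qed

lemma prism_compact:
  assumes "compact F" shows "compact (prism F \<nu>)"
proof -
  have "prism F \<nu> = (\<lambda>z. fst z + snd z *\<^sub>R \<nu>) ` (F \<times> {0..1})"
    by (force simp: prism_def)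
  then show ?thesis
    using assms by (auto intro!: compact_continuous_image continuous_intros compact_Times)
qed

lemma facet_compact: "E \<in> \<T> \<Longrightarrow> F facet_of E \<Longrightarrow> compact F"
  using face_of_imp_compact[OF element_props(2,1)] by (auto simp: facet_of_def)

lemma facet_subset: "F facet_of E \<Longrightarrow> F \<subseteq> E"
  by (auto simp: facet_of_def dest: face_of_imp_subset)

lemma facet_integrand_integrable:
  assumes E: "E \<in> \<T>" and F: "F facet_of E" and \<tau>: "\<tau> \<in> XX_h \<Omega> \<Gamma> \<T>"
    and g: "(\<lambda>y. g (foot F (outward_normal E F) y)) \<in> L2 (prism F (outward_normal E F))"
  defines "\<nu> \<equiv> outward_normal E F"
  shows "integrable (lebesgue_on (prism F \<nu>)) (\<lambda>y. g (foot F \<nu> y) \<bullet> (value_from_within E \<tau> (foot F \<nu> y) *v \<nu>))"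
proof -
  obtain P where P: "affine_field P" "\<And>x. x \<in> E \<Longrightarrow> value_from_within E \<tau> x = P x"
    using XX_h_piece[OF \<tau> E] by blast
  have prism: "bounded (prism F \<nu>)" "prism F \<nu> \<in> sets lebesgue"
    using prism_compact[OF facet_compact[OF E F]] by (auto simp: compact_imp_bounded lmeasurable_compact fmeasurableD)
  have "continuous_on UNIV (\<lambda>y. P (foot F \<nu> y) *v \<nu>)"
    unfolding foot_def Let_def
    by (intro bounded_bilinear.continuous_on[OF bounded_bilinear_matrix_vector_mult]
        continuous_on_compose2[OF affine_field_continuous[OF P(1), of UNIV]] continuous_intros) auto
  then have "(\<lambda>y. P (foot F \<nu> y) *v \<nu>) \<in> L2 (prism F \<nu>)"
    by (rule L2_continuous[OF prism])
  then have int: "integrable (lebesgue_on (prism F \<nu>)) (\<lambda>y. g (foot F \<nu> y) \<bullet> (P (foot F \<nu> y) *v \<nu>))"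
    using g unfolding \<nu>_def by (intro L2_bilinear_integrable[OF bounded_bilinear_inner])
  have "value_from_within E \<tau> (foot F \<nu> y) = P (foot F \<nu> y)" if "y \<in> space (lebesgue_on (prism F \<nu>))" for y
    using P(2) foot_in_facet[OF E F] facet_subset[OF F] that
    by (auto simp: \<nu>_def space_restrict_space)
  then have "integrable (lebesgue_on (prism F \<nu>)) (\<lambda>y. g (foot F \<nu> y) \<bullet> (value_from_within E \<tau> (foot F \<nu> y) *v \<nu>))
      \<longleftrightarrow> integrable (lebesgue_on (prism F \<nu>)) (\<lambda>y. g (foot F \<nu> y) \<bullet> (P (foot F \<nu> y) *v \<nu>))"
    by (intro Bochner_Integration.integrable_cong refl arg_cong2[where f = inner] arg_cong2[where f = "(*v)"])
  with int show ?thesis by simp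
qed

lemma facet_integral_add_scaled:
  assumes E: "E \<in> \<T>" and F: "F facet_of E" and \<tau>: "\<sigma> \<in> XX_h \<Omega> \<Gamma> \<T>" "\<tau> \<in> XX_h \<Omega> \<Gamma> \<T>"
    and g: "(\<lambda>y. g (foot F (outward_normal E F) y)) \<in> L2 (prism F (outward_normal E F))"
  defines "\<nu> \<equiv> outward_normal E F"
  shows "facet_integral F \<nu> (\<lambda>x. g x \<bullet> (value_from_within E (\<lambda>x. c *\<^sub>R \<sigma> x + \<tau> x) x *v \<nu>)) =
    c * facet_integral F \<nu> (\<lambda>x. g x \<bullet> (value_from_within E \<sigma> x *v \<nu>))
    + facet_integral F \<nu> (\<lambda>x. g x \<bullet> (value_from_within E \<tau> x *v \<nu>))"
proof -
  have "value_from_within E (\<lambda>x. c *\<^sub>R \<sigma> x + \<tau> x) (foot F \<nu> y) =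
      c *\<^sub>R value_from_within E \<sigma> (foot F \<nu> y) + value_from_within E \<tau> (foot F \<nu> y)"
    if "y \<in> space (lebesgue_on (prism F \<nu>))" for y
    using foot_in_facet[OF E F] facet_subset[OF F] that
    by (intro value_from_within_XX_h_add_scaled[OF \<tau> E]) (auto simp: \<nu>_def space_restrict_space)
  then have "facet_integral F \<nu> (\<lambda>x. g x \<bullet> (value_from_within E (\<lambda>x. c *\<^sub>R \<sigma> x + \<tau> x) x *v \<nu>)) =
      (LINT y|lebesgue_on (prism F \<nu>). c * (g (foot F \<nu> y) \<bullet> (value_from_within E \<sigma> (foot F \<nu> y) *v \<nu>))
        + g (foot F \<nu> y) \<bullet> (value_from_within E \<tau> (foot F \<nu> y) *v \<nu>))"
    unfolding facet_integral_def
    by (intro Bochner_Integration.integral_cong refl)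
       (simp add: matrix_vector_mult_add_rdistrib scaleR_matrix_vector_assoc[symmetric] inner_add_right)
  also have "\<dots> = c * facet_integral F \<nu> (\<lambda>x. g x \<bullet> (value_from_within E \<sigma> x *v \<nu>))
      + facet_integral F \<nu> (\<lambda>x. g x \<bullet> (value_from_within E \<tau> x *v \<nu>))"
    unfolding facet_integral_def \<nu>_def
    using facet_integrand_integrable[OF E F \<tau>(1) g] facet_integrand_integrable[OF E F \<tau>(2) g] by simp
  finally show ?thesis .
qed

lemma boundary_pairing_add_scaled:
  assumes g: "g \<in> L2_facets (facets_in \<Omega> \<T> \<Gamma>D)" and \<tau>: "\<sigma> \<in> XX_h \<Omega> \<Gamma> \<T>" "\<tau> \<in> XX_h \<Omega> \<Gamma> \<T>"
  shows "boundary_pairing \<Omega> \<Gamma>D \<T> g (\<lambda>x. c *\<^sub>R \<sigma> x + \<tau> x) =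
    c * boundary_pairing \<Omega> \<Gamma>D \<T> g \<sigma> + boundary_pairing \<Omega> \<Gamma>D \<T> g \<tau>"
proof -
  let ?I = "\<lambda>\<tau> (E, F). facet_integral F (outward_normal E F)
       (\<lambda>x. g x \<bullet> (value_from_within E \<tau> x *v outward_normal E F))"
  have "?I (\<lambda>x. c *\<^sub>R \<sigma> x + \<tau> x) p = c * ?I \<sigma> p + ?I \<tau> p" if "p \<in> facets_in \<Omega> \<T> \<Gamma>D" for p
  proof -
    obtain E F where p: "p = (E, F)" by (cases p)
    have EF: "E \<in> \<T>" "F facet_of E"
      using that p by (auto simp: facets_in_def boundary_facets_def)
    have "(\<lambda>y. g (foot F (outward_normal E F) y)) \<in> L2 (prism F (outward_normal E F))"
      using g that p by (auto simp: L2_facets_def)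
    from facet_integral_add_scaled[OF EF \<tau> this] show ?thesis by (simp add: p)
  qed
  then show ?thesis
    by (simp add: boundary_pairing_def sum.distrib sum_distrib_left)
qed

lemma boundary_pairing_zero:
  assumes "\<And>E x. E \<in> \<T> \<Longrightarrow> x \<in> interior E \<Longrightarrow> \<tau> x = 0"
  shows "boundary_pairing \<Omega> \<Gamma>D \<T> g \<tau> = 0"
  unfolding boundary_pairing_def
proof (intro sum.neutral ballI)
  fix p assume "p \<in> facets_in \<Omega> \<T> \<Gamma>D"
  then obtain E F where p: "p = (E, F)" "E \<in> \<T>" "F facet_of E"
    by (auto simp: facets_in_def boundary_facets_def)
  have "value_from_within E \<tau> (foot F (outward_normal E F) y) = 0" if "y \<in> prism F (outward_normal E F)" for y
    using foot_in_facet[OF p(2,3) that] facet_subset[OF p(3)] assms[OF p(2)]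
    by (intro value_from_within_const[OF p(2)]) auto
  then have "facet_integral F (outward_normal E F) (\<lambda>x. g x \<bullet> (value_from_within E \<tau> x *v outward_normal E F)) = 0"
    unfolding facet_integral_def
    by (intro integral_eq_zero_AE AE_I2) (simp add: space_restrict_space)
  then show "(case p of (E, F) \<Rightarrow> facet_integral F (outward_normal E F)
      (\<lambda>x. g x \<bullet> (value_from_within E \<tau> x *v outward_normal E F))) = 0"
    by (simp add: p(1))
qed

end

section \<open>Well-posedness of the discrete problem\<close>

type_synonym 'n triple = "(real^'n \<Rightarrow> real^'n^'n) \<times> (real^'n \<Rightarrow> real^'n) \<times> (real^'n \<Rightarrow> real^'n^'n)"

fun add_scaled :: "real \<Rightarrow> 'n::finite triple \<Rightarrow> 'n triple \<Rightarrow> 'n triple" where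
  "add_scaled c (\<sigma>, u, \<gamma>) (\<tau>, v, \<xi>) =
     ((\<lambda>x. c *\<^sub>R \<sigma> x + \<tau> x), (\<lambda>x. c *\<^sub>R u x + v x), (\<lambda>x. c *\<^sub>R \<gamma> x + \<xi> x))"

locale msmfe_problem = fe_mesh \<Omega> \<T> for \<Omega> :: "(real^'n) set" and \<T> +
  fixes \<Gamma>D :: "(real^'n) set" and A :: "real^'n \<Rightarrow> (real^'n^'n) \<Rightarrow>\<^sub>L (real^'n^'n)"
  assumes coercive: "\<exists>a>0. \<forall>x\<in>closure \<Omega>. \<forall>M. a * (norm M)\<^sup>2 \<le> blinfun_apply (A x) M \<bullet> M"
    and dirichlet_facet: "facets_in \<Omega> \<T> \<Gamma>D \<noteq> {}"
begin

definition discrete_space :: "'n triple set" where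
  "discrete_space = XX_h \<Omega> \<Gamma>D \<T> \<times> VV_h \<Omega> \<T> \<times> WW_h0 \<Omega> \<T>"

text \<open>The three equations of the method, added up with one test function for each of them. Triples with two zero
components as test functions recover the single equations (\<open>solution_iff\<close>).\<close>

fun mixed_form :: "'n triple \<Rightarrow> 'n triple \<Rightarrow> real" where
  "mixed_form (\<sigma>, u, \<gamma>) (\<tau>, v, \<xi>) =
     quad \<T> A \<sigma> \<tau> + (L2_inner \<Omega> u (weak_div \<Omega> \<tau>) + L2_inner \<Omega> \<gamma> \<tau>)
       + (L2_inner \<Omega> (weak_div \<Omega> \<sigma>) v + L2_inner \<Omega> \<sigma> \<xi>)"

fun load :: "(real^'n \<Rightarrow> real^'n) \<Rightarrow> (real^'n \<Rightarrow> real^'n) \<Rightarrow> 'n triple \<Rightarrow> real" where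
  "load f g (\<tau>, v, \<xi>) = boundary_pairing \<Omega> \<Gamma>D \<T> g \<tau> + L2_inner \<Omega> f v"

text \<open>Equality almost everywhere with zero, for functions that are continuous on the open elements.\<close>

fun vanishes_on_elements :: "'n triple \<Rightarrow> bool" where
  "vanishes_on_elements (\<sigma>, u, \<gamma>) \<longleftrightarrow> (\<forall>E\<in>\<T>. \<forall>x\<in>interior E. \<sigma> x = 0 \<and> u x = 0 \<and> \<gamma> x = 0)"

lemma AE_zero:
  assumes "\<forall>E\<in>\<T>. \<forall>x\<in>interior E. \<phi> x = 0" shows "AE x in lebesgue_on \<Omega>. \<phi> x = 0"
  using AE_in_element_interior by (rule eventually_mono) (use assms in auto)

lemma vanishing_negligible:
  assumes y: "(\<tau>, v, \<xi>) \<in> discrete_space" "vanishes_on_elements (\<tau>, v, \<xi>)"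
  shows "quad \<T> A \<sigma> \<tau> = 0" "quad \<T> A \<tau> \<sigma> = 0"
    "L2_inner \<Omega> \<psi> (weak_div \<Omega> \<tau>) = 0" "L2_inner \<Omega> (weak_div \<Omega> \<tau>) \<psi> = 0"
    "L2_inner \<Omega> \<rho> \<tau> = 0" "L2_inner \<Omega> \<tau> \<rho> = 0"
    "L2_inner \<Omega> \<psi> v = 0" "L2_inner \<Omega> v \<psi> = 0" "L2_inner \<Omega> \<rho> \<xi> = 0" "L2_inner \<Omega> \<xi> \<rho> = 0"
    "boundary_pairing \<Omega> \<Gamma>D \<T> g \<tau> = 0"
proof -
  have \<tau>: "\<tau> \<in> L2 \<Omega>" using y(1) by (auto simp: discrete_space_def intro: spaces_L2(1))
  have zero: "value_from_within E \<tau> r = 0" if "E \<in> \<T>" "r \<in> vertices E" for E r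
    using y(2) vertices_subset[OF that(1)] that by (intro value_from_within_const) auto
  have ae: "AE x in lebesgue_on \<Omega>. \<tau> x = 0" "AE x in lebesgue_on \<Omega>. v x = 0" "AE x in lebesgue_on \<Omega>. \<xi> x = 0"
    using y(2) by (auto intro!: AE_zero)
  show "quad \<T> A \<sigma> \<tau> = 0" "quad \<T> A \<tau> \<sigma> = 0"
    using quad_vertex_values_zero[OF zero] by auto
  show "L2_inner \<Omega> \<psi> (weak_div \<Omega> \<tau>) = 0" "L2_inner \<Omega> (weak_div \<Omega> \<tau>) \<psi> = 0"
    using L2_inner_AE_0[OF weak_div_AE_0[OF \<tau> ae(1)]] by auto
  show "L2_inner \<Omega> \<rho> \<tau> = 0" "L2_inner \<Omega> \<tau> \<rho> = 0"
    "L2_inner \<Omega> \<psi> v = 0" "L2_inner \<Omega> v \<psi> = 0" "L2_inner \<Omega> \<rho> \<xi> = 0" "L2_inner \<Omega> \<xi> \<rho> = 0"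
    using L2_inner_AE_0[OF ae(1)] L2_inner_AE_0[OF ae(2)] L2_inner_AE_0[OF ae(3)] by auto
  show "boundary_pairing \<Omega> \<Gamma>D \<T> g \<tau> = 0"
    using y(2) by (intro boundary_pairing_zero) auto
qed

lemma zero_triple: "(\<lambda>_. 0, \<lambda>_. 0, \<lambda>_. 0) \<in> discrete_space" "vanishes_on_elements (\<lambda>_. 0, \<lambda>_. 0, \<lambda>_. 0)"
  using zero_in_spaces by (auto simp: discrete_space_def)

lemmas zero_negligible = vanishing_negligible[OF zero_triple]

lemma discrete_space_add_scaled:
  "x \<in> discrete_space \<Longrightarrow> y \<in> discrete_space \<Longrightarrow> add_scaled c x y \<in> discrete_space"
  by (cases x; cases y) (auto simp: discrete_space_def intro: XX_h_add_scaled VV_h_add_scaled WW_h0_add_scaled)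

lemma L2_inner_weak_div_add_scaled:
  assumes "\<sigma> \<in> XX_h \<Omega> \<Gamma>D \<T>" "\<tau> \<in> XX_h \<Omega> \<Gamma>D \<T>" "v \<in> L2 \<Omega>"
  shows "L2_inner \<Omega> (weak_div \<Omega> (\<lambda>x. c *\<^sub>R \<sigma> x + \<tau> x)) v =
    c * L2_inner \<Omega> (weak_div \<Omega> \<sigma>) v + L2_inner \<Omega> (weak_div \<Omega> \<tau>) v"
proof -
  have XX: "\<sigma> \<in> XX \<Omega> \<Gamma>D" "\<tau> \<in> XX \<Omega> \<Gamma>D" using assms by (auto simp: XX_h_iff)
  have "L2_inner \<Omega> (weak_div \<Omega> (\<lambda>x. c *\<^sub>R \<sigma> x + \<tau> x)) v
      = L2_inner \<Omega> (\<lambda>x. c *\<^sub>R weak_div \<Omega> \<sigma> x + weak_div \<Omega> \<tau> x) v"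
    using assms(3)
    by (intro L2_inner_cong_AE weak_div_add_scaled_AE[OF XX_weak_div[OF XX(1)] XX_weak_div[OF XX(2)]]
        L2_add_scaled XX_L2[OF XX(1)] XX_L2[OF XX(2)] XX_weak_div_L2[OF XX_add_scaled[OF XX]]
        XX_weak_div_L2[OF XX(1)] XX_weak_div_L2[OF XX(2)])
  then show ?thesis
    using L2_inner_add_scaled_left[OF XX_weak_div_L2[OF XX(1)] XX_weak_div_L2[OF XX(2)] assms(3)] by simp
qed

lemma mixed_form_linear_left:
  assumes "y \<in> discrete_space" shows "linear_wrt add_scaled discrete_space (\<lambda>x. mixed_form x y)"
  unfolding linear_wrt_def
proof (intro allI ballI)
  fix c and x x' :: "'n triple" assume x: "x \<in> discrete_space" and x': "x' \<in> discrete_space"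
  obtain \<tau> v \<xi> where y: "y = (\<tau>, v, \<xi>)" by (cases y)
  obtain \<sigma> u \<gamma> where xe: "x = (\<sigma>, u, \<gamma>)" by (cases x)
  obtain \<sigma>' u' \<gamma>' where xe': "x' = (\<sigma>', u', \<gamma>')" by (cases x')
  have S: "\<sigma> \<in> XX_h \<Omega> \<Gamma>D \<T>" "u \<in> VV_h \<Omega> \<T>" "\<gamma> \<in> WW_h0 \<Omega> \<T>" "\<sigma>' \<in> XX_h \<Omega> \<Gamma>D \<T>" "u' \<in> VV_h \<Omega> \<T>" "\<gamma>' \<in> WW_h0 \<Omega> \<T>"
    "\<tau> \<in> XX_h \<Omega> \<Gamma>D \<T>" "v \<in> VV_h \<Omega> \<T>" "\<xi> \<in> WW_h0 \<Omega> \<T>"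
    using x x' assms by (auto simp: discrete_space_def xe xe' y)
  note L2 = spaces_L2(1)[OF S(1)] spaces_L2(1)[OF S(4)] spaces_L2(3)[OF S(2)] spaces_L2(3)[OF S(5)]
    spaces_L2(4)[OF S(3)] spaces_L2(4)[OF S(6)] spaces_L2(1,2)[OF S(7)] spaces_L2(3)[OF S(8)] spaces_L2(4)[OF S(9)]
  show "mixed_form (add_scaled c x x') y = c * mixed_form x y + mixed_form x' y"
    by (simp add: xe xe' y quad_add_scaled_left[OF S(1,4)] L2_inner_add_scaled_left L2
        L2_inner_weak_div_add_scaled[OF S(1,4)], simp add: algebra_simps)
qed

lemma mixed_form_linear_right:
  assumes "x \<in> discrete_space" shows "linear_wrt add_scaled discrete_space (mixed_form x)"
  unfolding linear_wrt_def
proof (intro allI ballI)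
  fix c and y y' :: "'n triple" assume y: "y \<in> discrete_space" and y': "y' \<in> discrete_space"
  obtain \<sigma> u \<gamma> where x: "x = (\<sigma>, u, \<gamma>)" by (cases x)
  obtain \<tau> v \<xi> where ye: "y = (\<tau>, v, \<xi>)" by (cases y)
  obtain \<tau>' v' \<xi>' where ye': "y' = (\<tau>', v', \<xi>')" by (cases y')
  have S: "\<tau> \<in> XX_h \<Omega> \<Gamma>D \<T>" "v \<in> VV_h \<Omega> \<T>" "\<xi> \<in> WW_h0 \<Omega> \<T>" "\<tau>' \<in> XX_h \<Omega> \<Gamma>D \<T>" "v' \<in> VV_h \<Omega> \<T>" "\<xi>' \<in> WW_h0 \<Omega> \<T>"
    "\<sigma> \<in> XX_h \<Omega> \<Gamma>D \<T>" "u \<in> VV_h \<Omega> \<T>" "\<gamma> \<in> WW_h0 \<Omega> \<T>"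
    using y y' assms by (auto simp: discrete_space_def ye ye' x)
  note L2 = spaces_L2(1)[OF S(1)] spaces_L2(1)[OF S(4)] spaces_L2(3)[OF S(2)] spaces_L2(3)[OF S(5)]
    spaces_L2(4)[OF S(3)] spaces_L2(4)[OF S(6)] spaces_L2(1,2)[OF S(7)] spaces_L2(3)[OF S(8)] spaces_L2(4)[OF S(9)]
  show "mixed_form x (add_scaled c y y') = c * mixed_form x y + mixed_form x y'"
    by (simp add: x ye ye' quad_add_scaled_right[OF S(1,4)] L2_inner_add_scaled_right L2
        L2_inner_commute[of \<Omega> u] L2_inner_weak_div_add_scaled[OF S(1,4)],
        simp add: algebra_simps)
qed

lemma load_linear:
  assumes "f \<in> L2 \<Omega>" "g \<in> L2_facets (facets_in \<Omega> \<T> \<Gamma>D)"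
  shows "linear_wrt add_scaled discrete_space (load f g)"
  unfolding linear_wrt_def
proof (intro allI ballI)
  fix c and y y' :: "'n triple" assume y: "y \<in> discrete_space" and y': "y' \<in> discrete_space"
  obtain \<tau> v \<xi> where ye: "y = (\<tau>, v, \<xi>)" by (cases y)
  obtain \<tau>' v' \<xi>' where ye': "y' = (\<tau>', v', \<xi>')" by (cases y')
  have S: "\<tau> \<in> XX_h \<Omega> \<Gamma>D \<T>" "v \<in> VV_h \<Omega> \<T>" "\<tau>' \<in> XX_h \<Omega> \<Gamma>D \<T>" "v' \<in> VV_h \<Omega> \<T>"
    using y y' by (auto simp: discrete_space_def ye ye')
  show "load f g (add_scaled c y y') = c * load f g y + load f g y'"
    using boundary_pairing_add_scaled[OF assms(2) S(1,3)]
      L2_inner_add_scaled_right[OF spaces_L2(3)[OF S(2)] spaces_L2(3)[OF S(4)] assms(1)]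
    by (simp add: ye ye' algebra_simps)
qed

text \<open>Coercivity at the vertices annihilates the stress, which is affine on elements; the multipliers are then
covered by \<open>discrete_kernel_trivial\<close>.\<close>

lemma kernel_trivial_if_quad_zero:
  assumes S: "(\<sigma>, u, \<gamma>) \<in> discrete_space" and zero: "quad \<T> A \<sigma> \<sigma> = 0"
    and ortho: "quad \<T> A \<sigma> \<sigma> = 0 \<Longrightarrow> vanishes_on_elements (\<sigma>, \<lambda>_. 0, \<lambda>_. 0) \<Longrightarrow>
      \<forall>\<tau>\<in>XX_h \<Omega> \<Gamma>D \<T>. L2_inner \<Omega> u (weak_div \<Omega> \<tau>) + L2_inner \<Omega> \<gamma> \<tau> = 0"
  shows "vanishes_on_elements (\<sigma>, u, \<gamma>)"
proof -
  obtain a where a: "a > 0" "\<forall>x\<in>closure \<Omega>. \<forall>M. a * (norm M)\<^sup>2 \<le> blinfun_apply (A x) M \<bullet> M"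
    using coercive by blast
  have spaces: "\<sigma> \<in> XX_h \<Omega> \<Gamma>D \<T>" "u \<in> VV_h \<Omega> \<T>" "\<gamma> \<in> WW_h0 \<Omega> \<T>"
    using S by (auto simp: discrete_space_def)
  have \<sigma>: "\<sigma> x = 0" if "E \<in> \<T>" "x \<in> interior E" for E x
    using XX_h_zero_if_vertex_values_zero[OF spaces(1) that(1) vertex_values_zero_if_quad_zero[OF a zero that(1)] that(2)] .
  obtain E0 F0 where facet: "E0 \<in> \<T>" "F0 facet_of E0" "F0 \<subseteq> frontier \<Omega>" "rel_interior F0 \<subseteq> \<Gamma>D"
    using dirichlet_facet by (auto simp: facets_in_def boundary_facets_def)
  have "\<forall>\<tau>\<in>XX_h \<Omega> \<Gamma>D \<T>. L2_inner \<Omega> u (weak_div \<Omega> \<tau>) + L2_inner \<Omega> \<gamma> \<tau> = 0"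
    using ortho[OF zero] \<sigma> by simp
  then have "u x = 0 \<and> \<gamma> x = 0" if "E \<in> \<T>" "x \<in> interior E" for E x
    using discrete_kernel_trivial[OF facet spaces(2,3) _ that] by blast
  then show ?thesis using \<sigma> by simp
qed

lemma negated_multipliers_in_space:
  assumes "(\<sigma>, u, \<gamma>) \<in> discrete_space" shows "(\<sigma>, \<lambda>x. - u x, \<lambda>x. - \<gamma> x) \<in> discrete_space"
  using assms VV_h_add_scaled[of u "\<lambda>_. 0" "-1"] WW_h0_add_scaled[of \<gamma> "\<lambda>_. 0" "-1"] zero_in_spaces(2,3)
  by (auto simp: discrete_space_def)

lemma L2_inner_minus: "L2_inner \<Omega> (\<lambda>x. - \<phi> x) \<psi> = - L2_inner \<Omega> \<phi> \<psi>" "L2_inner \<Omega> \<psi> (\<lambda>x. - \<phi> x) = - L2_inner \<Omega> \<psi> \<phi>"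
  by (simp_all add: L2_inner_def)

text \<open>Testing with \<open>(\<sigma>, - u, - \<gamma>)\<close> cancels the coupling terms and leaves the
quadrature form at \<open>\<sigma>\<close>.\<close>

lemma mixed_form_left_kernel:
  assumes x: "x \<in> discrete_space" and zero: "\<And>y. y \<in> discrete_space \<Longrightarrow> mixed_form x y = 0"
  shows "vanishes_on_elements x"
proof -
  obtain \<sigma> u \<gamma> where xe: "x = (\<sigma>, u, \<gamma>)" by (cases x)
  have S: "(\<sigma>, u, \<gamma>) \<in> discrete_space" using x xe by simp
  show ?thesis
    unfolding xe
  proof (rule kernel_trivial_if_quad_zero[OF S])
    show "quad \<T> A \<sigma> \<sigma> = 0"
      using zero[OF negated_multipliers_in_space[OF S]]
      by (simp add: xe L2_inner_minus L2_inner_commute[of \<Omega> u] L2_inner_commute[of \<Omega> \<gamma>])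
    assume \<sigma>: "vanishes_on_elements (\<sigma>, \<lambda>_. 0, \<lambda>_. 0)"
    have "(\<sigma>, \<lambda>_. 0, \<lambda>_. 0) \<in> discrete_space" using S zero_in_spaces by (auto simp: discrete_space_def)
    note neg = vanishing_negligible[OF this \<sigma>]
    show "\<forall>\<tau>\<in>XX_h \<Omega> \<Gamma>D \<T>. L2_inner \<Omega> u (weak_div \<Omega> \<tau>) + L2_inner \<Omega> \<gamma> \<tau> = 0"
    proof
      fix \<tau> assume "\<tau> \<in> XX_h \<Omega> \<Gamma>D \<T>"
      then have "(\<tau>, \<lambda>_. 0, \<lambda>_. 0) \<in> discrete_space" using zero_in_spaces by (auto simp: discrete_space_def)
      from zero[OF this] show "L2_inner \<Omega> u (weak_div \<Omega> \<tau>) + L2_inner \<Omega> \<gamma> \<tau> = 0"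
        by (simp add: xe neg zero_negligible)
    qed
  qed
qed

lemma mixed_form_right_kernel:
  assumes y: "y \<in> discrete_space" and zero: "\<And>x. x \<in> discrete_space \<Longrightarrow> mixed_form x y = 0"
  shows "vanishes_on_elements y"
proof -
  obtain \<tau> v \<xi> where ye: "y = (\<tau>, v, \<xi>)" by (cases y)
  have S: "(\<tau>, v, \<xi>) \<in> discrete_space" using y ye by simp
  show ?thesis
    unfolding ye
  proof (rule kernel_trivial_if_quad_zero[OF S])
    show "quad \<T> A \<tau> \<tau> = 0"
      using zero[OF negated_multipliers_in_space[OF S]]
      by (simp add: ye L2_inner_minus L2_inner_commute[of \<Omega> v] L2_inner_commute[of \<Omega> \<xi>])
    assume \<tau>: "vanishes_on_elements (\<tau>, \<lambda>_. 0, \<lambda>_. 0)"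
    have "(\<tau>, \<lambda>_. 0, \<lambda>_. 0) \<in> discrete_space" using S zero_in_spaces by (auto simp: discrete_space_def)
    note neg = vanishing_negligible[OF this \<tau>]
    show "\<forall>\<sigma>\<in>XX_h \<Omega> \<Gamma>D \<T>. L2_inner \<Omega> v (weak_div \<Omega> \<sigma>) + L2_inner \<Omega> \<xi> \<sigma> = 0"
    proof
      fix \<sigma> assume "\<sigma> \<in> XX_h \<Omega> \<Gamma>D \<T>"
      then have "(\<sigma>, \<lambda>_. 0, \<lambda>_. 0) \<in> discrete_space" using zero_in_spaces by (auto simp: discrete_space_def)
      from zero[OF this] show "L2_inner \<Omega> v (weak_div \<Omega> \<sigma>) + L2_inner \<Omega> \<xi> \<sigma> = 0"
        by (simp add: ye neg zero_negligible L2_inner_commute[of \<Omega> v] L2_inner_commute[of \<Omega> \<xi>])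
    qed
  qed
qed

text \<open>The vector \<open>b\<close> of the standard basis selects one component of one of the three fields. For
the piecewise constant fields one value per element would be enough; vertex values treat all three alike.\<close>

fun vertex_functional :: "(real^'n) set \<times> (real^'n) \<times> ((real^'n^'n) \<times> (real^'n) \<times> (real^'n^'n)) \<Rightarrow> 'n triple \<Rightarrow> real" where
  "vertex_functional (E, r, b) (\<sigma>, u, \<gamma>) =
     (value_from_within E \<sigma> r, value_from_within E u r, value_from_within E \<gamma> r) \<bullet> b"

definition vertex_functionals :: "((real^'n) set \<times> (real^'n) \<times> ((real^'n^'n) \<times> (real^'n) \<times> (real^'n^'n))) set" where
  "vertex_functionals = (SIGMA E:\<T>. vertices E \<times> Basis)"

lemma finite_vertex_functionals: "finite vertex_functionals"
  unfolding vertex_functionals_def using finite_mesh element_props(6) by (intro finite_SigmaI) auto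

lemma vertex_functional_linear:
  assumes "i \<in> vertex_functionals" shows "linear_wrt add_scaled discrete_space (vertex_functional i)"
  unfolding linear_wrt_def
proof (intro allI ballI)
  fix c and y y' :: "'n triple" assume y: "y \<in> discrete_space" and y': "y' \<in> discrete_space"
  obtain E r b where i: "i = (E, r, b)" by (cases i)
  obtain \<tau> v \<xi> where ye: "y = (\<tau>, v, \<xi>)" by (cases y)
  obtain \<tau>' v' \<xi>' where ye': "y' = (\<tau>', v', \<xi>')" by (cases y')
  have S: "\<tau> \<in> XX_h \<Omega> \<Gamma>D \<T>" "\<tau>' \<in> XX_h \<Omega> \<Gamma>D \<T>" "v \<in> VV_h \<Omega> \<T>" "v' \<in> VV_h \<Omega> \<T>" "\<xi> \<in> WW_h0 \<Omega> \<T>" "\<xi>' \<in> WW_h0 \<Omega> \<T>"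
    using y y' by (auto simp: discrete_space_def ye ye')
  have E: "E \<in> \<T>" "r \<in> vertices E" using assms by (auto simp: vertex_functionals_def i)
  then have r: "r \<in> E" using vertices_subset by blast
  have const: "\<exists>U. \<forall>x\<in>interior E. v x = U" "\<exists>U. \<forall>x\<in>interior E. v' x = U"
    "\<exists>U. \<forall>x\<in>interior E. \<xi> x = U" "\<exists>U. \<forall>x\<in>interior E. \<xi>' x = U"
    using S(3-6) E(1) unfolding VV_h_iff WW_h0_iff by auto
  note add = value_from_within_XX_h_add_scaled[OF S(1,2) E(1) r]
    value_from_within_piecewise_constant_add_scaled[OF const(1,2) E(1) r]
    value_from_within_piecewise_constant_add_scaled[OF const(3,4) E(1) r]
  show "vertex_functional i (add_scaled c y y') = c * vertex_functional i y + vertex_functional i y'"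
    by (cases b) (simp add: i ye ye' add inner_add_left, simp add: algebra_simps)
qed

lemma vanishes_if_vertex_functionals_zero:
  assumes y: "y \<in> discrete_space" and zero: "\<forall>i\<in>vertex_functionals. vertex_functional i y = 0"
  shows "vanishes_on_elements y"
proof -
  obtain \<tau> v \<xi> where ye: "y = (\<tau>, v, \<xi>)" by (cases y)
  have S: "\<tau> \<in> XX_h \<Omega> \<Gamma>D \<T>" "v \<in> VV_h \<Omega> \<T>" "\<xi> \<in> WW_h0 \<Omega> \<T>"
    using y by (auto simp: discrete_space_def ye)
  have val: "value_from_within E \<tau> r = 0 \<and> value_from_within E v r = 0 \<and> value_from_within E \<xi> r = 0"
    if "E \<in> \<T>" "r \<in> vertices E" for E r
  proof -
    have "(value_from_within E \<tau> r, value_from_within E v r, value_from_within E \<xi> r) \<bullet> b = 0" if "b \<in> Basis" for b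
      using zero \<open>E \<in> \<T>\<close> \<open>r \<in> vertices E\<close> that by (force simp: vertex_functionals_def ye)
    then have "(value_from_within E \<tau> r, value_from_within E v r, value_from_within E \<xi> r) = 0"
      by (rule euclidean_eqI[where y = 0, simplified])
    then show ?thesis by (simp add: zero_prod_def)
  qed
  have "\<tau> x = 0 \<and> v x = 0 \<and> \<xi> x = 0" if E: "E \<in> \<T>" "x \<in> interior E" for E x
  proof -
    obtain r where r: "r \<in> vertices E"
      using full_simplex.C_nonempty[OF element_simplex(1)[OF E(1)]] by blast
    then have rE: "r \<in> E" using vertices_subset[OF E(1)] by blast
    obtain U where U: "\<forall>x\<in>interior E. v x = U" using S(2) E(1) unfolding VV_h_iff by auto
    obtain G where G: "\<forall>x\<in>interior E. \<xi> x = G" using S(3) E(1) unfolding WW_h0_iff by auto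
    have "value_from_within E v r = U" "value_from_within E \<xi> r = G"
      using U G by (auto intro!: value_from_within_const[OF E(1) rE])
    then have "U = 0" "G = 0" using val[OF E(1) r] by auto
    moreover have "\<tau> x = 0"
      using val[OF E(1)] by (intro XX_h_zero_if_vertex_values_zero[OF S(1) E(1) _ E(2)]) auto
    ultimately show ?thesis using U G E(2) by auto
  qed
  then show ?thesis by (simp add: ye)
qed

lemma solution_iff:
  "MSMFE0_solution \<Omega> \<Gamma>D \<T> A f g \<sigma> u \<gamma> \<longleftrightarrow>
     (\<sigma>, u, \<gamma>) \<in> discrete_space \<and> (\<forall>y\<in>discrete_space. mixed_form (\<sigma>, u, \<gamma>) y = load f g y)"
proof (intro iffI conjI ballI)
  assume sol: "MSMFE0_solution \<Omega> \<Gamma>D \<T> A f g \<sigma> u \<gamma>"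
  then show "(\<sigma>, u, \<gamma>) \<in> discrete_space" by (simp add: MSMFE0_solution_def discrete_space_def)
  fix y assume "y \<in> discrete_space"
  then show "mixed_form (\<sigma>, u, \<gamma>) y = load f g y"
    using sol by (auto simp: MSMFE0_solution_def discrete_space_def)
next
  assume sol: "(\<sigma>, u, \<gamma>) \<in> discrete_space \<and> (\<forall>y\<in>discrete_space. mixed_form (\<sigma>, u, \<gamma>) y = load f g y)"
  have eq: "mixed_form (\<sigma>, u, \<gamma>) (\<tau>, v, \<xi>) = load f g (\<tau>, v, \<xi>)"
    if "\<tau> \<in> XX_h \<Omega> \<Gamma>D \<T>" "v \<in> VV_h \<Omega> \<T>" "\<xi> \<in> WW_h0 \<Omega> \<T>" for \<tau> v \<xi>
    using sol that by (simp add: discrete_space_def)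
  show "MSMFE0_solution \<Omega> \<Gamma>D \<T> A f g \<sigma> u \<gamma>"
    unfolding MSMFE0_solution_def
  proof (intro conjI ballI)
    show "\<sigma> \<in> XX_h \<Omega> \<Gamma>D \<T>" "u \<in> VV_h \<Omega> \<T>" "\<gamma> \<in> WW_h0 \<Omega> \<T>"
      using sol by (auto simp: discrete_space_def)
    show "quad \<T> A \<sigma> \<tau> + L2_inner \<Omega> u (weak_div \<Omega> \<tau>) + L2_inner \<Omega> \<gamma> \<tau> = boundary_pairing \<Omega> \<Gamma>D \<T> g \<tau>"
      if "\<tau> \<in> XX_h \<Omega> \<Gamma>D \<T>" for \<tau>
      using eq[OF that zero_in_spaces(2,3)] by (simp add: zero_negligible)
    show "L2_inner \<Omega> (weak_div \<Omega> \<sigma>) v = L2_inner \<Omega> f v" if "v \<in> VV_h \<Omega> \<T>" for v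
      using eq[OF zero_in_spaces(1) that zero_in_spaces(3)] by (simp add: zero_negligible)
    show "L2_inner \<Omega> \<sigma> \<xi> = 0" if "\<xi> \<in> WW_h0 \<Omega> \<T>" for \<xi>
      using eq[OF zero_in_spaces(1,2) that] by (simp add: zero_negligible)
  qed
qed

lemma solution_exists:
  assumes f: "f \<in> L2 \<Omega>" and g: "g \<in> L2_facets (facets_in \<Omega> \<T> \<Gamma>D)"
  shows "\<exists>\<sigma> u \<gamma>. MSMFE0_solution \<Omega> \<Gamma>D \<T> A f g \<sigma> u \<gamma>"
proof -
  have negligible: "mixed_form x y = 0" "load f g y = 0" "mixed_form y x = 0"
    if "y \<in> discrete_space" "vanishes_on_elements y" for x y
  proof -
    obtain \<tau> v \<xi> where ye: "y = (\<tau>, v, \<xi>)" by (cases y)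
    obtain \<sigma> u \<gamma> where xe: "x = (\<sigma>, u, \<gamma>)" by (cases x)
    note neg = vanishing_negligible[OF that[unfolded ye]]
    show "mixed_form x y = 0" "load f g y = 0" "mixed_form y x = 0" by (simp_all add: xe ye neg)
  qed
  obtain x where x: "x \<in> discrete_space" "\<And>y. y \<in> discrete_space \<Longrightarrow> mixed_form x y = load f g y"
  proof (rule finite_dimensional_variational_problem_solvable[OF finite_vertex_functionals zero_triple(1),
        where comb = add_scaled and B = mixed_form and l = vertex_functional and L = "load f g"])
    show "mixed_form x y = 0" if "y \<in> discrete_space" "\<forall>i\<in>vertex_functionals. vertex_functional i y = 0" for x y
      using that negligible(1) vanishes_if_vertex_functionals_zero by blast
    show "load f g y = 0" if "y \<in> discrete_space" "\<forall>x\<in>discrete_space. mixed_form x y = 0" for y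
      using that negligible(2) mixed_form_right_kernel by blast
    show "mixed_form (\<lambda>_. 0, \<lambda>_. 0, \<lambda>_. 0) y = 0" for y
      using negligible(3)[OF zero_triple] .
  qed (use discrete_space_add_scaled vertex_functional_linear mixed_form_linear_left mixed_form_linear_right
      load_linear[OF f g] in blast)+
  obtain \<sigma> u \<gamma> where "x = (\<sigma>, u, \<gamma>)" by (cases x)
  with x have "MSMFE0_solution \<Omega> \<Gamma>D \<T> A f g \<sigma> u \<gamma>" unfolding solution_iff by simp
  then show ?thesis by blast
qed

lemma solution_unique:
  assumes "MSMFE0_solution \<Omega> \<Gamma>D \<T> A f g \<sigma> u \<gamma>" "MSMFE0_solution \<Omega> \<Gamma>D \<T> A f g \<sigma>' u' \<gamma>'"
  shows "AE x in lebesgue_on \<Omega>. \<sigma> x = \<sigma>' x \<and> u x = u' x \<and> \<gamma> x = \<gamma>' x"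
proof -
  have x: "(\<sigma>, u, \<gamma>) \<in> discrete_space" "(\<sigma>', u', \<gamma>') \<in> discrete_space"
    and eq: "\<And>y. y \<in> discrete_space \<Longrightarrow> mixed_form (\<sigma>, u, \<gamma>) y = mixed_form (\<sigma>', u', \<gamma>') y"
    using assms by (auto simp: solution_iff)
  let ?d = "add_scaled (-1) (\<sigma>', u', \<gamma>') (\<sigma>, u, \<gamma>)"
  have "vanishes_on_elements ?d"
  proof (rule mixed_form_left_kernel)
    show "?d \<in> discrete_space" using x by (intro discrete_space_add_scaled)
    show "mixed_form ?d y = 0" if "y \<in> discrete_space" for y
      using linear_wrtD[OF mixed_form_linear_left[OF that] x(2,1), of "-1"] eq[OF that] by simp
  qed
  then show ?thesis
    using AE_in_element_interior by (auto elim!: eventually_mono)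
qed

end

theorem theorem3p1:
  fixes \<Omega> \<Gamma>D \<Gamma>N :: "(real^'n) set"
    and H :: "real set"
    and \<T> :: "real \<Rightarrow> (real^'n) set set"
    and A :: "real^'n \<Rightarrow> (real^'n^'n) \<Rightarrow>\<^sub>L (real^'n^'n)"
    and f g :: "real^'n \<Rightarrow> real^'n"
    and h :: real
  assumes dim: "CARD('n) = 2 \<or> CARD('n) = 3"
    and domain: "polyhedral_domain \<Omega>" "simply_connected \<Omega>"
    and boundary: "frontier \<Omega> = \<Gamma>D \<union> \<Gamma>N" "\<Gamma>D \<noteq> {}"
    and mesh: "\<And>h. h \<in> H \<Longrightarrow> fe_partition \<Omega> (\<T> h)"
      "\<And>h. h \<in> H \<Longrightarrow> mesh_size (\<T> h) = h"
      "\<And>h. h \<in> H \<Longrightarrow> resolves_boundary_parts \<Omega> \<Gamma>D \<Gamma>N (\<T> h)"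
      "shape_regular H \<T>" "quasi_uniform H \<T>"
    and compliance: "compliance_tensor (closure \<Omega>) A"
    and h: "h \<in> H"
    and f: "f \<in> L2 \<Omega>"
    and g: "g \<in> L2_facets (facets_in \<Omega> (\<T> h) \<Gamma>D)"
  shows "(\<exists>\<sigma> u \<gamma>. MSMFE0_solution \<Omega> \<Gamma>D (\<T> h) A f g \<sigma> u \<gamma>) \<and>
    (\<forall>\<sigma> u \<gamma> \<sigma>' u' \<gamma>'.
       MSMFE0_solution \<Omega> \<Gamma>D (\<T> h) A f g \<sigma> u \<gamma> \<and>
       MSMFE0_solution \<Omega> \<Gamma>D (\<T> h) A f g \<sigma>' u' \<gamma>' \<longrightarrow>
       (AE x in lebesgue_on \<Omega>. \<sigma> x = \<sigma>' x \<and> u x = u' x \<and> \<gamma> x = \<gamma>' x))"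
proof -
  interpret msmfe_problem \<Omega> "\<T> h" \<Gamma>D A
  proof
    show "polyhedral_domain \<Omega>" "fe_partition \<Omega> (\<T> h)"
      using domain(1) mesh(1)[OF h] .
    show "\<exists>a>0. \<forall>x\<in>closure \<Omega>. \<forall>M. a * (norm M)\<^sup>2 \<le> blinfun_apply (A x) M \<bullet> M"
      using compliance unfolding compliance_tensor_def by (elim conjE)
    show "facets_in \<Omega> (\<T> h) \<Gamma>D \<noteq> {}"
      using mesh(3)[OF h] boundary(2) by (auto simp: resolves_boundary_parts_def)
  qed
  show ?thesis
    using solution_exists[OF f g] solution_unique by blast
qed

end
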